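(* Consider the problem, setting and Majorized ADMM described in the context, with $\sigma>0$, $\tau>0$ and self-adjoint positive semidefinite $\mathcal{S},\mathcal{T}$. Suppose that the solution set of the problem is nonempty and that there exists $(\hat u,\hat v)\in\mathrm{ri}(\mathrm{dom}(p)\times\mathrm{dom}(q))$ with $\mathcal{A}^*\hat u+\mathcal{B}^*\hat v=c$. Assume one of the following holds: (i) $\tau\in(0,1]$ and $\mathcal{O}_1:=\frac14\mathcal{Q}+\mathrm{Diag}(\mathcal{S}+(1-\tau)\sigma\mathcal{A}\mathcal{A}^*,\ \mathcal{T}+(1-\tau)\sigma\mathcal{B}\mathcal{B}^* )\succ0$; (ii) $\tau\in(0,\frac{1+\sqrt5}{2})$, $\frac14\mathcal{Q}+\mathrm{Diag}(\mathcal{S}-\eta\mathcal{D}_1,\mathcal{T}-\eta\mathcal{D}_2)\succeq0$ and $\mathcal{O}_2:=\frac14\mathcal{Q}+\mathrm{Diag}(\mathcal{S}+\sigma\mathcal{A}\mathcal{A}^*-\eta\mathcal{D}_1,\ \mathcal{T}+\sigma\mathcal{B}\mathcal{B}^*-\eta\mathcal{D}_2)\succ0$. Then there exists a constant $C$, depending only on the initial point and the optimal solution set (in particular independent of $k$), such that the generated sequence satisfies for all $k\ge1$ $$\min_{1\le i\le k}\Big\{\mathrm{dist}^2\big(0,F(u^{i+1},v^{i+1},x^{i+1})\big)+\|\mathcal{A}^*u^{i+1}+\mathcal{B}^*v^{i+1}-c\|^2\Big\}\le C/k,$$ and moreover $$\lim_{k\to\infty}k\Big(\min_{1\le i\le 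k}\Big\{\mathrm{dist}^2\big(0,F(u^{i+1},v^{i+1},x^{i+1})\big)+\|\mathcal{A}^*u^{i+1}+\mathcal{B}^*v^{i+1}-c\|^2\Big\}\Big)=0.$$
   Context: $\mathcal{U},\mathcal{V},\mathcal{X}$ are real finite-dimensional Euclidean spaces. $p:\mathcal{U}\to(-\infty,\infty]$ and $q:\mathcal{V}\to(-\infty,\infty]$ are closed proper convex functions; $\phi:\mathcal{U}\times\mathcal{V}\to\mathbb{R}$ is a smooth convex function with globally Lipschitz continuous gradient; $\mathcal{A}:\mathcal{X}\to\mathcal{U}$, $\mathcal{B}:\mathcal{X}\to\mathcal{V}$ are linear, $c\in\mathcal{X}$. The problem is $\min_{u,v}\ p(u)+q(v)+\phi(u,v)$ subject to $\mathcal{A}^*u+\mathcal{B}^*v=c$. Write $w=(u,v)$. For self-adjoint positive semidefinite $\mathcal{G}$, $\|z\|_{\mathcal{G}}^2=\langle z,\mathcal{G}z\rangle$. $\partial^2\phi(w)$ is Clarke's generalized Hessian (convex hull of limits of $\nabla^2\phi(w^j)$, $w^j\to w$, at points where $\nabla^2\phi$ exists). $\mathcal{Q},\mathcal{H}$ are self-adjoint positive semidefinite operators on $\mathcal{U}\times\mathcal{V}$ with $\mathcal{Q}\preceq\mathcal{W}\preceq\mathcal{Q}+\mathcal{H}$ for all $\mathcal{W}\in\partial^2\phi(w)$, all $w$; $\mathcal{H}=\mathrm{Diag}(\mathcal{D}_1,\mathcal{D}_2)$ with $\mathcal{D}_1,\mathcal{D}_2$ self-adjoint positive semidefinite. Blocks: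 $\mathcal{Q}=\begin{pmatrix}\mathcal{Q}_{11}&\mathcal{Q}_{12}\\ \mathcal{Q}_{12}^*&\mathcal{Q}_{22}\end{pmatrix}$, similarly for $\mathcal{W}$. $\eta\in[0,1]$ is a constant with $|\langle u,(\mathcal{W}_{12}-\mathcal{Q}_{12})v\rangle|\le\frac{\eta}{2}(\|u\|_{\mathcal{D}_1}^2+\|v\|_{\mathcal{D}_2}^2)$ for all $\mathcal{W}\in\partial^2\phi(z)$, all $z$, all $u\in\mathcal{U},v\in\mathcal{V}$. $F$ is the set-valued map $F(u,v,x)=\nabla\phi(w)+\begin{pmatrix}\partial p(u)+\mathcal{A}x\\ \partial q(v)+\mathcal{B}x\end{pmatrix}$, and $\mathrm{dist}(0,S)$ is the Euclidean distance from $0$ to a set $S$. Majorized ADMM: $\hat\phi(w;w')=\phi(w')+\langle\nabla\phi(w'),w-w'\rangle+\frac12\|w-w'\|^2_{\mathcal{Q}+\mathcal{H}}$, $\widehat{\mathcal{L}}_\sigma(w;(x,w'))=p(u)+q(v)+\hat\phi(w;w')+\langle x,\mathcal{A}^*u+\mathcal{B}^*v-c\rangle+\frac{\sigma}{2}\|\mathcal{A}^*u+\mathcal{B}^*v-c\|^2$. Given $(u^0,v^0,x^0)\in\mathrm{dom}(p)\times\mathrm{dom}(q)\times\mathcal{X}$, for $k=0,1,\dots$: $u^{k+1}=\arg\min_u\{\widehat{\mathcal{L}}_\sigma(u,v^k;(x^k,w^k))+\frac12\|u-u^k\|_{\mathcal{S}}^2\}$; $v^{k+1}=\arg\min_v\{\widehat{\mathcal{L}}_\sigma(u^{k+1},v;(x^k,w^k))+\frac12\|v-v^k\|_{\mathcal{T}}^2\}$;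 $x^{k+1}=x^k+\tau\sigma(\mathcal{A}^*u^{k+1}+\mathcal{B}^*v^{k+1}-c)$. *)

theory Defs
  imports "HOL-Analysis.Analysis"
begin

text \<open>Convexity of an extended-real-valued function (values in (-inf, +inf]);
  ereal arithmetic uses 0 * inf = 0.\<close>
definition ext_convex :: "('a::real_vector \<Rightarrow> ereal) \<Rightarrow> bool" where
  "ext_convex f \<longleftrightarrow>
     (\<forall>x y t. 0 \<le> t \<and> t \<le> 1 \<longrightarrow>
        f ((1 - t) *\<^sub>R x + t *\<^sub>R y) \<le> ereal (1 - t) * f x + ereal t * f y)"

definition closed_proper_convex :: "('a::real_normed_vector \<Rightarrow> ereal) \<Rightarrow> bool" where
  "closed_proper_convex f \<longleftrightarrow>
     ext_convex f \<and> (\<forall>x. f x \<noteq> -\<infinity>) \<and> (\<exists>x. f x \<noteq> \<infinity>) \<and>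
     (\<forall>a. closed {x. f x \<le> ereal a})"

definition edom :: "('a \<Rightarrow> ereal) \<Rightarrow> 'a set" where
  "edom f = {x. f x < \<infinity>}"

definition subdiff :: "('a::real_inner \<Rightarrow> ereal) \<Rightarrow> 'a \<Rightarrow> 'a set" where
  "subdiff f x = {g. f x < \<infinity> \<and> (\<forall>z. f x + ereal (g \<bullet> (z - x)) \<le> f z)}"

definition sa_psd :: "('a::real_inner \<Rightarrow> 'a) \<Rightarrow> bool" where
  "sa_psd G \<longleftrightarrow> linear G \<and> (\<forall>x y. G x \<bullet> y = x \<bullet> G y) \<and> (\<forall>x. 0 \<le> x \<bullet> G x)"

definition op_psd :: "('a::real_inner \<Rightarrow> 'a) \<Rightarrow> bool" where
  "op_psd G \<longleftrightarrow> (\<forall>x. 0 \<le> x \<bullet> G x)"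

definition op_pd :: "('a::real_inner \<Rightarrow> 'a) \<Rightarrow> bool" where
  "op_pd G \<longleftrightarrow> (\<forall>x. x \<noteq> 0 \<longrightarrow> 0 < x \<bullet> G x)"

definition loewner_le :: "('a::real_inner \<Rightarrow> 'a) \<Rightarrow> ('a \<Rightarrow> 'a) \<Rightarrow> bool" where
  "loewner_le G1 G2 \<longleftrightarrow> (\<forall>z. z \<bullet> G1 z \<le> z \<bullet> G2 z)"

definition gnorm2 :: "('a::real_inner \<Rightarrow> 'a) \<Rightarrow> 'a \<Rightarrow> real" where
  "gnorm2 G z = z \<bullet> G z"

definition diag_op :: "('u \<Rightarrow> 'u) \<Rightarrow> ('v \<Rightarrow> 'v) \<Rightarrow> 'u \<times> 'v \<Rightarrow> 'u \<times> 'v" where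
  "diag_op D1 D2 = (\<lambda>(u, v). (D1 u, D2 v))"

definition block12 :: "('u::zero \<times> 'v::zero \<Rightarrow> 'u \<times> 'v) \<Rightarrow> 'v \<Rightarrow> 'u" where
  "block12 G v = fst (G (0, v))"

definition gen_hessian ::
  "('a::euclidean_space \<Rightarrow> 'a) \<Rightarrow> 'a \<Rightarrow> ('a \<Rightarrow>\<^sub>L 'a) set" where
  "gen_hessian grad w = convex hull
     {W. \<exists>ws Ws. (\<forall>j. (grad has_derivative blinfun_apply (Ws j)) (at (ws j))) \<and>
                 ws \<longlonglongrightarrow> w \<and> Ws \<longlonglongrightarrow> W}"

definition objective ::
  "('u \<Rightarrow> ereal) \<Rightarrow> ('v \<Rightarrow> ereal) \<Rightarrow> ('u \<times> 'v \<Rightarrow> real) \<Rightarrow> 'u \<times> 'v \<Rightarrow> ereal" where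
  "objective p q \<phi> w = p (fst w) + q (snd w) + ereal (\<phi> w)"

definition constr ::
  "('x::euclidean_space \<Rightarrow> 'u::euclidean_space) \<Rightarrow> ('x \<Rightarrow> 'v::euclidean_space) \<Rightarrow> 'x
     \<Rightarrow> 'u \<times> 'v \<Rightarrow> 'x" where
  "constr A B c w = adjoint A (fst w) + adjoint B (snd w) - c"

definition solution_set ::
  "('u::euclidean_space \<Rightarrow> ereal) \<Rightarrow> ('v::euclidean_space \<Rightarrow> ereal) \<Rightarrow> ('u \<times> 'v \<Rightarrow> real)
    \<Rightarrow> ('x::euclidean_space \<Rightarrow> 'u) \<Rightarrow> ('x \<Rightarrow> 'v) \<Rightarrow> 'x \<Rightarrow> ('u \<times> 'v) set" where
  "solution_set p q \<phi> A B c =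
     {w. constr A B c w = 0 \<and>
         (\<forall>w'. constr A B c w' = 0 \<longrightarrow> objective p q \<phi> w \<le> objective p q \<phi> w')}"

definition phi_hat ::
  "('a::real_inner \<Rightarrow> real) \<Rightarrow> ('a \<Rightarrow> 'a) \<Rightarrow> ('a \<Rightarrow> 'a) \<Rightarrow> 'a \<Rightarrow> 'a \<Rightarrow> real" where
  "phi_hat \<phi> grad QH w w' = \<phi> w' + grad w' \<bullet> (w - w') + 1/2 * gnorm2 QH (w - w')"

definition L_hat ::
  "('u::euclidean_space \<Rightarrow> ereal) \<Rightarrow> ('v::euclidean_space \<Rightarrow> ereal) \<Rightarrow> ('u \<times> 'v \<Rightarrow> real)
    \<Rightarrow> ('u \<times> 'v \<Rightarrow> 'u \<times> 'v) \<Rightarrow> ('u \<times> 'v \<Rightarrow> 'u \<times> 'v)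
    \<Rightarrow> ('x::euclidean_space \<Rightarrow> 'u) \<Rightarrow> ('x \<Rightarrow> 'v) \<Rightarrow> 'x \<Rightarrow> real
    \<Rightarrow> 'u \<times> 'v \<Rightarrow> 'x \<Rightarrow> 'u \<times> 'v \<Rightarrow> ereal" where
  "L_hat p q \<phi> grad QH A B c \<sigma> w x w' =
     p (fst w) + q (snd w) +
     ereal (phi_hat \<phi> grad QH w w' + x \<bullet> constr A B c w + \<sigma> / 2 * (norm (constr A B c w))\<^sup>2)"

definition F_map ::
  "('u::euclidean_space \<Rightarrow> ereal) \<Rightarrow> ('v::euclidean_space \<Rightarrow> ereal) \<Rightarrow> ('u \<times> 'v \<Rightarrow> 'u \<times> 'v)
    \<Rightarrow> ('x::euclidean_space \<Rightarrow> 'u) \<Rightarrow> ('x \<Rightarrow> 'v) \<Rightarrow> 'u \<Rightarrow> 'v \<Rightarrow> 'x \<Rightarrow> ('u \<times> 'v) set" where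
  "F_map p q grad A B u v x =
     {grad (u, v) + (g + A x, h + B x) | g h. g \<in> subdiff p u \<and> h \<in> subdiff q v}"

definition residual ::
  "('u::euclidean_space \<Rightarrow> ereal) \<Rightarrow> ('v::euclidean_space \<Rightarrow> ereal) \<Rightarrow> ('u \<times> 'v \<Rightarrow> 'u \<times> 'v)
    \<Rightarrow> ('x::euclidean_space \<Rightarrow> 'u) \<Rightarrow> ('x \<Rightarrow> 'v) \<Rightarrow> 'x \<Rightarrow> 'u \<Rightarrow> 'v \<Rightarrow> 'x \<Rightarrow> real" where
  "residual p q grad A B c u v x =
     (infdist 0 (F_map p q grad A B u v x))\<^sup>2 + (norm (constr A B c (u, v)))\<^sup>2"

end

theory Submission
  imports Defs
begin

text \<open>
  Since the generalized Hessian only records points where the gradient is differentiable, the Hessian bounds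
  are turned into bounds for gradient increments by Rademacher's theorem: a Lipschitz map has directional
  derivatives almost everywhere on lines (Vitali covering), and it is differentiable at every point where
  the closed sets on which the partial difference quotients are almost constant are not porous.
  A Tonelli argument then gives a mean value inequality for Lipschitz maps. Applied to the gradient of
  \<open>\<psi> = \<phi> - Q/2\<close>, it shows that \<open>\<psi>\<close> is convex, that its Bregman distances are at most half the squared \<open>H\<close>-norm,
  and that its mixed second differences obey the \<open>\<eta>\<close>-bound.

  Slater's condition yields a multiplier by supporting the epigraph of the value function at the optimum.
  Comparing the optimality conditions of the two block steps with the KKT conditions gives a one-step
  inequality in which all error terms telescope, except for a multiple of \<open>\<langle>r\<^sup>+, B\<^sup>* \<Delta>v\<rangle>\<close>. It is completed to a
  square in case (i); in case (ii) it is rewritten with the monotonicity of the subdifferential of \<open>q\<close>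
  between two consecutive iterates. Either way the squared step lengths and constraint violations, and with
  them the residuals, are summable, and the minimum of the first \<open>k\<close> terms of a summable sequence is \<open>o(1/k)\<close>.
\<close>

section \<open>Directional derivatives of Lipschitz functions\<close>

text \<open>After \<open>Q\<close> is split off, all Hessians of the remaining function lie between
  0 and \<open>H\<close>; \<open>Q\<close> then enters the iteration as an exact quadratic form and
  only \<open>H\<close> as an error. Both block steps use the gradient at the old point. The
  resulting loss, the squared \<open>H\<close>-norm of the increment, is cancelled exactly by what
  is released when the proximal term with \<open>H\<close> telescopes; hence no multiple of
  \<open>H\<close> in condition (i). The quarter of \<open>Q\<close> arises because the increment is
  the difference of two successive errors: half of their squared \<open>Q\<close>-norms pays for a
  quarter of that of the increment. The constant \<eta> belongs to the comparison of two consecutive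
  v-steps: between them the gradient has also moved because u moved, and \<eta> measures this mixed
  effect. Positive definiteness is used only at the end, to pass from the seminorms that descent
  controls to the full norm of the increment. Throughout, derivatives of the gradient exist only
  almost everywhere; integral formulas for gradient increments and the symmetry of Hessian blocks
  are therefore replaced by Bregman inequalities and second differences.\<close>

lemma Vitali_covering_intervals:
  fixes E :: "real set" and P :: "real \<Rightarrow> real \<Rightarrow> bool"
  assumes "open U" "E \<subseteq> U"
    and P: "\<And>x d. x \<in> E \<Longrightarrow> 0 < d \<Longrightarrow> \<exists>y z. y < z \<and> y \<le> x \<and> x \<le> z \<and> z - y < d \<and> P y z"
  obtains C where "countable C"
    "\<And>y z. (y, z) \<in> C \<Longrightarrow> y < z \<and> {y..z} \<subseteq> U \<and> P y z"
    "disjoint_family_on (\<lambda>i. {fst i..snd i}) C"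
    "negligible (E - (\<Union>i\<in>C. {fst i..snd i}))"
proof -
  define K where "K = {(y, z). y < z \<and> {y..z} \<subseteq> U \<and> P y z}"
  \<comment> \<open>The point x may be an endpoint of its interval. This is harmless: each interval
    is a closed ball around its own midpoint, and the covering theorem only asks that x lie in the
    ball.\<close>
  let ?a = "\<lambda>i::real\<times>real. (fst i + snd i) / 2" and ?r = "\<lambda>i::real\<times>real. (snd i - fst i) / 2"
  have cb: "cball (?a i) (?r i) = {fst i..snd i}" for i
    by (simp add: cball_eq_atLeastAtMost field_simps)
  have r: "0 < ?r i" if "i \<in> K" for i
    using that by (auto simp: K_def)
  have S: "\<exists>i. i \<in> K \<and> x \<in> cball (?a i) (?r i) \<and> ?r i < d" if x: "x \<in> E" and d: "0 < d" for x d
  proof -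
    obtain e where e: "e > 0" "ball x e \<subseteq> U"
      using assms x by (meson openE subsetD)
    obtain y z where yz: "y < z" "y \<le> x" "x \<le> z" "z - y < min d e" "P y z"
      using P[OF x, of "min d e"] d e by auto
    have "{y..z} \<subseteq> ball x e"
      using yz by (auto simp: dist_real_def)
    then have "(y, z) \<in> K"
      using yz e by (auto simp: K_def)
    moreover have "x \<in> cball (?a (y, z)) (?r (y, z))"
      using yz by (subst cb) auto
    ultimately show ?thesis
      using yz by (intro exI[of _ "(y, z)"]) auto
  qed
  obtain C where C: "countable C" "C \<subseteq> K"
     "pairwise (\<lambda>i j. disjnt (cball (?a i) (?r i)) (cball (?a j) (?r j))) C"
     "negligible(E - (\<Union>i \<in> C. cball (?a i) (?r i)))"
    by (rule Vitali_covering_theorem_cballs[of K ?r E ?a, OF r S])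
  show ?thesis
  proof
    show "countable C" by (rule C(1))
    show "y < z \<and> {y..z} \<subseteq> U \<and> P y z" if "(y, z) \<in> C" for y z
      using that C(2) by (auto simp: K_def)
    show "disjoint_family_on (\<lambda>i. {fst i..snd i}) C"
      using C(3) unfolding cb by (auto simp: pairwise_def disjnt_def disjoint_family_on_def)
    show "negligible (E - (\<Union>i\<in>C. {fst i..snd i}))"
      using C(4) unfolding cb .
  qed
qed

text \<open>Two nested Vitali coverings, compared through the Stieltjes measure of \<open>f\<close>.
  Intervals of slope at most \<open>a\<close>, inside an open set barely larger than
  \<open>E\<close>, form a set of Stieltjes measure at most \<open>a * (s + e)\<close>; intervals of
  slope at least \<open>b\<close>, chosen inside that set, still cover almost all of
  \<open>E\<close> and force at least \<open>b * s\<close>.\<close>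

lemma mono_slope_gap_null:
  fixes f :: "real \<Rightarrow> real"
  assumes mono: "\<And>x y. x \<le> y \<Longrightarrow> f x \<le> f y" and cont: "continuous_on UNIV f"
    and E: "E \<in> sets borel" "bounded E" and ab: "0 \<le> a" "a < b"
    and lo: "\<And>x d. x \<in> E \<Longrightarrow> 0 < d \<Longrightarrow>
       \<exists>y z. y < z \<and> y \<le> x \<and> x \<le> z \<and> z - y < d \<and> f z - f y \<le> a * (z - y)"
    and hi: "\<And>x d. x \<in> E \<Longrightarrow> 0 < d \<Longrightarrow>
       \<exists>y z. y < z \<and> y \<le> x \<and> x \<le> z \<and> z - y < d \<and> b * (z - y) \<le> f z - f y"
  shows "emeasure lborel E = 0"
proof -
  let ?m = "emeasure (interval_measure f)" and ?l = "emeasure lborel"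
  have mu: "?m {y..z} = ennreal (f z - f y)" if "y \<le> z" for y z
    by (rule emeasure_interval_measure_Icc[OF that mono cont])
  define s where "s = measure lborel E"
  have s: "?l E = ennreal s" "0 \<le> s"
    unfolding s_def using emeasure_bounded_finite[OF E(2)]
    by (auto simp: emeasure_eq_ennreal_measure less_top)
  have "b * s \<le> a * (s + e)" if e: "0 < e" for e
  proof -
    obtain U where U: "open U" "E \<subseteq> U" "?l (U - E) < ennreal e"
      using outer_regular_lborel[OF E(1) e] by blast
    have "?l U = ?l E + ?l (U - E)"
      using U E by (subst plus_emeasure) (auto simp: Un_absorb1)
    also have "\<dots> \<le> ennreal s + ennreal e"
      using U s by (intro add_mono) auto
    finally have lU: "?l U \<le> ennreal (s + e)"
      using e s by simp
    obtain C where C: "countable C"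
      "\<And>y z. (y, z) \<in> C \<Longrightarrow> y < z \<and> {y..z} \<subseteq> U \<and> f z - f y \<le> a * (z - y)"
      "disjoint_family_on (\<lambda>i. {fst i..snd i}) C"
      "negligible (E - (\<Union>i\<in>C. {fst i..snd i}))"
      by (rule Vitali_covering_intervals[OF U(1,2), of "\<lambda>y z. f z - f y \<le> a * (z - y)"])
        (use lo in auto)
    \<comment> \<open>Open interiors are taken so that the second covering can be confined to
      \<open>V\<close>; only countably many endpoints are lost.\<close>
    define V where "V = (\<Union>i\<in>C. {fst i<..<snd i})"
    have oV: "open V" by (auto simp: V_def)
    have "?m V \<le> ?m (\<Union>i\<in>C. {fst i..snd i})"
      using C(1) by (intro emeasure_mono) (force simp: V_def intro!: sets.countable_UN')+
    also have "\<dots> = (\<integral>\<^sup>+i. ?m {fst i..snd i} \<partial>count_space C)"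
      using C by (intro emeasure_UN_countable) auto
    also have "\<dots> \<le> (\<integral>\<^sup>+i. ennreal a * ?l {fst i..snd i} \<partial>count_space C)"
    proof (intro nn_integral_mono)
      fix i assume "i \<in> space (count_space C)"
      then have i: "i \<in> C" by simp
      then have "fst i < snd i" "f (snd i) - f (fst i) \<le> a * (snd i - fst i)"
        using C(2)[of "fst i" "snd i"] by auto
      then show "?m {fst i..snd i} \<le> ennreal a * ?l {fst i..snd i}"
        using ab by (simp add: mu ennreal_mult[symmetric] ennreal_leI)
    qed
    also have "\<dots> = ennreal a * (\<integral>\<^sup>+i. ?l {fst i..snd i} \<partial>count_space C)"
      by (rule nn_integral_cmult) auto
    also have "(\<integral>\<^sup>+i. ?l {fst i..snd i} \<partial>count_space C) = ?l (\<Union>i\<in>C. {fst i..snd i})"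
      using C by (intro emeasure_UN_countable[symmetric]) auto
    also have "\<dots> \<le> ?l U"
      using C(2) U by (intro emeasure_mono) force+
    also note lU
    finally have muV: "?m V \<le> ennreal a * ennreal (s + e)"
      by (simp add: mult_left_mono)
    have "negligible (\<Union>i\<in>C. {fst i, snd i})"
      using C(1) by (intro iffD2[OF negligible_iff_null_sets] null_sets_completionI countable_imp_null_set_lborel) auto
    then have neg: "negligible (E - V)"
      using C(4) by (rule negligible_subset[OF negligible_Un]) (force simp: V_def)
    have EV: "E \<inter> V \<in> sets borel" using E oV by auto
    have "E - V \<in> null_sets lborel"
      using neg E oV by (simp add: negligible_iff_null_sets null_sets_completion_iff)
    then have "?l E = ?l (E \<inter> V)"
      using E(1) oV by (metis Diff_Diff_Int emeasure_Diff_null_set sets_lborel)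
    also obtain D where D: "countable D"
      "\<And>y z. (y, z) \<in> D \<Longrightarrow> y < z \<and> {y..z} \<subseteq> V \<and> b * (z - y) \<le> f z - f y"
      "disjoint_family_on (\<lambda>i. {fst i..snd i}) D"
      "negligible (E \<inter> V - (\<Union>i\<in>D. {fst i..snd i}))"
      by (rule Vitali_covering_intervals[OF oV Int_lower2, of E "\<lambda>y z. b * (z - y) \<le> f z - f y"])
        (use hi in auto)
    have mD: "(\<Union>i\<in>D. {fst i..snd i}) \<in> sets borel"
      using D(1) by (intro sets.countable_UN') auto
    have "E \<inter> V - (\<Union>i\<in>D. {fst i..snd i}) \<in> null_sets lborel"
      using D(4) EV mD by (simp add: negligible_iff_null_sets null_sets_completion_iff)
    then have "?l (E \<inter> V) = ?l (E \<inter> V \<inter> (\<Union>i\<in>D. {fst i..snd i}))"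
      using EV mD by (metis Diff_Diff_Int emeasure_Diff_null_set sets_lborel)
    also have "\<dots> \<le> ?l (\<Union>i\<in>D. {fst i..snd i})"
      using mD by (intro emeasure_mono) auto
    also have "\<dots> = (\<integral>\<^sup>+i. ?l {fst i..snd i} \<partial>count_space D)"
      using D by (intro emeasure_UN_countable) auto
    finally have "ennreal b * ?l E \<le> ennreal b * (\<integral>\<^sup>+i. ?l {fst i..snd i} \<partial>count_space D)"
      by (intro mult_left_mono) auto
    also have "\<dots> = (\<integral>\<^sup>+i. ennreal b * ?l {fst i..snd i} \<partial>count_space D)"
      by (rule nn_integral_cmult[symmetric]) auto
    also have "\<dots> \<le> (\<integral>\<^sup>+i. ?m {fst i..snd i} \<partial>count_space D)"
    proof (intro nn_integral_mono)
      fix i assume "i \<in> space (count_space D)"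
      then have i: "i \<in> D" by simp
      then have "fst i < snd i" "b * (snd i - fst i) \<le> f (snd i) - f (fst i)"
        using D(2)[of "fst i" "snd i"] by auto
      then show "ennreal b * ?l {fst i..snd i} \<le> ?m {fst i..snd i}"
        using ab by (simp add: mu ennreal_mult[symmetric] ennreal_leI)
    qed
    also have "\<dots> = ?m (\<Union>i\<in>D. {fst i..snd i})"
      using D by (intro emeasure_UN_countable[symmetric]) auto
    also have "\<dots> \<le> ?m V"
      using D(2) oV by (intro emeasure_mono) force+
    also note muV
    finally have "ennreal (b * s) \<le> ennreal (a * (s + e))"
      using ab s e by (simp add: ennreal_mult)
    then show ?thesis
      using ab s e by (simp add: ennreal_le_iff)
  qed note key = this
  have "s = 0"
  proof (rule ccontr)
    assume "s \<noteq> 0"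
    then have s0: "s > 0" using s by simp
    \<comment> \<open>Chosen so that \<open>a * e\<close> is at most half of the gap
      \<open>(b - a) * s\<close>; the summand 1 in the denominator covers
      \<open>a = 0\<close>.\<close>
    define e where "e = (b - a) * s / (2 * (a + 1))"
    have e: "e > 0" using ab s0 by (simp add: e_def)
    have "a * e \<le> (a + 1) * e" using e by (simp add: algebra_simps)
    also have "\<dots> = (b - a) * s / 2" using ab by (simp add: e_def field_simps)
    finally have "a * (s + e) \<le> a * s + (b - a) * s / 2" by (simp add: algebra_simps)
    moreover have "b * s - a * s > (b - a) * s / 2" using ab s0 by (simp add: field_simps)
    ultimately show False using key[OF e] by linarith
  qed
  then show ?thesis using s by simp
qed

text \<open>Tonelli's theorem for the translates \<open>N - t h\<close>, \<open>0 \<le> t \<le> 1\<close>, which all have the measure of \<open>N\<close>.\<close>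
lemma lborel_line_slices:
  fixes N :: "'a::euclidean_space set" and h :: 'a
  assumes N: "N \<in> sets borel"
  shows "(\<lambda>w. emeasure lborel {t\<in>{0..1::real}. w + t *\<^sub>R h \<in> N}) \<in> borel_measurable lborel" (is ?meas)
    and "emeasure lborel N = (\<integral>\<^sup>+w. emeasure lborel {t\<in>{0..1::real}. w + t *\<^sub>R h \<in> N} \<partial>lborel)"
proof -
  let ?l1 = "lborel :: real measure" and ?ln = "lborel :: 'a measure"
  define X where "X = {(w, t). t \<in> {0..1::real} \<and> w + t *\<^sub>R h \<in> N}"
  have "(\<lambda>p. fst p + snd p *\<^sub>R h) \<in> borel_measurable (borel :: ('a \<times> real) measure)"
    by (intro borel_measurable_continuous_onI continuous_intros)
  from measurable_sets[OF this N]
  have "(\<lambda>p. fst p + snd p *\<^sub>R h) -` N \<in> sets (borel :: ('a \<times> real) measure)"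
    by simp
  moreover have "(snd -` {0..1::real} :: ('a \<times> real) set) \<in> sets borel"
    by (intro borel_closed closed_vimage continuous_intros)
  ultimately have "(\<lambda>p. fst p + snd p *\<^sub>R h) -` N \<inter> snd -` {0..1} \<in> sets (borel :: ('a \<times> real) measure)"
    by (rule sets.Int)
  moreover have "(\<lambda>p. fst p + snd p *\<^sub>R h) -` N \<inter> snd -` {0..1} = X"
    by (auto simp: X_def)
  ultimately have "X \<in> sets (borel :: ('a \<times> real) measure)"
    by simp
  then have X: "X \<in> sets (?ln \<Otimes>\<^sub>M ?l1)"
    unfolding lborel_prod by simp
  have tr: "emeasure ?ln {w. w + z \<in> N} = emeasure ?ln N" for z
  proof -
    have "emeasure ?ln N = emeasure (distr ?ln borel ((+) z)) N"
      by (simp add: lborel_distr_plus)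
    also have "\<dots> = emeasure ?ln ((+) z -` N \<inter> space ?ln)"
      by (rule emeasure_distr) (use N in auto)
    finally show ?thesis by (simp add: vimage_def add.commute)
  qed
  have "emeasure ?ln N = (\<integral>\<^sup>+t. emeasure ?ln N * indicator {0..1::real} t \<partial>?l1)"
    by (subst nn_integral_cmult_indicator) auto
  also have "\<dots> = (\<integral>\<^sup>+t. emeasure ?ln ((\<lambda>w. (w, t)) -` X) \<partial>?l1)"
    by (intro nn_integral_cong) (auto simp: X_def vimage_def tr indicator_def)
  also have "\<dots> = emeasure (?ln \<Otimes>\<^sub>M ?l1) X"
    by (rule lborel_pair.emeasure_pair_measure_alt2[OF X, symmetric])
  also have "\<dots> = (\<integral>\<^sup>+w. emeasure ?l1 (Pair w -` X) \<partial>?ln)"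
    by (rule lborel.emeasure_pair_measure_alt[OF X])
  finally show "emeasure lborel N = (\<integral>\<^sup>+w. emeasure lborel {t\<in>{0..1::real}. w + t *\<^sub>R h \<in> N} \<partial>lborel)"
    by (simp add: X_def vimage_def)
  show ?meas
    using lborel.measurable_emeasure_Pair[OF X] by (simp add: X_def vimage_def)
qed

text \<open>The candidate limit is the supremum of all eventual lower bounds. Restricting the gaps
  to rational \<open>a < b\<close> makes divergence a countable union of exceptional events.\<close>

lemma tendsto_if_no_rational_gap:
  fixes q :: "'t \<Rightarrow> real"
  assumes F: "F \<noteq> bot" and bd: "\<forall>\<^sub>F t in F. \<bar>q t\<bar> \<le> M"
    and gap: "\<And>a b. a \<in> \<rat> \<Longrightarrow> b \<in> \<rat> \<Longrightarrow> a < b \<Longrightarrow> (\<forall>\<^sub>F t in F. a \<le> q t) \<or> (\<forall>\<^sub>F t in F. q t \<le> b)"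
  shows "\<exists>l. (q \<longlongrightarrow> l) F"
proof -
  define X where "X = {a. \<forall>\<^sub>F t in F. a \<le> q t}"
  have "- M \<in> X"
    unfolding X_def using bd by (auto elim: eventually_mono)
  have ub: "a \<le> M" if "a \<in> X" for a
  proof -
    have "\<forall>\<^sub>F t in F. a \<le> M"
      using bd that unfolding X_def mem_Collect_eq by eventually_elim auto
    then show ?thesis using F by simp
  qed
  have bdd: "bdd_above X" using ub by (rule bdd_aboveI)
  have "(q \<longlongrightarrow> Sup X) F"
  proof (rule order_tendstoI)
    fix y assume "y < Sup X"
    then obtain a where "a \<in> X" "y < a"
      using \<open>- M \<in> X\<close> bdd by (metis empty_iff less_cSup_iff)
    then show "\<forall>\<^sub>F t in F. y < q t"
      unfolding X_def by (auto elim: eventually_mono)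
  next
    fix y assume y: "Sup X < y"
    obtain a where a: "a \<in> \<rat>" "Sup X < a" "a < y" using Rats_dense_in_real[OF y] by blast
    obtain b where b: "b \<in> \<rat>" "a < b" "b < y" using Rats_dense_in_real[OF a(3)] by blast
    have "a \<notin> X" using a(2) cSup_upper[OF _ bdd, of a] by auto
    then have "\<forall>\<^sub>F t in F. q t \<le> b"
      using gap[OF a(1) b(1,2)] by (simp add: X_def)
    then show "\<forall>\<^sub>F t in F. q t < y"
      using b by (auto elim: eventually_mono)
  qed
  then show ?thesis by blast
qed

text \<open>On each line parallel to \<open>h\<close>, adding \<open>M * s\<close> makes
  \<open>g\<close> nondecreasing and shifts all slopes by \<open>M\<close>, so the monotone case
  applies to every slice and Tonelli finishes. If \<open>a + M < 0\<close>, the set is empty because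
  slopes never fall below \<open>- M\<close>.\<close>

lemma lipschitz_slope_gap_null:
  fixes g :: "'a::euclidean_space \<Rightarrow> real" and h :: 'a
  assumes lip: "L-lipschitz_on UNIV g" and ab: "a < b"
  defines "N \<equiv> {w. \<forall>n::nat. (\<exists>t. t \<noteq> 0 \<and> \<bar>t\<bar> < 1 / Suc n \<and> (g (w + t *\<^sub>R h) - g w) / t < a) \<and>
                          (\<exists>t. t \<noteq> 0 \<and> \<bar>t\<bar> < 1 / Suc n \<and> b < (g (w + t *\<^sub>R h) - g w) / t)}"
  shows "N \<in> null_sets lborel"
proof -
  have L: "L \<ge> 0" by (rule lipschitz_on_nonneg[OF lip])
  have cont: "continuous_on UNIV g" by (rule lipschitz_on_continuous_on[OF lip])
  have conth: "continuous_on UNIV (\<lambda>w. g (w + z))" for z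
    by (rule continuous_on_compose2[OF cont]) (auto intro!: continuous_intros)
  \<comment> \<open>The unions over real \<open>t\<close> are uncountable, but they are unions of
    open sets; only the intersection over \<open>n\<close> has to be countable for \<open>N\<close>
    to be Borel.\<close>
  have "N = (\<Inter>n. (\<Union>t\<in>{t. t \<noteq> 0 \<and> \<bar>t\<bar> < 1 / Suc n}. {w. (g (w + t *\<^sub>R h) - g w) / t < a}) \<inter>
                  (\<Union>t\<in>{t. t \<noteq> 0 \<and> \<bar>t\<bar> < 1 / Suc n}. {w. b < (g (w + t *\<^sub>R h) - g w) / t}))"
    by (auto simp: N_def)
  also have "\<dots> \<in> sets borel"
    by (intro sets.countable_INT'' sets.Int borel_open open_UN ballI open_Collect_less
        continuous_intros conth cont) auto
  finally have N: "N \<in> sets borel" .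
  define M where "M = L * norm h"
  have M: "M \<ge> 0" using L by (simp add: M_def)
  have gM: "\<bar>g (w + s *\<^sub>R h) - g (w + t *\<^sub>R h)\<bar> \<le> M * \<bar>s - t\<bar>" for w s t
    using lipschitz_onD[OF lip, of "w + s *\<^sub>R h" "w + t *\<^sub>R h"]
    by (simp add: M_def dist_norm scaleR_diff_left[symmetric] mult_ac)
  have slice: "emeasure lborel {t\<in>{0..1::real}. w + t *\<^sub>R h \<in> N} = 0" for w
  proof (cases "0 \<le> a + M")
    case True
    define f where "f = (\<lambda>s. g (w + s *\<^sub>R h) + M * s)"
    let ?E = "{t\<in>{0..1::real}. w + t *\<^sub>R h \<in> N}"
    have contf: "continuous_on UNIV f"
      unfolding f_def by (intro continuous_intros continuous_on_compose2[OF cont]) auto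
    show ?thesis
    proof (rule mono_slope_gap_null[of f ?E "a + M" "b + M"])
      show "f x \<le> f y" if "x \<le> y" for x y
        using gM[of w x y] that by (simp add: f_def algebra_simps abs_le_iff)
      have "(\<lambda>t. w + t *\<^sub>R h) \<in> borel_measurable borel"
        by (intro borel_measurable_continuous_onI continuous_intros)
      from measurable_sets[OF this N] have "(\<lambda>t. w + t *\<^sub>R h) -` N \<in> sets borel" by simp
      then have "{0..1} \<inter> (\<lambda>t. w + t *\<^sub>R h) -` N \<in> sets borel" by simp
      then show "?E \<in> sets borel" by (simp add: vimage_def Collect_conj_eq[symmetric] Int_def)
      show "bounded ?E" by (rule bounded_subset[of "{0..1}"]) auto
      show "0 \<le> a + M" "a + M < b + M" using True ab by auto
      show "\<exists>y z. y < z \<and> y \<le> x \<and> x \<le> z \<and> z - y < d \<and> f z - f y \<le> (a + M) * (z - y)"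
        if x: "x \<in> ?E" and d: "0 < d" for x d
      proof -
        obtain n :: nat where n: "1 / Suc n < d" using nat_approx_posE[OF d] by blast
        obtain t where t: "t \<noteq> 0" "\<bar>t\<bar> < 1 / Suc n" "(g (w + x *\<^sub>R h + t *\<^sub>R h) - g (w + x *\<^sub>R h)) / t < a"
          using x unfolding N_def by blast
        have eq: "w + x *\<^sub>R h + t *\<^sub>R h = w + (x + t) *\<^sub>R h" by (simp add: algebra_simps)
        show ?thesis
        proof (cases "t > 0")
          case True
          have "g (w + (x + t) *\<^sub>R h) - g (w + x *\<^sub>R h) < a * t"
            using t(3) True by (simp add: eq divide_less_eq)
          then show ?thesis
            using t n True by (intro exI[of _ x] exI[of _ "x + t"]) (simp add: f_def algebra_simps)
        next
          case False
          then have t0: "t < 0" using t(1) by simp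
          have "a * t < g (w + (x + t) *\<^sub>R h) - g (w + x *\<^sub>R h)"
            using t(3) t0 by (simp add: eq divide_less_eq)
          then show ?thesis
            using t n t0 by (intro exI[of _ "x + t"] exI[of _ x]) (simp add: f_def algebra_simps)
        qed
      qed
      show "\<exists>y z. y < z \<and> y \<le> x \<and> x \<le> z \<and> z - y < d \<and> (b + M) * (z - y) \<le> f z - f y"
        if x: "x \<in> ?E" and d: "0 < d" for x d
      proof -
        obtain n :: nat where n: "1 / Suc n < d" using nat_approx_posE[OF d] by blast
        obtain t where t: "t \<noteq> 0" "\<bar>t\<bar> < 1 / Suc n" "b < (g (w + x *\<^sub>R h + t *\<^sub>R h) - g (w + x *\<^sub>R h)) / t"
          using x unfolding N_def by blast
        have eq: "w + x *\<^sub>R h + t *\<^sub>R h = w + (x + t) *\<^sub>R h" by (simp add: algebra_simps)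
        show ?thesis
        proof (cases "t > 0")
          case True
          have "b * t < g (w + (x + t) *\<^sub>R h) - g (w + x *\<^sub>R h)"
            using t(3) True by (simp add: eq less_divide_eq)
          then show ?thesis
            using t n True by (intro exI[of _ x] exI[of _ "x + t"]) (simp add: f_def algebra_simps)
        next
          case False
          then have t0: "t < 0" using t(1) by simp
          have "g (w + (x + t) *\<^sub>R h) - g (w + x *\<^sub>R h) < b * t"
            using t(3) t0 by (simp add: eq less_divide_eq)
          then show ?thesis
            using t n t0 by (intro exI[of _ "x + t"] exI[of _ x]) (simp add: f_def algebra_simps)
        qed
      qed
    qed (rule contf)
  next
    case False
    have "- M \<le> (g (v + t *\<^sub>R h) - g v) / t" if "t \<noteq> 0" for v t
    proof -
      have "\<bar>(g (v + t *\<^sub>R h) - g v) / t\<bar> \<le> M"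
        using gM[of v t 0] that by (simp add: abs_divide divide_le_eq)
      then show ?thesis by linarith
    qed
    note lb = this
    have "v \<notin> N" for v
    proof
      assume "v \<in> N"
      then obtain t where "t \<noteq> 0" "(g (v + t *\<^sub>R h) - g v) / t < a"
        unfolding N_def by blast
      then show False using lb[of t v] False by linarith
    qed
    then show ?thesis by simp
  qed
  have "emeasure lborel N = 0"
    unfolding lborel_line_slices(2)[OF N, of h] slice by simp
  then show ?thesis by (rule null_setsI) (simp add: N)
qed

lemma lipschitz_directional_derivative_ae:
  fixes g :: "'a::euclidean_space \<Rightarrow> real"
  assumes lip: "L-lipschitz_on UNIV g"
  shows "negligible {w. \<not> (\<exists>l. ((\<lambda>t. (g (w + t *\<^sub>R h) - g w) / t) \<longlongrightarrow> l) (at 0))}"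
proof -
  define N where "N = (\<lambda>a b. {w. \<forall>n::nat. (\<exists>t. t \<noteq> 0 \<and> \<bar>t\<bar> < 1 / Suc n \<and> (g (w + t *\<^sub>R h) - g w) / t < a) \<and>
                          (\<exists>t. t \<noteq> 0 \<and> \<bar>t\<bar> < 1 / Suc n \<and> b < (g (w + t *\<^sub>R h) - g w) / t)})"
  define I :: "(real \<times> real) set" where "I = {(a, b). a \<in> \<rat> \<and> b \<in> \<rat> \<and> a < b}"
  have "countable I"
    by (rule countable_subset[OF _ countable_SIGMA[OF countable_rat countable_rat]]) (auto simp: I_def)
  moreover have "negligible (N a b)" if "a < b" for a b
    using lipschitz_slope_gap_null[OF lip that, of h]
    unfolding N_def negligible_iff_null_sets by (rule null_sets_completionI)
  ultimately have neg: "negligible (\<Union>((\<lambda>(a, b). N a b) ` I))"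
    by (intro negligible_countable_Union) (auto simp: I_def)
  have "\<exists>l. ((\<lambda>t. (g (w + t *\<^sub>R h) - g w) / t) \<longlongrightarrow> l) (at 0)"
    if w: "w \<notin> \<Union>((\<lambda>(a, b). N a b) ` I)" for w
  proof (rule tendsto_if_no_rational_gap)
    show "\<forall>\<^sub>F t in at 0. \<bar>(g (w + t *\<^sub>R h) - g w) / t\<bar> \<le> L * norm h"
      unfolding eventually_at
    proof (intro exI[of _ 1] conjI ballI impI)
      fix t :: real assume "t \<noteq> 0 \<and> dist t 0 < 1"
      then show "\<bar>(g (w + t *\<^sub>R h) - g w) / t\<bar> \<le> L * norm h"
        using lipschitz_onD[OF lip, of "w + t *\<^sub>R h" w]
        by (simp add: dist_norm abs_divide divide_le_eq mult_ac)
    qed simp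
    show "(\<forall>\<^sub>F t in at 0. a \<le> (g (w + t *\<^sub>R h) - g w) / t) \<or> (\<forall>\<^sub>F t in at 0. (g (w + t *\<^sub>R h) - g w) / t \<le> b)"
      if "a \<in> \<rat>" "b \<in> \<rat>" "a < b" for a b
    proof -
      have "w \<notin> N a b" using w that by (auto simp: I_def)
      then obtain n :: nat where
        "\<not> (\<exists>t. t \<noteq> 0 \<and> \<bar>t\<bar> < 1 / Suc n \<and> (g (w + t *\<^sub>R h) - g w) / t < a) \<or>
         \<not> (\<exists>t. t \<noteq> 0 \<and> \<bar>t\<bar> < 1 / Suc n \<and> b < (g (w + t *\<^sub>R h) - g w) / t)"
        unfolding N_def by blast
      then show ?thesis
      proof
        assume "\<not> (\<exists>t. t \<noteq> 0 \<and> \<bar>t\<bar> < 1 / Suc n \<and> (g (w + t *\<^sub>R h) - g w) / t < a)"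
        then have "\<forall>\<^sub>F t in at 0. a \<le> (g (w + t *\<^sub>R h) - g w) / t"
          unfolding eventually_at dist_real_def
          by (intro exI[of _ "1 / Suc n"] conjI ballI impI) (simp, metis diff_0_right not_less)
        then show ?thesis ..
      next
        assume "\<not> (\<exists>t. t \<noteq> 0 \<and> \<bar>t\<bar> < 1 / Suc n \<and> b < (g (w + t *\<^sub>R h) - g w) / t)"
        then have "\<forall>\<^sub>F t in at 0. (g (w + t *\<^sub>R h) - g w) / t \<le> b"
          unfolding eventually_at dist_real_def
          by (intro exI[of _ "1 / Suc n"] conjI ballI impI) (simp, metis diff_0_right not_less)
        then show ?thesis ..
      qed
    qed
  qed simp
  then show ?thesis
    by (intro negligible_subset[OF neg]) blast
qed

section \<open>Rademacher's theorem\<close>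

text \<open>Every point of \<open>S\<close> has arbitrarily small balls of radius
  \<open>2 * d\<close> in which a hole occupies the fixed proportion \<open>q\<close> of the volume.
  Disjoint balls of this kind cover almost all of a bounded part of \<open>S\<close>, so that part
  fills at most the proportion \<open>1 - q\<close> of any open set around it.\<close>

lemma porous_negligible:
  fixes S :: "'a::euclidean_space set"
  assumes S: "S \<in> sets borel" and c: "0 < c" "c \<le> 1"
    and por: "\<And>x r. x \<in> S \<Longrightarrow> 0 < r \<Longrightarrow>
       \<exists>d y. 0 < d \<and> d < r \<and> dist x y \<le> d \<and> ball y (c * d) \<inter> S = {}"
  shows "negligible S"
proof -
  define q where "q = (c / 2) ^ DIM('a)"
  have q: "0 < q" "q < 1"
  proof -
    show "0 < q" using c by (simp add: q_def)
    have "(c / 2) ^ DIM('a) < 1 ^ DIM('a)"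
      using c by (intro power_strict_mono) auto
    then show "q < 1" by (simp add: q_def)
  qed
  have fin: "emeasure lborel (ball x r) \<noteq> top" for x :: 'a and r
    using emeasure_bounded_finite[OF bounded_ball, of x r] by simp
  have main: "emeasure lborel T = 0" if T: "T \<in> sets borel" "bounded T" "T \<subseteq> S" for T
  proof (rule ccontr)
    assume nz: "emeasure lborel T \<noteq> 0"
    define s where "s = measure lborel T"
    have s: "emeasure lborel T = ennreal s" "0 \<le> s"
      unfolding s_def using emeasure_bounded_finite[OF T(2)]
      by (auto simp: emeasure_eq_ennreal_measure less_top)
    with nz have s0: "0 < s" by (auto simp: less_le)
    \<comment> \<open>An excess of \<open>q * s\<close> suffices: the covering then gives s at most
      (1 - q) (1 + q) s, which is impossible for positive s.\<close>
    obtain U where U: "open U" "T \<subseteq> U" "emeasure lborel (U - T) < ennreal (q * s)"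
      using outer_regular_lborel[OF T(1), of "q * s"] q s0 by (metis mult_pos_pos)
    have "emeasure lborel U = emeasure lborel T + emeasure lborel (U - T)"
      using U T by (subst plus_emeasure) (auto simp: Un_absorb1)
    also have "\<dots> < ennreal s + ennreal (q * s)"
      using U s by (simp add: ennreal_add_left_cancel_less)
    finally have lU: "emeasure lborel U < ennreal (s + q * s)"
      using q s by simp
    define K where "K = {(x::'a, r::real). 0 < r \<and> ball x r \<subseteq> U \<and> 
        emeasure lborel (T \<inter> ball x r) \<le> ennreal (1 - q) * emeasure lborel (ball x r)}"
    have cov: "\<exists>i. i \<in> K \<and> x \<in> ball (fst i) (snd i) \<and> snd i < d" if x: "x \<in> T" and d: "0 < d" for x d
    proof -
      obtain e where e: "e > 0" "ball x e \<subseteq> U"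
        using U x by (meson openE subsetD)
      obtain r y where r: "0 < r" "r < min d e / 2" "dist x y \<le> r" "ball y (c * r) \<inter> S = {}"
        using por[of x "min d e / 2"] x T d e by auto
      have yx: "ball y (c * r) \<subseteq> ball x (2 * r)"
      proof
        fix z assume "z \<in> ball y (c * r)"
        then have "dist y z < c * r" by simp
        also have "\<dots> \<le> r" using c r by (simp add: mult_le_cancel_right1)
        finally have "dist y z < r" .
        then show "z \<in> ball x (2 * r)"
          using r dist_triangle[of x z y] by simp
      qed
      have "measure lborel (T \<inter> ball x (2 * r)) \<le> measure lborel (ball x (2 * r) - ball y (c * r))"
        using r T by (intro measure_mono_fmeasurable)
          (auto simp: fmeasurable_def intro!: emeasure_bounded_finite[unfolded infinity_ennreal_def] bounded_diff)
      also have "\<dots> = measure lborel (ball x (2 * r)) - measure lborel (ball y (c * r))"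
        using yx by (intro measure_Diff) (auto simp: fin)
      also have "measure lborel (ball y (c * r)) = q * measure lborel (ball x (2 * r))"
      proof -
        have "c * r = (c / 2) * (2 * r)" by simp
        then show ?thesis
          using r c by (simp add: content_ball_conv_unit_ball[of "c * r"] content_ball_conv_unit_ball[of "2 * r"] q_def power_mult_distrib power_divide)
      qed
      finally have le: "measure lborel (T \<inter> ball x (2 * r)) \<le> (1 - q) * measure lborel (ball x (2 * r))"
        by (simp add: algebra_simps)
      have "emeasure lborel (T \<inter> ball x (2 * r)) = ennreal (measure lborel (T \<inter> ball x (2 * r)))"
        by (rule emeasure_eq_ennreal_measure) (metis bounded_Int bounded_ball emeasure_bounded_finite less_irrefl infinity_ennreal_def)
      also have "\<dots> \<le> ennreal ((1 - q) * measure lborel (ball x (2 * r)))"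
        by (rule ennreal_leI[OF le])
      also have "\<dots> = ennreal (1 - q) * emeasure lborel (ball x (2 * r))"
        using q by (subst emeasure_eq_ennreal_measure) (auto simp: ennreal_mult fin)
      finally have "(x, 2 * r) \<in> K"
        using r e by (auto simp: K_def)
      then show ?thesis using r by (intro exI[of _ "(x, 2 * r)"]) auto
    qed
    obtain C where C: "countable C" "C \<subseteq> K"
      "pairwise (\<lambda>i j. disjnt (ball (fst i) (snd i)) (ball (fst j) (snd j))) C"
      "negligible (T - (\<Union>i \<in> C. ball (fst i) (snd i)))"
      by (rule Vitali_covering_theorem_balls[of T K fst snd, OF cov])
    have dis: "disjoint_family_on (\<lambda>i. ball (fst i) (snd i)) C"
      using C(3) by (auto simp: pairwise_def disjnt_def disjoint_family_on_def)
    let ?V = "\<Union>i \<in> C. ball (fst i) (snd i)"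
    have "T - ?V \<in> sets borel"
      by (intro sets.Diff T(1) borel_open open_UN ballI open_ball)
    then have "T - ?V \<in> null_sets lborel"
      using C(4) by (simp add: negligible_iff_null_sets null_sets_completion_iff)
    then have "emeasure lborel T = emeasure lborel (T \<inter> ?V)"
      using T by (metis Diff_Diff_Int emeasure_Diff_null_set sets_lborel)
    also have "\<dots> = emeasure lborel (\<Union>i\<in>C. T \<inter> ball (fst i) (snd i))"
      by simp
    also have "\<dots> = (\<integral>\<^sup>+i. emeasure lborel (T \<inter> ball (fst i) (snd i)) \<partial>count_space C)"
      using C T by (intro emeasure_UN_countable disjoint_family_on_bisimulation[OF dis]) auto
    also have "\<dots> \<le> (\<integral>\<^sup>+i. ennreal (1 - q) * emeasure lborel (ball (fst i) (snd i)) \<partial>count_space C)"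
      using C by (intro nn_integral_mono) (auto simp: K_def)
    also have "\<dots> = ennreal (1 - q) * (\<integral>\<^sup>+i. emeasure lborel (ball (fst i) (snd i)) \<partial>count_space C)"
      by (rule nn_integral_cmult) auto
    also have "(\<integral>\<^sup>+i. emeasure lborel (ball (fst i) (snd i)) \<partial>count_space C) = emeasure lborel ?V"
      using C dis by (intro emeasure_UN_countable[symmetric]) auto
    also have "\<dots> \<le> emeasure lborel U"
      using C(2) U by (intro emeasure_mono) (fastforce simp: K_def)+
    also have "\<dots> \<le> ennreal (s + q * s)" using lU by simp
    finally have "ennreal s \<le> ennreal (1 - q) * ennreal (s + q * s)"
      by (simp add: mult_left_mono s)
    then have "s \<le> (1 - q) * (s + q * s)"
      using q s ennreal_mult[of "1 - q" "s + q * s"] ennreal_le_iff[of "(1 - q) * (s + q * s)" s] by auto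
    then have "q * q * s \<le> 0" by (simp add: algebra_simps)
    then show False using q s0 by (simp add: mult_le_0_iff)
  qed
  have "negligible (S \<inter> ball 0 (real n))" for n
    using main[of "S \<inter> ball 0 (real n)"] S
    by (auto simp: negligible_iff_null_sets null_sets_def bounded_Int)
  then have "negligible (\<Union>n. S \<inter> ball 0 (real n))"
    by (rule negligible_Union_nat)
  moreover have "(\<Union>n. S \<inter> ball 0 (real n)) = S"
    using reals_Archimedean2 by (auto simp: dist_norm)
  ultimately show ?thesis by simp
qed

text \<open>A hole of \<open>K\<close> is also a hole of the set of porosity points, so that set is
  porous itself. The strict inequality \<open>dist y x < d\<close> presents it as \<open>K\<close>
  intersected with a countable intersection of unions of open balls, hence as a Borel set.\<close>

lemma porous_points_negligible:
  fixes K :: "'a::euclidean_space set"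
  assumes K: "closed K" and c: "0 < c" "c \<le> 1"
  shows "negligible {x\<in>K. \<forall>m::nat. \<exists>d y. 0 < d \<and> d < 1 / Suc m \<and> dist y x < d \<and> ball y (c * d) \<inter> K = {}}"
    (is "negligible ?S")
proof (rule porous_negligible[OF _ c])
  have "?S = K \<inter> (\<Inter>m::nat. \<Union>p\<in>{(d, y). 0 < d \<and> d < 1 / Suc m \<and> ball y (c * d) \<inter> K = {}}. ball (snd p) (fst p))"
    by (auto; blast)
  also have "\<dots> \<in> sets borel"
    using K by (intro sets.Int sets.countable_INT'' borel_open open_UN ballI open_ball borel_closed) auto
  finally show "?S \<in> sets borel" .
  fix x and r :: real assume x: "x \<in> ?S" and r: "0 < r"
  obtain m :: nat where m: "1 / Suc m < r" using nat_approx_posE[OF r] by blast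
  obtain d y where dy: "0 < d" "d < 1 / Suc m" "dist y x < d" "ball y (c * d) \<inter> K = {}"
    using x by blast
  show "\<exists>d y. 0 < d \<and> d < r \<and> dist x y \<le> d \<and> ball y (c * d) \<inter> ?S = {}"
    using dy m by (intro exI[of _ d] exI[of _ y]) (auto simp: dist_commute)
qed

text \<open>Move from \<open>x\<close> to \<open>x + h\<close> one coordinate at a time; every intermediate point is close to a point
  of \<open>K\<close>, where the increment in the next coordinate direction is controlled.\<close>
lemma nonporous_linear_approximation:
  fixes g :: "'a::euclidean_space \<Rightarrow> real" and L c \<epsilon> \<delta> :: real
  assumes lip: "L-lipschitz_on UNIV g"
    and K: "K = {x. \<forall>i\<in>Basis. \<forall>t. \<bar>t\<bar> \<le> \<delta> \<longrightarrow> \<bar>g (x + t *\<^sub>R i) - g x - (\<alpha> \<bullet> i) * t\<bar> \<le> \<epsilon> * \<bar>t\<bar>}"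
    and \<epsilon>: "0 \<le> \<epsilon>" and c: "0 < c" and h: "norm h \<le> \<delta>"
    and np: "\<And>y. dist y x \<le> DIM('a) * norm h \<Longrightarrow> ball y (c * norm h) \<inter> K \<noteq> {}"
  shows "\<bar>g (x + h) - g x - \<alpha> \<bullet> h\<bar> \<le> DIM('a) * (\<epsilon> + 2 * L * c) * norm h"
proof -
  have L: "0 \<le> L" using lip by (rule lipschitz_on_nonneg)
  have step: "\<bar>g (x + (\<Sum>j\<in>S. (h \<bullet> j) *\<^sub>R j)) - g x - (\<Sum>j\<in>S. (\<alpha> \<bullet> j) * (h \<bullet> j))\<bar>
      \<le> card S * (\<epsilon> + 2 * L * c) * norm h" if "S \<subseteq> Basis" for S
    using finite_subset[OF that finite_Basis] that
  proof (induction S rule: finite_induct)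
    case empty
    then show ?case by simp
  next
    case (insert i S)
    define y where "y = x + (\<Sum>j\<in>S. (h \<bullet> j) *\<^sub>R j)"
    define t where "t = h \<bullet> i"
    have i: "i \<in> Basis" using insert by auto
    have t: "\<bar>t\<bar> \<le> norm h" using Basis_le_norm[OF i, of h] by (simp add: t_def)
    have "norm (\<Sum>j\<in>S. (h \<bullet> j) *\<^sub>R j) \<le> (\<Sum>j\<in>S. norm h)"
      using insert.prems by (intro sum_norm_le) (auto simp: Basis_le_norm)
    also have "\<dots> \<le> DIM('a) * norm h"
      using insert.prems by (auto intro!: mult_right_mono card_mono)
    finally have "dist y x \<le> DIM('a) * norm h" by (simp add: y_def dist_norm)
    from np[OF this] obtain z where z: "z \<in> K" "dist y z < c * norm h" by auto
    have 1: "\<bar>g (z + t *\<^sub>R i) - g z - (\<alpha> \<bullet> i) * t\<bar> \<le> \<epsilon> * \<bar>t\<bar>"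
      using z(1) i t h unfolding K by auto
    have 2: "\<epsilon> * \<bar>t\<bar> \<le> \<epsilon> * norm h" using t \<epsilon> by (rule mult_left_mono)
    have "\<bar>g y - g z\<bar> \<le> L * dist y z"
      using lipschitz_onD[OF lip, of y z] by (simp add: dist_real_def)
    also have "\<dots> \<le> L * (c * norm h)" using z L by (intro mult_left_mono) auto
    finally have 3: "\<bar>g y - g z\<bar> \<le> L * (c * norm h)" .
    have "\<bar>g (y + t *\<^sub>R i) - g (z + t *\<^sub>R i)\<bar> \<le> L * dist y z"
      using lipschitz_onD[OF lip, of "y + t *\<^sub>R i" "z + t *\<^sub>R i"] by (simp add: dist_real_def)
    also have "\<dots> \<le> L * (c * norm h)" using z L by (intro mult_left_mono) auto
    finally have 4: "\<bar>g (y + t *\<^sub>R i) - g (z + t *\<^sub>R i)\<bar> \<le> L * (c * norm h)" .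
    have 5: "\<bar>g y - g x - (\<Sum>j\<in>S. (\<alpha> \<bullet> j) * (h \<bullet> j))\<bar> \<le> card S * (\<epsilon> + 2 * L * c) * norm h"
      using insert unfolding y_def by auto
    have 6: "x + (\<Sum>j\<in>insert i S. (h \<bullet> j) *\<^sub>R j) = y + t *\<^sub>R i"
      using insert by (simp add: y_def t_def algebra_simps)
    have 7: "(\<Sum>j\<in>insert i S. (\<alpha> \<bullet> j) * (h \<bullet> j)) = (\<alpha> \<bullet> i) * t + (\<Sum>j\<in>S. (\<alpha> \<bullet> j) * (h \<bullet> j))"
      using insert by (simp add: t_def)
    have 8: "card (insert i S) * (\<epsilon> + 2 * L * c) * norm h =
       card S * (\<epsilon> + 2 * L * c) * norm h + \<epsilon> * norm h + 2 * (L * (c * norm h))"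
      using insert by (simp add: algebra_simps)
    show ?case
      unfolding 6 7 8 using 1 2 3 4 5 by linarith
  qed
  have "\<alpha> \<bullet> h = (\<Sum>j\<in>Basis. (\<alpha> \<bullet> j) * (h \<bullet> j))" by (rule euclidean_inner)
  then show ?thesis using step[of Basis] by (simp add: euclidean_representation)
qed

text \<open>Outside \<open>N1\<close> the partial derivatives exist and determine the candidate
  gradient \<open>A\<close>; outside \<open>N2\<close> no set \<open>K \<alpha> n k\<close>
  containing the point is porous there. An \<alpha> close to \<open>A\<close> puts the point into
  such a set, and nonporosity turns the coordinatewise control on \<open>K \<alpha> n k\<close> into
  control in all directions.\<close>

theorem Rademacher_real:
  fixes g :: "'a::euclidean_space \<Rightarrow> real"
  assumes lip: "L-lipschitz_on UNIV g"
  shows "negligible {x. \<not> g differentiable (at x)}"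
proof -
  have L: "0 \<le> L" by (rule lipschitz_on_nonneg[OF lip])
  have cont: "continuous_on UNIV g" by (rule lipschitz_on_continuous_on[OF lip])
  \<comment> \<open>Points whose partial difference quotients agree with \<alpha> up to
    \<open>1 / Suc k\<close> at all scales up to \<open>1 / Suc n\<close>. Letting \<alpha> range
    over a countable dense set only keeps the exceptional set a countable union.\<close>
  define K :: "'a \<Rightarrow> nat \<Rightarrow> nat \<Rightarrow> 'a set" where "K = (\<lambda>\<alpha> n k. {x. \<forall>i\<in>Basis. \<forall>t. \<bar>t\<bar> \<le> 1 / Suc n \<longrightarrow>
      \<bar>g (x + t *\<^sub>R i) - g x - (\<alpha> \<bullet> i) * t\<bar> \<le> 1 / Suc k * \<bar>t\<bar>})"
  define P where "P = (\<lambda>\<alpha> n k j. {x\<in>K \<alpha> n k. \<forall>m::nat. \<exists>d y. 0 < d \<and> d < 1 / Suc m \<and> dist y x < d \<and>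
      ball y (1 / Suc j * d) \<inter> K \<alpha> n k = {}})"
  have clK: "closed (K \<alpha> n k)" for \<alpha> n k
  proof -
    have "K \<alpha> n k = (\<Inter>i\<in>Basis. \<Inter>t\<in>{t. \<bar>t\<bar> \<le> 1 / Suc n}. {x. \<bar>g (x + t *\<^sub>R i) - g x - (\<alpha> \<bullet> i) * t\<bar> \<le> 1 / Suc k * \<bar>t\<bar>})"
      by (auto simp: K_def)
    also have "closed \<dots>"
      by (intro closed_INT ballI closed_Collect_le continuous_intros continuous_on_compose2[OF cont]) auto
    finally show ?thesis .
  qed
  obtain D :: "'a set" where D: "countable D" "\<And>X. open X \<Longrightarrow> X \<noteq> {} \<Longrightarrow> \<exists>d\<in>D. d \<in> X"
    by (rule countable_dense_setE) blast
  have nP: "negligible (P \<alpha> n k j)" for \<alpha> n k j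
    unfolding P_def by (rule porous_points_negligible[OF clK]) auto
  define N1 where "N1 = (\<Union>i\<in>Basis. {w. \<not> (\<exists>l. ((\<lambda>t. (g (w + t *\<^sub>R i) - g w) / t) \<longlongrightarrow> l) (at 0))})"
  define N2 where "N2 = (\<Union>\<alpha>\<in>D. \<Union>n. \<Union>k. \<Union>j. P \<alpha> n k j)"
  have "negligible N1"
    unfolding N1_def using lipschitz_directional_derivative_ae[OF lip]
    by (intro negligible_Union) auto
  moreover have "negligible N2"
    unfolding N2_def using D(1) nP
    by (intro negligible_countable_Union) (auto intro!: negligible_Union_nat)
  ultimately have neg: "negligible (N1 \<union> N2)" by (rule negligible_Un)
  have "g differentiable (at x)" if x: "x \<notin> N1 \<union> N2" for x
  proof -
    have "\<forall>i\<in>Basis. \<exists>l. ((\<lambda>t. (g (x + t *\<^sub>R i) - g x) / t) \<longlongrightarrow> l) (at 0)"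
      using x by (auto simp: N1_def)
    then obtain a where a: "\<And>i. i \<in> Basis \<Longrightarrow> ((\<lambda>t. (g (x + t *\<^sub>R i) - g x) / t) \<longlongrightarrow> a i) (at 0)"
      by metis
    define A where "A = (\<Sum>i\<in>Basis. a i *\<^sub>R i)"
    have Ai: "A \<bullet> i = a i" if "i \<in> Basis" for i
      using that by (simp add: A_def)
    define M where "M = real DIM('a)"
    have M: "M \<ge> 1" by (simp add: M_def Suc_leI)
    have "(g has_derivative (\<lambda>h. A \<bullet> h)) (at x)"
      unfolding has_derivative_at_alt
    proof (intro conjI allI impI)
      show "bounded_linear ((\<bullet>) A)" by (rule bounded_linear_inner_right)
      fix e :: real assume e: "e > 0"
      \<comment> \<open>The final error is \<open>(M + 1) * \<epsilon> + 2 * L * M * c\<close> per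
        unit of \<open>norm h\<close>. The bound \<gamma> on \<epsilon> makes the first term at most
        \<open>e / 2\<close>; below, \<beta> does the same for the second, where \<open>c\<close>
        carries another factor \<open>M + 1\<close>.\<close>
      define \<gamma> where "\<gamma> = e / (2 * (M + 1))"
      have \<gamma>: "\<gamma> > 0" using e M by (simp add: \<gamma>_def)
      obtain k :: nat where k: "1 / Suc k < \<gamma>" using nat_approx_posE[OF \<gamma>] by blast
      define \<epsilon> where "\<epsilon> = 1 / real (Suc k)"
      have \<epsilon>: "0 < \<epsilon>" by (simp add: \<epsilon>_def)
      define \<beta> where "\<beta> = e / (4 * (L + 1) * (M + 1) * (M + 1))"
      have \<beta>: "\<beta> > 0" using e M L by (simp add: \<beta>_def)
      obtain j :: nat where j: "1 / Suc j < \<beta>" using nat_approx_posE[OF \<beta>] by blast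
      have "\<exists>\<alpha>\<in>D. \<alpha> \<in> ball A (\<epsilon> / 2)" using \<epsilon> by (intro D(2)) auto
      then obtain \<alpha> where \<alpha>: "\<alpha> \<in> D" "dist A \<alpha> < \<epsilon> / 2" by auto
      have "\<forall>\<^sub>F t in at 0. \<forall>i\<in>Basis. dist ((g (x + t *\<^sub>R i) - g x) / t) (a i) < \<epsilon> / 2"
        using a \<epsilon> by (intro eventually_ball_finite ballI tendstoD) auto
      then obtain \<delta> where \<delta>: "\<delta> > 0" and
        \<delta>': "\<And>t i. t \<noteq> 0 \<Longrightarrow> \<bar>t\<bar> < \<delta> \<Longrightarrow> i \<in> Basis \<Longrightarrow> dist ((g (x + t *\<^sub>R i) - g x) / t) (a i) < \<epsilon> / 2"
        unfolding eventually_at by (auto simp: dist_real_def)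
      obtain n :: nat where n: "1 / Suc n < \<delta>" using nat_approx_posE[OF \<delta>] by blast
      have xK: "x \<in> K \<alpha> n k"
        unfolding K_def
      proof (intro CollectI ballI allI impI)
        fix i :: 'a and t :: real assume i: "i \<in> Basis" and t: "\<bar>t\<bar> \<le> 1 / Suc n"
        show "\<bar>g (x + t *\<^sub>R i) - g x - (\<alpha> \<bullet> i) * t\<bar> \<le> 1 / Suc k * \<bar>t\<bar>"
        proof (cases "t = 0")
          case False
          have "\<bar>(g (x + t *\<^sub>R i) - g x) / t - a i\<bar> < \<epsilon> / 2"
            using \<delta>'[OF False _ i] t n by (simp add: dist_real_def)
          moreover have "\<bar>A \<bullet> i - \<alpha> \<bullet> i\<bar> \<le> norm (A - \<alpha>)"
            using Basis_le_norm[OF i, of "A - \<alpha>"] by (simp add: inner_diff_left)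
          ultimately have "\<bar>(g (x + t *\<^sub>R i) - g x) / t - \<alpha> \<bullet> i\<bar> \<le> \<epsilon>"
            using \<alpha>(2) unfolding Ai[OF i] dist_norm by linarith
          then have "\<bar>(g (x + t *\<^sub>R i) - g x) / t - \<alpha> \<bullet> i\<bar> * \<bar>t\<bar> \<le> \<epsilon> * \<bar>t\<bar>"
            by (rule mult_right_mono) simp
          moreover have "((g (x + t *\<^sub>R i) - g x) / t - \<alpha> \<bullet> i) * t = g (x + t *\<^sub>R i) - g x - (\<alpha> \<bullet> i) * t"
            using False by (simp add: field_simps)
          ultimately show ?thesis by (simp add: \<epsilon>_def abs_mult[symmetric])
        qed simp
      qed
      moreover have "x \<notin> P \<alpha> n k j" using x \<alpha>(1) by (auto simp: N2_def)
      ultimately obtain m :: nat where m: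
        "\<And>d y. 0 < d \<Longrightarrow> d < 1 / Suc m \<Longrightarrow> dist y x < d \<Longrightarrow> ball y (1 / Suc j * d) \<inter> K \<alpha> n k \<noteq> {}"
        unfolding P_def by blast
      define \<rho> where "\<rho> = min (1 / Suc n) (1 / Suc m / (M + 1))"
      have \<rho>: "\<rho> > 0" using M by (simp add: \<rho>_def)
      have "\<bar>g (x + h) - g x - A \<bullet> h\<bar> \<le> e * norm h" if h: "norm h < \<rho>" for h
      proof (cases "h = 0")
        case False
        then have h0: "norm h > 0" by simp
        \<comment> \<open>Nonporosity is used with \<open>d = (M + 1) * norm h\<close>, strictly
          more than the distance \<open>M * norm h\<close> that the intermediate points may have
          from x; this rescales the admissible hole from \<open>1 / Suc j\<close> to
          \<open>c\<close>.\<close>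
        define c where "c = 1 / Suc j * (M + 1)"
        have "\<bar>g (x + h) - g x - \<alpha> \<bullet> h\<bar> \<le> DIM('a) * (1 / Suc k + 2 * L * c) * norm h"
        proof (rule nonporous_linear_approximation[OF lip, where K="K \<alpha> n k" and \<delta>="1 / Suc n" and x = x])
          show "0 < c" using M by (simp add: c_def)
          show "norm h \<le> 1 / Suc n" using h by (simp add: \<rho>_def)
          fix y assume y: "dist y x \<le> DIM('a) * norm h"
          have "norm h < 1 / Suc m / (M + 1)" using h by (simp add: \<rho>_def)
          then have "(M + 1) * norm h < 1 / Suc m" using M by (simp add: pos_less_divide_eq mult_ac)
          moreover have "dist y x < (M + 1) * norm h" using y h0 unfolding M_def distrib_right by linarith
          ultimately have "ball y (1 / Suc j * ((M + 1) * norm h)) \<inter> K \<alpha> n k \<noteq> {}"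
            using M h0 by (intro m) auto
          then show "ball y (c * norm h) \<inter> K \<alpha> n k \<noteq> {}" by (simp add: c_def mult.assoc)
        qed (auto simp: K_def)
        moreover have "\<bar>\<alpha> \<bullet> h - A \<bullet> h\<bar> \<le> \<epsilon> * norm h"
        proof -
          have "\<bar>(\<alpha> - A) \<bullet> h\<bar> \<le> norm (\<alpha> - A) * norm h" by (rule Cauchy_Schwarz_ineq2)
          also have "\<dots> \<le> \<epsilon> * norm h"
            using \<alpha>(2) \<epsilon> by (intro mult_right_mono) (auto simp: dist_norm norm_minus_commute)
          finally show ?thesis by (simp add: inner_diff_left)
        qed
        ultimately have "\<bar>g (x + h) - g x - A \<bullet> h\<bar> \<le> M * (\<epsilon> + 2 * L * c) * norm h + \<epsilon> * norm h"
          unfolding M_def \<epsilon>_def by linarith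
        also have "\<dots> = ((M + 1) * \<epsilon> + 2 * L * M * c) * norm h" by (simp add: algebra_simps)
        also have "\<dots> \<le> e * norm h"
        proof (rule mult_right_mono)
          have "(M + 1) * \<epsilon> \<le> (M + 1) * \<gamma>" using k M by (intro mult_left_mono) (auto simp: \<epsilon>_def)
          also have "\<dots> = e / 2" using M by (simp add: \<gamma>_def field_simps)
          finally have 1: "(M + 1) * \<epsilon> \<le> e / 2" .
          have "2 * L * M * c \<le> 2 * (L + 1) * (M + 1) * (\<beta> * (M + 1))"
            unfolding c_def using L M j \<beta> by (intro mult_mono) auto
          also have "\<dots> = e / 2"
          proof -
            have "2 * a * b * (e / (4 * a * b * b) * b) = e / 2" if "a > 0" "b > 0" for a b :: real
              using that by (simp add: field_simps)
            from this[of "L + 1" "M + 1"] show ?thesis using L M by (simp add: \<beta>_def)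
          qed
          finally show "(M + 1) * \<epsilon> + 2 * L * M * c \<le> e" using 1 by linarith
        qed simp
        finally show ?thesis .
      qed simp
      then show "\<exists>d>0. \<forall>y. norm (y - x) < d \<longrightarrow> norm (g y - g x - A \<bullet> (y - x)) \<le> e * norm (y - x)"
        using \<rho> by (intro exI[of _ \<rho>]) (auto, metis add.commute diff_add_cancel)
    qed
    then show ?thesis by (auto simp: differentiable_def)
  qed
  then show ?thesis by (intro negligible_subset[OF neg]) blast
qed

theorem Rademacher:
  fixes f :: "'a::euclidean_space \<Rightarrow> 'b::euclidean_space"
  assumes lip: "L-lipschitz_on UNIV f"
  shows "negligible {x. \<not> f differentiable (at x)}"
proof -
  have "L-lipschitz_on UNIV (\<lambda>x. f x \<bullet> i)" if i: "i \<in> Basis" for i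
  proof (rule lipschitz_onI)
    fix x y
    have "dist (f x \<bullet> i) (f y \<bullet> i) \<le> dist (f x) (f y)"
      using Basis_le_norm[OF i, of "f x - f y"] by (simp add: dist_norm inner_diff_left)
    also have "\<dots> \<le> L * dist x y" using lipschitz_onD[OF lip] by simp
    finally show "dist (f x \<bullet> i) (f y \<bullet> i) \<le> L * dist x y" .
  qed (rule lipschitz_on_nonneg[OF lip])
  then have "negligible (\<Union>i\<in>Basis. {x. \<not> (\<lambda>x. f x \<bullet> i) differentiable (at x)})"
    by (intro negligible_Union) (auto intro: Rademacher_real)
  moreover have "{x. \<not> f differentiable (at x)} = (\<Union>i\<in>Basis. {x. \<not> (\<lambda>x. f x \<bullet> i) differentiable (at x)})"
    by (subst differentiable_componentwise_within) auto
  ultimately show ?thesis by simp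
qed

section \<open>A mean value inequality for Lipschitz maps\<close>

text \<open>A bisection argument: any decrease of \<open>g\<close> on an interval is at most
  \<open>e\<close> times its length plus \<open>L\<close> times the length of its part in a small
  open neighbourhood \<open>U\<close> of \<open>Z\<close>. This holds locally at points of
  \<open>Z\<close> by the Lipschitz bound, since short intervals there lie in \<open>U\<close>, and
  elsewhere by the nonnegative derivative.\<close>

lemma lipschitz_increasing_if_derivative_ae:
  fixes g :: "real \<Rightarrow> real"
  assumes lip: "L-lipschitz_on UNIV g" and Z: "negligible Z"
    and der: "\<And>t. t \<in> {0..1} - Z \<Longrightarrow> \<exists>D\<ge>0. (g has_real_derivative D) (at t)"
  shows "g 0 \<le> g 1"
proof -
  have L: "0 \<le> L" by (rule lipschitz_on_nonneg[OF lip])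
  have "g 0 - g 1 \<le> (1 + L) * e" if e: "e > 0" for e
  proof -
    have Zn: "Z \<in> null_sets lebesgue" using Z by (simp add: negligible_iff_null_sets)
    obtain U where U: "open U" "Z \<subseteq> U" "emeasure lebesgue (U - Z) < ennreal e"
      using sets_lebesgue_outer_open[of Z e] Zn e by (metis null_setsD2)
    have "emeasure lborel U = emeasure lebesgue U" using U by simp
    also have "\<dots> = emeasure lebesgue (U - Z)"
      using U Zn by (intro emeasure_Diff_null_set[symmetric]) auto
    finally have eU: "emeasure lborel U < ennreal e" using U by simp
    \<comment> \<open>Half-open intervals split without overlap, so this error term is additive, as
      the bisection principle requires.\<close>
    define m where "m = (\<lambda>a b. measure lborel (U \<inter> {a<..b}))"
    have fin: "emeasure lborel (U \<inter> {a<..b}) \<noteq> \<infinity>" for a b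
      using emeasure_bounded_finite[of "U \<inter> {a<..b}"] by (auto simp: bounded_Int less_top)
    have "g 1 - g 0 \<ge> - e * (1 - 0) - L * m 0 1"
    proof (rule Bolzano[of 0 1 "\<lambda>a b. g b - g a \<ge> - e * (b - a) - L * m a b"])
      fix a b c :: real
      assume 1: "g b - g a \<ge> - e * (b - a) - L * m a b" and 2: "g c - g b \<ge> - e * (c - b) - L * m b c"
        and abc: "a \<le> b" "b \<le> c"
      have "U \<inter> {a<..c} = (U \<inter> {a<..b}) \<union> (U \<inter> {b<..c})" using abc by auto
      moreover have "measure lborel ((U \<inter> {a<..b}) \<union> (U \<inter> {b<..c})) = m a b + m b c"
        unfolding m_def using U fin by (intro measure_Union) auto
      ultimately have m: "m a c = m a b + m b c" by (simp add: m_def)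
      have "L * m a c = L * m a b + L * m b c" by (simp add: m algebra_simps)
      moreover have "- e * (c - a) = - e * (b - a) - e * (c - b)" by (simp add: algebra_simps)
      ultimately show "g c - g a \<ge> - e * (c - a) - L * m a c" using 1 2 by simp
    next
      fix x :: real assume x: "0 \<le> x" "x \<le> 1"
      show "\<exists>d>0. \<forall>a b. a \<le> x \<and> x \<le> b \<and> b - a < d \<longrightarrow> g b - g a \<ge> - e * (b - a) - L * m a b"
      proof (cases "x \<in> Z")
        case True
        then obtain d where d: "d > 0" "ball x d \<subseteq> U" using U by (meson openE subsetD)
        show ?thesis
        proof (intro exI[of _ d] conjI allI impI)
          fix a b assume ab: "a \<le> x \<and> x \<le> b \<and> b - a < d"
          then have "{a<..b} \<subseteq> ball x d" by (auto simp: dist_real_def)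
          then have "U \<inter> {a<..b} = {a<..b}" using d by auto
          then have "m a b = b - a" using ab by (simp add: m_def)
          moreover have "\<bar>g b - g a\<bar> \<le> L * (b - a)"
            using lipschitz_onD[OF lip, of b a] ab by (simp add: dist_real_def)
          moreover have "0 \<le> e * (b - a)" using e ab by simp
          ultimately show "g b - g a \<ge> - e * (b - a) - L * m a b" by (simp add: abs_le_iff)
        qed (use d in simp)
      next
        case False
        then obtain D where D: "D \<ge> 0" "(g has_real_derivative D) (at x)" using der x by auto
        then have "(g has_derivative (\<lambda>h. D * h)) (at x)" by (simp add: has_field_derivative_def)
        then obtain d where d: "d > 0"
          "\<And>y. \<bar>y - x\<bar> < d \<Longrightarrow> \<bar>g y - g x - D * (y - x)\<bar> \<le> e * \<bar>y - x\<bar>"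
          unfolding has_derivative_at_alt real_norm_def using e by blast
        show ?thesis
        proof (intro exI[of _ d] conjI allI impI)
          fix a b assume ab: "a \<le> x \<and> x \<le> b \<and> b - a < d"
          have "\<bar>g b - g x - D * (b - x)\<bar> \<le> e * (b - x)" using d(2)[of b] ab by simp
          moreover have "\<bar>g a - g x - D * (a - x)\<bar> \<le> e * (x - a)" using d(2)[of a] ab by simp
          moreover have "0 \<le> D * (b - x)" "0 \<le> D * (x - a)" using D ab by auto
          moreover have "0 \<le> L * m a b" using L by (simp add: m_def)
          ultimately show "g b - g a \<ge> - e * (b - a) - L * m a b"
            by (simp add: abs_le_iff algebra_simps)
        qed (use d in simp)
      qed
    qed simp
    moreover have "m 0 1 \<le> e"
    proof -
      have "emeasure lborel (U \<inter> {0<..1}) \<le> emeasure lborel U" using U by (intro emeasure_mono) auto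
      also have "\<dots> \<le> ennreal e" using eU by simp
      finally have "ennreal (m 0 1) \<le> ennreal e"
        unfolding m_def using fin by (subst emeasure_eq_ennreal_measure[symmetric]) auto
      then show ?thesis using e by simp
    qed
    then have "L * m 0 1 \<le> L * e" using L by (rule mult_left_mono)
    ultimately show ?thesis by (simp add: algebra_simps)
  qed note key = this
  show ?thesis
  proof (rule ccontr)
    assume "\<not> g 0 \<le> g 1"
    then have "0 < (g 0 - g 1) / (2 * (1 + L))" using L by simp
    from key[OF this] have "g 0 - g 1 \<le> (1 + L) * ((g 0 - g 1) / (2 * (1 + L)))" .
    also have "\<dots> = (g 0 - g 1) / 2" using L by (simp add: field_simps)
    finally show False using \<open>\<not> g 0 \<le> g 1\<close> by simp
  qed
qed

text \<open>For almost every \<open>w\<close> the segment from \<open>w\<close> to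
  \<open>w + h\<close> meets the bad set in a null set of parameters, and the one-dimensional
  monotonicity lemma applies to \<open>y \<bullet> f (w + t *\<^sub>R h) - \<kappa> * t\<close>. A
  null set has empty interior, so continuity extends the inequality to every
  \<open>w\<close>.\<close>

theorem lipschitz_mean_value_ge:
  fixes f :: "'a::euclidean_space \<Rightarrow> 'b::euclidean_space"
  assumes lip: "L-lipschitz_on UNIV f"
    and der: "\<And>w D. (f has_derivative D) (at w) \<Longrightarrow> \<kappa> \<le> y \<bullet> D h"
  shows "\<kappa> \<le> y \<bullet> (f (w + h) - f w)"
proof -
  have cont: "continuous_on UNIV f" by (rule lipschitz_on_continuous_on[OF lip])
  have "{x. \<not> f differentiable (at x)} \<in> null_sets lebesgue"
    using Rademacher[OF lip] by (simp add: negligible_iff_null_sets)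
  \<comment> \<open>The set of nondifferentiability is only known to be Lebesgue null; slicing along
    lines needs a Borel null superset.\<close>
  then obtain N where N: "N \<in> null_sets lborel" "{x. \<not> f differentiable (at x)} \<subseteq> N"
    unfolding null_sets_completion_iff2 by blast
  have "AE w in lborel. emeasure lborel {t\<in>{0..1::real}. w + t *\<^sub>R h \<in> N} = 0"
    using lborel_line_slices[of N h] N by (subst nn_integral_0_iff_AE[symmetric]) (auto simp: null_sets_def)
  then obtain M where M: "M \<in> null_sets lborel"
    "\<And>w. w \<notin> M \<Longrightarrow> emeasure lborel {t\<in>{0..1::real}. w + t *\<^sub>R h \<in> N} = 0"
    by (auto elim!: AE_E3)
  have line: "\<kappa> \<le> y \<bullet> (f (w + h) - f w)" if w: "w \<notin> M" for w
  proof -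
    define g where "g = (\<lambda>t. y \<bullet> f (w + t *\<^sub>R h) - \<kappa> * t)"
    let ?Z = "{t\<in>{0..1::real}. w + t *\<^sub>R h \<in> N}"
    have "?Z \<in> sets borel"
    proof -
      have "(\<lambda>t. w + t *\<^sub>R h) \<in> borel_measurable borel"
        by (intro borel_measurable_continuous_onI continuous_intros)
      moreover have "N \<in> sets borel" using N by auto
      ultimately have "(\<lambda>t. w + t *\<^sub>R h) -` N \<inter> space borel \<in> sets borel" by (rule measurable_sets)
      then have "(\<lambda>t. w + t *\<^sub>R h) -` N \<in> sets borel" by simp
      then have "{0..1} \<inter> (\<lambda>t. w + t *\<^sub>R h) -` N \<in> sets borel" by simp
      then show ?thesis by (simp add: vimage_def Int_def)
    qed
    then have Z: "negligible ?Z"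
      using M(2)[OF w] by (simp add: negligible_iff_null_sets null_sets_completionI null_sets_def)
    have "g 0 \<le> g 1"
    proof (rule lipschitz_increasing_if_derivative_ae[OF _ Z])
      show "(norm y * (L * norm h) + \<bar>\<kappa>\<bar>)-lipschitz_on UNIV g"
      proof (rule lipschitz_onI)
        fix s t :: real
        have "\<bar>y \<bullet> (f (w + s *\<^sub>R h) - f (w + t *\<^sub>R h))\<bar> \<le> norm y * norm (f (w + s *\<^sub>R h) - f (w + t *\<^sub>R h))"
          by (rule Cauchy_Schwarz_ineq2)
        also have "\<dots> \<le> norm y * (L * norm ((s - t) *\<^sub>R h))"
          using lipschitz_onD[OF lip, of "w + s *\<^sub>R h" "w + t *\<^sub>R h"]
          by (intro mult_left_mono) (auto simp: dist_norm scaleR_diff_left)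
        finally have "\<bar>y \<bullet> (f (w + s *\<^sub>R h) - f (w + t *\<^sub>R h))\<bar> \<le> norm y * (L * norm h) * \<bar>s - t\<bar>"
          by (simp add: mult_ac)
        moreover have "\<bar>\<kappa> * s - \<kappa> * t\<bar> = \<bar>\<kappa>\<bar> * \<bar>s - t\<bar>" by (simp add: abs_mult[symmetric] algebra_simps)
        ultimately show "dist (g s) (g t) \<le> (norm y * (L * norm h) + \<bar>\<kappa>\<bar>) * dist s t"
          unfolding g_def dist_real_def by (simp add: inner_diff_right distrib_right)
      qed (use lipschitz_on_nonneg[OF lip] in simp)
      fix t assume t: "t \<in> {0..1} - ?Z"
      then have "f differentiable (at (w + t *\<^sub>R h))" using N(2) by blast
      then obtain D where D: "(f has_derivative D) (at (w + t *\<^sub>R h))" by (auto simp: differentiable_def)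
      have "((\<lambda>t. w + t *\<^sub>R h) has_derivative (\<lambda>s. s *\<^sub>R h)) (at t)"
        by (auto intro!: derivative_eq_intros)
      from has_derivative_compose[OF this D]
      have "((\<lambda>t. f (w + t *\<^sub>R h)) has_derivative (\<lambda>s. D (s *\<^sub>R h))) (at t)" .
      then have "((\<lambda>t. y \<bullet> f (w + t *\<^sub>R h) - \<kappa> * t) has_derivative (\<lambda>s. y \<bullet> D (s *\<^sub>R h) - \<kappa> * s)) (at t)"
        by (intro derivative_intros)
      moreover have "(\<lambda>s. y \<bullet> D (s *\<^sub>R h) - \<kappa> * s) = (*) (y \<bullet> D h - \<kappa>)"
        using linear_scale[OF has_derivative_linear[OF D]] by (auto simp: algebra_simps)
      ultimately have "(g has_real_derivative (y \<bullet> D h - \<kappa>)) (at t)"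
        unfolding has_field_derivative_def g_def by simp
      then show "\<exists>D\<ge>0. (g has_real_derivative D) (at t)"
        using der[OF D] by (intro exI[of _ "y \<bullet> D h - \<kappa>"]) simp
    qed
    then show ?thesis by (simp add: g_def inner_diff_right)
  qed
  have "negligible M" using M(1) by (simp add: negligible_iff_null_sets null_sets_completionI)
  then have dense: "closure (- M) = UNIV"
    unfolding closure_complement
    using open_not_negligible[OF open_interior] negligible_subset[OF _ interior_subset] by blast
  have "closed {w. \<kappa> \<le> y \<bullet> (f (w + h) - f w)}"
    by (intro closed_Collect_le continuous_intros continuous_on_compose2[OF cont]) auto
  moreover have "- M \<subseteq> {w. \<kappa> \<le> y \<bullet> (f (w + h) - f w)}" using line by auto
  ultimately have "closure (- M) \<subseteq> {w. \<kappa> \<le> y \<bullet> (f (w + h) - f w)}" by (rule closure_minimal[rotated])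
  then show ?thesis using dense by auto
qed

section \<open>Subgradients and multipliers\<close>

text \<open>\<open>a\<close> and \<open>b\<close> stand for the values of a convex function at
  \<open>z0\<close> and \<open>z\<close>, and \<open>(1 - t) * a + t * b\<close> for its convexity
  bound in between. At a minimizer of convex plus smooth, the smooth part may thus be replaced by
  its linearization.\<close>

lemma linearized_min:
  fixes f :: "'a::real_inner \<Rightarrow> real"
  assumes der: "(f has_derivative (\<lambda>h. g \<bullet> h)) (at z0)"
    and min: "\<And>t. 0 < t \<Longrightarrow> t < 1 \<Longrightarrow> a + f z0 \<le> (1 - t) * a + t * b + f (z0 + t *\<^sub>R (z - z0))"
  shows "0 \<le> b - a + g \<bullet> (z - z0)"
proof (rule ccontr)
  assume neg: "\<not> ?thesis"
  let ?G = "\<lambda>t. f (z0 + t *\<^sub>R (z - z0)) + t * (b - a)"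
  have "((\<lambda>t. z0 + t *\<^sub>R (z - z0)) has_derivative (\<lambda>s. s *\<^sub>R (z - z0))) (at 0)"
    by (auto intro!: derivative_eq_intros)
  then have "((\<lambda>t. f (z0 + t *\<^sub>R (z - z0))) has_derivative (\<lambda>s. g \<bullet> (s *\<^sub>R (z - z0)))) (at 0)"
    by (rule has_derivative_compose) (simp add: der)
  then have "((\<lambda>t. f (z0 + t *\<^sub>R (z - z0))) has_real_derivative g \<bullet> (z - z0)) (at 0)"
    unfolding has_field_derivative_def by (rule has_derivative_eq_rhs) (auto simp: mult.commute)
  then have "(?G has_real_derivative g \<bullet> (z - z0) + (b - a)) (at 0)"
    by (auto intro!: derivative_eq_intros)
  moreover have "g \<bullet> (z - z0) + (b - a) < 0" using neg by simp
  ultimately obtain d where d: "d > 0" "\<forall>h>0. h < d \<longrightarrow> ?G (0 + h) < ?G 0"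
    using DERIV_neg_dec_right by blast
  define t where "t = min d 1 / 2"
  have t: "0 < t" "t < d" "t < 1" using d by (auto simp: t_def)
  have "?G t < ?G 0" using d(2) t by auto
  moreover have "?G 0 \<le> ?G t" using min[OF t(1,3)] by (simp add: algebra_simps)
  ultimately show False by simp
qed

lemma ext_convex_real:
  assumes cv: "ext_convex f" and fin: "\<And>x. f x \<noteq> -\<infinity>"
    and x: "x \<in> edom f" and y: "y \<in> edom f" and t: "0 \<le> t" "t \<le> 1"
  shows "(1 - t) *\<^sub>R x + t *\<^sub>R y \<in> edom f"
    and "real_of_ereal (f ((1 - t) *\<^sub>R x + t *\<^sub>R y)) \<le> (1 - t) * real_of_ereal (f x) + t * real_of_ereal (f y)"
proof -
  obtain a where a: "f x = ereal a" using x fin[of x] by (cases "f x") (auto simp: edom_def)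
  obtain b where b: "f y = ereal b" using y fin[of y] by (cases "f y") (auto simp: edom_def)
  have le: "f ((1 - t) *\<^sub>R x + t *\<^sub>R y) \<le> ereal ((1 - t) * a + t * b)"
    using cv t unfolding ext_convex_def by (metis a b plus_ereal.simps(1) times_ereal.simps(1))
  then show "(1 - t) *\<^sub>R x + t *\<^sub>R y \<in> edom f"
    by (auto simp: edom_def intro: le_less_trans)
  show "real_of_ereal (f ((1 - t) *\<^sub>R x + t *\<^sub>R y)) \<le> (1 - t) * real_of_ereal (f x) + t * real_of_ereal (f y)"
    using le fin[of "(1 - t) *\<^sub>R x + t *\<^sub>R y"]
    by (cases "f ((1 - t) *\<^sub>R x + t *\<^sub>R y)") (auto simp: a b)
qed

lemma edom_ereal_real:
  assumes "\<And>x. f x \<noteq> -\<infinity>" "x \<in> edom f"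
  shows "f x = ereal (real_of_ereal (f x))"
  using assms(1)[of x] assms(2) by (cases "f x") (auto simp: edom_def)

lemma subdiff_realI:
  assumes fin: "\<And>x. f x \<noteq> -\<infinity>" and x: "x \<in> edom f"
    and le: "\<And>z. z \<in> edom f \<Longrightarrow> real_of_ereal (f x) + g \<bullet> (z - x) \<le> real_of_ereal (f z)"
  shows "g \<in> subdiff f x"
proof -
  have "f x + ereal (g \<bullet> (z - x)) \<le> f z" for z
  proof (cases "z \<in> edom f")
    case True
    then show ?thesis
      using le[OF True] edom_ereal_real[OF fin x] edom_ereal_real[OF fin True]
      by (metis ereal_less_eq(3) plus_ereal.simps(1))
  next
    case False
    then show ?thesis by (simp add: edom_def)
  qed
  then show ?thesis using x by (auto simp: subdiff_def edom_def)
qed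

lemma subdiff_realD:
  assumes fin: "\<And>x. f x \<noteq> -\<infinity>" and g: "g \<in> subdiff f x" and z: "z \<in> edom f"
  shows "x \<in> edom f" "real_of_ereal (f x) + g \<bullet> (z - x) \<le> real_of_ereal (f z)"
proof -
  show x: "x \<in> edom f" using g by (auto simp: subdiff_def edom_def)
  have "f x + ereal (g \<bullet> (z - x)) \<le> f z" using g by (auto simp: subdiff_def)
  then show "real_of_ereal (f x) + g \<bullet> (z - x) \<le> real_of_ereal (f z)"
    using edom_ereal_real[OF fin x] edom_ereal_real[OF fin z]
    by (metis ereal_less_eq(3) plus_ereal.simps(1))
qed

lemma subdiff_monotone:
  assumes fin: "\<And>x. f x \<noteq> -\<infinity>" and "g \<in> subdiff f x" "h \<in> subdiff f y"
  shows "0 \<le> (g - h) \<bullet> (x - y)"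
proof -
  have "x \<in> edom f" "y \<in> edom f" using assms by (auto simp: subdiff_def edom_def)
  then show ?thesis
    using subdiff_realD(2)[OF fin assms(2), of y] subdiff_realD(2)[OF fin assms(3), of x]
    by (simp add: inner_diff_left inner_diff_right)
qed

lemma argmin_subgradient:
  fixes f :: "'a::real_inner \<Rightarrow> real"
  assumes cv: "ext_convex p" and fin: "\<And>x. p x \<noteq> -\<infinity>" and z0: "z0 \<in> edom p"
    and der: "(f has_derivative (\<lambda>h. g \<bullet> h)) (at z0)"
    and min: "\<And>z. p z0 + ereal (f z0) \<le> p z + ereal (f z)"
  shows "- g \<in> subdiff p z0"
proof (rule subdiff_realI[OF fin z0])
  fix z assume z: "z \<in> edom p"
  have "0 \<le> real_of_ereal (p z) - real_of_ereal (p z0) + g \<bullet> (z - z0)"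
  proof (rule linearized_min[OF der])
    fix t :: real assume t: "0 < t" "t < 1"
    have eq: "z0 + t *\<^sub>R (z - z0) = (1 - t) *\<^sub>R z0 + t *\<^sub>R z" by (simp add: algebra_simps)
    note c = ext_convex_real[OF cv fin z0 z, of t]
    have "z0 + t *\<^sub>R (z - z0) \<in> edom p" using c(1) t unfolding eq by simp
    then obtain b where b: "p (z0 + t *\<^sub>R (z - z0)) = ereal b" using edom_ereal_real[where f=p, OF fin] by blast
    obtain a where a: "p z0 = ereal a" using edom_ereal_real[where f=p, OF fin z0] by blast
    have "real_of_ereal (p z0) + f z0 \<le> real_of_ereal (p (z0 + t *\<^sub>R (z - z0))) + f (z0 + t *\<^sub>R (z - z0))"
      using min[of "z0 + t *\<^sub>R (z - z0)"] by (simp add: a b)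
    then show "real_of_ereal (p z0) + f z0
        \<le> (1 - t) * real_of_ereal (p z0) + t * real_of_ereal (p z) + f (z0 + t *\<^sub>R (z - z0))"
      using c(2) t unfolding eq by linarith
  qed
  then show "real_of_ereal (p z0) + - g \<bullet> (z - z0) \<le> real_of_ereal (p z)" by simp
qed

lemma constr_affine:
  assumes "linear A" "linear B"
  shows "constr A B c ((1 - t) *\<^sub>R w + t *\<^sub>R w') = (1 - t) *\<^sub>R constr A B c w + t *\<^sub>R constr A B c w'"
  using adjoint_linear[OF assms(1)] adjoint_linear[OF assms(2)]
  by (simp add: constr_def linear_add linear_diff linear_scale algebra_simps)

theorem KKT_multiplier:
  fixes p :: "'u::euclidean_space \<Rightarrow> ereal" and q :: "'v::euclidean_space \<Rightarrow> ereal"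
    and A :: "'x::euclidean_space \<Rightarrow> 'u" and B :: "'x \<Rightarrow> 'v"
  assumes p: "ext_convex p" "\<And>x. p x \<noteq> -\<infinity>" and q: "ext_convex q" "\<And>x. q x \<noteq> -\<infinity>"
    and der: "\<And>w. (\<phi> has_derivative (\<lambda>h. grad w \<bullet> h)) (at w)"
    and lin: "linear A" "linear B"
    and sol: "w0 \<in> solution_set p q \<phi> A B c"
    and slater: "wh \<in> rel_interior (edom p \<times> edom q)" "constr A B c wh = 0"
  obtains y where "- (fst (grad w0) + A y) \<in> subdiff p (fst w0)" "- (snd (grad w0) + B y) \<in> subdiff q (snd w0)"
proof -
  define Dm where "Dm = edom p \<times> edom q"
  define F where "F w = real_of_ereal (p (fst w)) + real_of_ereal (q (snd w))" for w
  let ?r = "constr A B c"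
  have cvD: "(1 - t) *\<^sub>R w + t *\<^sub>R w' \<in> Dm" and cvF: "F ((1 - t) *\<^sub>R w + t *\<^sub>R w') \<le> (1 - t) * F w + t * F w'"
    if "w \<in> Dm" "w' \<in> Dm" "0 \<le> t" "t \<le> 1" for w w' t
  proof -
    have m: "fst w \<in> edom p" "fst w' \<in> edom p" "snd w \<in> edom q" "snd w' \<in> edom q"
      using that by (auto simp: Dm_def)
    note 1 = ext_convex_real[OF p m(1,2) that(3,4)] and 2 = ext_convex_real[OF q m(3,4) that(3,4)]
    show "(1 - t) *\<^sub>R w + t *\<^sub>R w' \<in> Dm"
      using 1(1) 2(1) by (auto simp: Dm_def mem_Times_iff)
    show "F ((1 - t) *\<^sub>R w + t *\<^sub>R w') \<le> (1 - t) * F w + t * F w'"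
      using 1(2) 2(2) by (simp add: F_def algebra_simps)
  qed
  have convD: "convex Dm"
    using cvD by (auto simp: convex_alt)
  have obj: "objective p q \<phi> w = ereal (F w + \<phi> w)" if "w \<in> Dm" for w
  proof -
    have m: "fst w \<in> edom p" "snd w \<in> edom q" using that by (auto simp: Dm_def)
    show ?thesis
      unfolding objective_def F_def
      by (subst edom_ereal_real[OF p(2) m(1)], subst edom_ereal_real[OF q(2) m(2)]) simp
  qed
  have r0: "?r w0 = 0" and opt: "\<And>w. ?r w = 0 \<Longrightarrow> objective p q \<phi> w0 \<le> objective p q \<phi> w"
    using sol by (auto simp: solution_set_def)
  have wh: "wh \<in> Dm" using slater(1) rel_interior_subset by (auto simp: Dm_def)
  have "objective p q \<phi> w0 < \<infinity>"
    using opt[OF slater(2)] obj[OF wh] by (auto intro: le_less_trans)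
  then have w0: "w0 \<in> Dm"
    using p(2)[of "fst w0"] q(2)[of "snd w0"]
    by (cases "p (fst w0)"; cases "q (snd w0)") (auto simp: objective_def Dm_def edom_def mem_Times_iff)
  \<comment> \<open>By \<open>linearized_min\<close>, \<open>w0\<close> remains optimal when \<phi>
    is linearized there. Up to a constant, \<open>G\<close> is separable in u and v, so varying one
    block at a time later yields the two subgradient inclusions separately.\<close>
  define G where "G w = F w - F w0 + grad w0 \<bullet> (w - w0)" for w
  have G0: "0 \<le> G w" if w: "w \<in> Dm" "?r w = 0" for w
    unfolding G_def
  proof (rule linearized_min[OF der])
    fix t :: real assume t: "0 < t" "t < 1"
    have eq: "w0 + t *\<^sub>R (w - w0) = (1 - t) *\<^sub>R w0 + t *\<^sub>R w" by (simp add: algebra_simps)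
    have "?r (w0 + t *\<^sub>R (w - w0)) = 0" unfolding eq constr_affine[OF lin] by (simp add: r0 w)
    from opt[OF this] have "F w0 + \<phi> w0 \<le> F (w0 + t *\<^sub>R (w - w0)) + \<phi> (w0 + t *\<^sub>R (w - w0))"
      using t cvD[OF w0 w(1), of t] by (simp add: obj w0 eq)
    then show "F w0 + \<phi> w0 \<le> (1 - t) * F w0 + t * F w + \<phi> (w0 + t *\<^sub>R (w - w0))"
      using cvF[OF w0 w(1), of t] t unfolding eq by simp
  qed
  \<comment> \<open>All points above the value function of the linearized problem, with the
    constraint violation as perturbation. A nonvertical supporting hyperplane at the origin is a
    multiplier.\<close>
  define E where "E = {(?r w, s) | w s. w \<in> Dm \<and> G w \<le> s}"
  have convE: "convex E"
    unfolding convex_alt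
  proof (intro ballI allI impI)
    fix e1 e2 and t :: real assume "e1 \<in> E" "e2 \<in> E" and t: "0 \<le> t \<and> t \<le> 1"
    then obtain w1 s1 w2 s2 where e: "e1 = (?r w1, s1)" "e2 = (?r w2, s2)"
      "w1 \<in> Dm" "w2 \<in> Dm" "G w1 \<le> s1" "G w2 \<le> s2" by (auto simp: E_def)
    let ?w = "(1 - t) *\<^sub>R w1 + t *\<^sub>R w2"
    have "G ?w \<le> (1 - t) * G w1 + t * G w2"
      using cvF[OF e(3,4), of t] t by (simp add: G_def inner_add_right inner_diff_right algebra_simps)
    also have "\<dots> \<le> (1 - t) * s1 + t * s2"
      using e t by (intro add_mono mult_left_mono) auto
    finally have "(?r ?w, (1 - t) * s1 + t * s2) \<in> E"
      using cvD[OF e(3,4), of t] t unfolding E_def by blast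
    then show "(1 - t) *\<^sub>R e1 + t *\<^sub>R e2 \<in> E"
      unfolding e constr_affine[OF lin] by simp
  qed
  have zE: "(0, s) \<in> E" if "0 \<le> s" for s
  proof -
    have "G w0 \<le> s" using that by (simp add: G_def)
    then show ?thesis unfolding E_def using w0 r0 by (metis (mono_tags, lifting) mem_Collect_eq)
  qed
  \<comment> \<open>From a relative interior point the segment coming from \<open>(0, 1)\<close>
    could be prolonged to a negative height above 0, contradicting optimality.\<close>
  have "(0, 0) \<notin> rel_interior E"
  proof
    assume "(0, 0) \<in> rel_interior E"
    moreover have "(0, 1) \<in> affine hull E" using zE[of 1] by (auto intro: hull_inc)
    ultimately obtain e where e: "e > 1" "(1 - e) *\<^sub>R (0, 1) + e *\<^sub>R (0, 0) \<in> E"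
      using convex_rel_interior_if2[OF convE] by blast
    then obtain w where "w \<in> Dm" "?r w = 0" "G w \<le> 1 - e" by (auto simp: E_def)
    then show False using G0[of w] e by simp
  qed
  then obtain ys where ys: "\<And>e. e \<in> E \<Longrightarrow> ys \<bullet> (0, 0) \<le> ys \<bullet> e" "\<And>e. e \<in> rel_interior E \<Longrightarrow> ys \<bullet> (0, 0) < ys \<bullet> e"
    using supporting_hyperplane_rel_boundary[OF convE zE[of 0]] by (metis order_refl)
  obtain y s where ys_eq: "ys = (y, s)" by (cases ys)
  have nonneg: "0 \<le> y \<bullet> ?r w + s * r" if "w \<in> Dm" "G w \<le> r" for w r
  proof -
    have "(?r w, r) \<in> E" unfolding E_def using that by blast
    from ys(1)[OF this] show ?thesis by (simp add: ys_eq inner_prod_def)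
  qed
  have "0 \<le> s" using ys(1)[OF zE[of 1]] by (simp add: ys_eq inner_prod_def)
  \<comment> \<open>A vertical hyperplane is ruled out by Slater's condition:
    \<open>y \<bullet> ?r w\<close> would be nonnegative on \<open>Dm\<close> and zero at the
    relative interior point \<open>wh\<close>; prolonging segments beyond \<open>wh\<close> makes it
    vanish on all of \<open>Dm\<close>, so all of \<open>E\<close> would lie in the hyperplane,
    against the strict inequality on \<open>rel_interior E\<close>.\<close>
  moreover have "s \<noteq> 0"
  proof
    assume s: "s = 0"
    have z: "y \<bullet> ?r w = 0" if w: "w \<in> Dm" for w
    proof -
      have "0 \<le> y \<bullet> ?r w" using nonneg[OF w order_refl] s by simp
      moreover obtain e where e: "e > 1" "(1 - e) *\<^sub>R w + e *\<^sub>R wh \<in> Dm"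
        using convex_rel_interior_if2[OF convD slater(1)[folded Dm_def]] hull_subset[of Dm affine] w by auto
      have "0 \<le> y \<bullet> ?r ((1 - e) *\<^sub>R w + e *\<^sub>R wh)" using nonneg[OF e(2) order_refl] s by simp
      then have "0 \<le> (1 - e) * (y \<bullet> ?r w)" unfolding constr_affine[OF lin] by (simp add: slater)
      then have "y \<bullet> ?r w \<le> 0" using e(1) by (simp add: zero_le_mult_iff)
      ultimately show ?thesis by simp
    qed
    have "rel_interior E \<noteq> {}" using rel_interior_eq_empty[OF convE] zE[of 0] by auto
    then obtain e where e: "e \<in> rel_interior E" by auto
    then have "e \<in> E" using rel_interior_subset by auto
    then have "ys \<bullet> e = 0" using z s by (auto simp: E_def ys_eq inner_prod_def)
    then show False using ys(2)[OF e] by (simp add: ys_eq inner_prod_def)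
  qed
  ultimately have s: "s > 0" by simp
  define x0 where "x0 = y /\<^sub>R s"
  have main: "0 \<le> G w + x0 \<bullet> ?r w" if "w \<in> Dm" for w
  proof -
    have "0 \<le> (y \<bullet> ?r w + s * G w) / s" using nonneg[OF that order_refl] s by simp
    also have "\<dots> = G w + x0 \<bullet> ?r w" using s by (simp add: x0_def field_simps)
    finally show ?thesis .
  qed
  have m: "fst w0 \<in> edom p" "snd w0 \<in> edom q" using w0 by (auto simp: Dm_def)
  have adj: "x \<bullet> adjoint A a = A x \<bullet> a" "x \<bullet> adjoint B b = B x \<bullet> b" for x a b
    using adjoint_works lin by auto
  have r0': "adjoint A (fst w0) = c - adjoint B (snd w0)" using r0 by (simp add: constr_def algebra_simps)
  show thesis
  proof
    show "- (fst (grad w0) + A x0) \<in> subdiff p (fst w0)"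
    proof (rule subdiff_realI[OF p(2) m(1)])
      fix u assume "u \<in> edom p"
      then have "0 \<le> G (u, snd w0) + x0 \<bullet> ?r (u, snd w0)" using m by (intro main) (auto simp: Dm_def)
      moreover have "?r (u, snd w0) = adjoint A u - adjoint A (fst w0)" by (simp add: constr_def r0')
      ultimately show "real_of_ereal (p (fst w0)) + - (fst (grad w0) + A x0) \<bullet> (u - fst w0) \<le> real_of_ereal (p u)"
        by (simp add: G_def F_def inner_prod_def adj inner_diff_right inner_add_left inner_diff_left)
    qed
    show "- (snd (grad w0) + B x0) \<in> subdiff q (snd w0)"
    proof (rule subdiff_realI[OF q(2) m(2)])
      fix v assume "v \<in> edom q"
      then have "0 \<le> G (fst w0, v) + x0 \<bullet> ?r (fst w0, v)" using m by (intro main) (auto simp: Dm_def)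
      moreover have "?r (fst w0, v) = adjoint B v - adjoint B (snd w0)" by (simp add: constr_def r0')
      ultimately show "real_of_ereal (q (snd w0)) + - (snd (grad w0) + B x0) \<bullet> (v - snd w0) \<le> real_of_ereal (q v)"
        by (simp add: G_def F_def inner_prod_def adj inner_diff_right inner_add_left inner_diff_left)
    qed
  qed
qed

section \<open>Gradient increments under Hessian bounds\<close>

text \<open>A constant sequence witnesses membership. The Hessian hypotheses are used only in this
  form; points without a derivative are left to the mean value inequality.\<close>

lemma gen_hessianI:
  assumes "(grad has_derivative D) (at w)"
  shows "Blinfun D \<in> gen_hessian grad w" "blinfun_apply (Blinfun D) = D"
proof -
  show D: "blinfun_apply (Blinfun D) = D"
    using has_derivative_bounded_linear[OF assms] by (rule bounded_linear_Blinfun_apply)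
  show "Blinfun D \<in> gen_hessian grad w"
    unfolding gen_hessian_def
  proof (intro hull_inc CollectI exI conjI)
    show "\<forall>j::nat. (grad has_derivative blinfun_apply (Blinfun D)) (at w)" using assms by (simp add: D)
    show "(\<lambda>j. w) \<longlonglongrightarrow> w" "(\<lambda>j. Blinfun D) \<longlonglongrightarrow> Blinfun D" by auto
  qed
qed

section \<open>Gradient increments along segments and Bregman distances\<close>

lemma has_real_derivative_along_line:
  fixes \<psi> :: "'a::real_inner \<Rightarrow> real"
  assumes "\<And>w. (\<psi> has_derivative (\<lambda>h. g w \<bullet> h)) (at w)"
  shows "((\<lambda>t. \<psi> (w + t *\<^sub>R h)) has_real_derivative g (w + t *\<^sub>R h) \<bullet> h) (at t)"
proof -
  have "((\<lambda>t. w + t *\<^sub>R h) has_derivative (\<lambda>s. s *\<^sub>R h)) (at t)"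
    by (auto intro!: derivative_eq_intros)
  from has_derivative_compose[OF this assms]
  have "((\<lambda>t. \<psi> (w + t *\<^sub>R h)) has_derivative (\<lambda>s. g (w + t *\<^sub>R h) \<bullet> (s *\<^sub>R h))) (at t)" .
  then show ?thesis unfolding has_field_derivative_def by (rule has_derivative_eq_rhs) (auto simp: mult.commute)
qed

text \<open>The constant \<open>c\<close> may have either sign: \<open>c = 0\<close> gives
  convexity, and a nonpositive \<open>c\<close> applied to the negated function gives the upper
  Bregman bound.\<close>

lemma gradient_growth_imp_bregman_ge:
  fixes \<psi> :: "'a::real_inner \<Rightarrow> real"
  assumes der: "\<And>w. (\<psi> has_derivative (\<lambda>h. g w \<bullet> h)) (at w)"
    and mono: "\<And>t. 0 \<le> t \<Longrightarrow> t \<le> 1 \<Longrightarrow> t * c \<le> h \<bullet> (g (w + t *\<^sub>R h) - g w)"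
  shows "c / 2 \<le> \<psi> (w + h) - \<psi> w - g w \<bullet> h"
proof -
  let ?s = "\<lambda>t. \<psi> (w + t *\<^sub>R h) - t * (g w \<bullet> h) - c * t\<^sup>2 / 2"
  have "?s 0 \<le> ?s 1"
  proof (rule DERIV_nonneg_imp_nondecreasing[where f="?s"])
    fix t :: real assume t: "0 \<le> t" "t \<le> 1"
    have "(?s has_real_derivative g (w + t *\<^sub>R h) \<bullet> h - g w \<bullet> h - c * t) (at t)"
      by (auto intro!: derivative_eq_intros has_real_derivative_along_line[OF der])
    moreover have "0 \<le> g (w + t *\<^sub>R h) \<bullet> h - g w \<bullet> h - c * t"
      using mono[OF t] by (simp add: inner_diff_right inner_commute mult.commute)
    ultimately show "\<exists>y. (?s has_real_derivative y) (at t) \<and> 0 \<le> y" by blast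
  qed simp
  then show ?thesis by simp
qed

text \<open>Exchanges the roles of the two directions without second derivatives. The second
  difference over the parallelogram spanned by \<open>a\<close> and \<open>s *\<^sub>R b\<close> is
  at most \<open>s * \<kappa>\<close> when followed along \<open>a\<close>; its derivative in
  \<open>s\<close> at 0 is the quantity to be bounded.\<close>

lemma mixed_difference_symmetry:
  fixes \<psi> :: "'a::real_inner \<Rightarrow> real"
  assumes der: "\<And>w. (\<psi> has_derivative (\<lambda>h. g w \<bullet> h)) (at w)"
    and bd: "\<And>w s. 0 < s \<Longrightarrow> a \<bullet> (g (w + s *\<^sub>R b) - g w) \<le> s * \<kappa>"
  shows "b \<bullet> (g (w + a) - g w) \<le> \<kappa>"
proof (rule ccontr)
  assume neg: "\<not> ?thesis"
  let ?G = "\<lambda>s. \<psi> (w + a + s *\<^sub>R b) - \<psi> (w + s *\<^sub>R b) - (\<psi> (w + a) - \<psi> w) - \<kappa> * s"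
  have "(?G has_real_derivative g (w + a + 0 *\<^sub>R b) \<bullet> b - g (w + 0 *\<^sub>R b) \<bullet> b - \<kappa>) (at 0)"
    by (auto intro!: derivative_eq_intros has_real_derivative_along_line[OF der])
  moreover have "g (w + a + 0 *\<^sub>R b) \<bullet> b - g (w + 0 *\<^sub>R b) \<bullet> b - \<kappa> > 0"
    using neg by (simp add: inner_diff_right inner_commute)
  ultimately obtain d where d: "d > 0" "\<forall>h>0. h < d \<longrightarrow> ?G 0 < ?G (0 + h)"
    using DERIV_pos_inc_right by blast
  define s where "s = d / 2"
  have s: "0 < s" "s < d" using d by (auto simp: s_def)
  let ?F = "\<lambda>t. s * \<kappa> * t - (\<psi> (w + s *\<^sub>R b + t *\<^sub>R a) - \<psi> (w + t *\<^sub>R a))"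
  have "?F 0 \<le> ?F 1"
  proof (rule DERIV_nonneg_imp_nondecreasing[where f="?F"])
    fix t :: real
    have "(?F has_real_derivative s * \<kappa> - (g (w + s *\<^sub>R b + t *\<^sub>R a) \<bullet> a - g (w + t *\<^sub>R a) \<bullet> a)) (at t)"
      by (auto intro!: derivative_eq_intros has_real_derivative_along_line[OF der])
    moreover have "0 \<le> s * \<kappa> - (g (w + s *\<^sub>R b + t *\<^sub>R a) \<bullet> a - g (w + t *\<^sub>R a) \<bullet> a)"
      using bd[OF s(1), of "w + t *\<^sub>R a"] by (simp add: inner_diff_right inner_commute ac_simps)
    ultimately show "\<exists>y. (?F has_real_derivative y) (at t) \<and> 0 \<le> y" by blast
  qed simp
  then have "?G s \<le> 0" by (simp add: algebra_simps)
  moreover have "?G 0 < ?G s" using d(2) s by auto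
  ultimately show False by simp
qed

text \<open>Plays the part of the Cauchy-Schwarz and Young inequalities for an averaged Hessian
  between 0 and \<open>N\<close>: the value at \<open>y - e\<close> is bounded below from
  \<open>x\<close> and above from \<open>y\<close>, and the value at \<open>y\<close> above from
  \<open>x\<close>.\<close>

lemma bregman_cross:
  fixes g :: "'a::real_inner \<Rightarrow> 'a"
  assumes lo: "\<And>x y. \<xi> x + g x \<bullet> (y - x) \<le> \<xi> y"
    and up: "\<And>x y. \<xi> y \<le> \<xi> x + g x \<bullet> (y - x) + N (y - x) / 2"
    and even: "\<And>e. N (- e) = N e"
  shows "e \<bullet> (g y - g x) \<le> (N e + N (y - x)) / 2"
  using lo[of x "y - e"] up[of "y - e" y] up[of y x] even[of e]
  by (simp add: inner_diff_right inner_diff_left inner_commute algebra_simps add_divide_distrib)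

text \<open>Lower bounds from \<open>x\<close> to \<open>z\<close> and from \<open>z\<close> to
  \<open>y\<close> meet an upper bound from \<open>x\<close> to \<open>y\<close>. With old iterate
  \<open>x\<close>, new iterate \<open>y\<close> and solution \<open>z\<close>, this is the price of
  evaluating the gradient at the old point.\<close>

lemma bregman_three_points:
  fixes g :: "'a::real_inner \<Rightarrow> 'a"
  assumes lo: "\<And>x y. \<xi> x + g x \<bullet> (y - x) \<le> \<xi> y"
    and up: "\<And>x y. \<xi> y \<le> \<xi> x + g x \<bullet> (y - x) + N (y - x) / 2"
  shows "- N (y - x) / 2 \<le> (y - z) \<bullet> (g x - g z)"
  using lo[of x z] lo[of z y] up[of y x]
  by (simp add: inner_diff_right inner_diff_left inner_commute algebra_simps)

section \<open>Self-adjoint positive semidefinite operators\<close>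

lemma sa_psdD:
  assumes "sa_psd G"
  shows "linear G" "G x \<bullet> y = x \<bullet> G y" "0 \<le> x \<bullet> G x"
  using assms by (auto simp: sa_psd_def)

lemma sa_psd_expand:
  assumes "sa_psd G"
  shows "G (x + y) = G x + G y" "G (x - y) = G x - G y" "G (- x) = - G x" "G (t *\<^sub>R x) = t *\<^sub>R G x" "G 0 = 0"
  using sa_psdD(1)[OF assms] by (auto simp: linear_add linear_diff linear_neg linear_scale linear_0)

lemma sa_psd_diag_op: "sa_psd D1 \<Longrightarrow> sa_psd D2 \<Longrightarrow> sa_psd (diag_op D1 D2)"
  unfolding sa_psd_def
  by (auto simp: diag_op_def linear_iff inner_prod_def intro!: add_nonneg_nonneg)

section \<open>The smooth term after subtraction of its quadratic minorant\<close>

locale bounded_hessian =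
  fixes \<phi> :: "'u::euclidean_space \<times> 'v::euclidean_space \<Rightarrow> real" and grad Q D1 D2 and \<eta> :: real
  assumes phi_grad: "\<And>w. (\<phi> has_derivative (\<lambda>h. grad w \<bullet> h)) (at w)"
    and grad_lipschitz: "\<exists>L. L-lipschitz_on UNIV grad"
    and Q: "sa_psd Q" and D1: "sa_psd D1" and D2: "sa_psd D2"
    and hess_bounds: "\<And>w W. W \<in> gen_hessian grad w \<Longrightarrow>
          loewner_le Q (blinfun_apply W) \<and>
          loewner_le (blinfun_apply W) (\<lambda>z. Q z + diag_op D1 D2 z)"
    and eta_bound: "\<And>z W a b. W \<in> gen_hessian grad z \<Longrightarrow>
          \<bar>a \<bullet> (block12 (blinfun_apply W) b - block12 Q b)\<bar>
            \<le> \<eta> / 2 * (gnorm2 D1 a + gnorm2 D2 b)"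
begin

lemma residual_gradient_mean_value:
  assumes "\<And>z D. (grad has_derivative D) (at z) \<Longrightarrow> \<kappa> \<le> y \<bullet> (D h - Q h)"
  shows "\<kappa> \<le> y \<bullet> ((grad (w + h) - Q (w + h)) - (grad w - Q w))"
proof -
  obtain L where L: "L-lipschitz_on UNIV grad" using grad_lipschitz by blast
  have "\<kappa> + y \<bullet> Q h \<le> y \<bullet> (grad (w + h) - grad w)"
    by (rule lipschitz_mean_value_ge[OF L]) (use assms in \<open>force simp: inner_diff_right\<close>)
  then show ?thesis
    by (simp add: sa_psd_expand[OF Q] inner_diff_right inner_add_right)
qed

definition "gpsi w = grad w - Q w"
definition "psi w = \<phi> w - (w \<bullet> Q w) / 2"

lemma psi_has_derivative: "(psi has_derivative (\<lambda>h. gpsi w \<bullet> h)) (at w)"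
proof -
  have bl: "bounded_linear Q" using sa_psdD(1)[OF Q] by (rule linear_linear[THEN iffD2])
  have "(psi has_derivative (\<lambda>h. grad w \<bullet> h - (h \<bullet> Q w + w \<bullet> Q h) / 2)) (at w)"
    unfolding psi_def
    by (auto intro!: derivative_eq_intros phi_grad bounded_linear_imp_has_derivative bl simp: add.commute)
  moreover have "grad w \<bullet> h - (h \<bullet> Q w + w \<bullet> Q h) / 2 = gpsi w \<bullet> h" for h
    using sa_psdD(2)[OF Q, of w h] by (simp add: gpsi_def inner_diff_left inner_commute[of h])
  ultimately show ?thesis by simp
qed

lemma gpsi_growth:
  assumes "0 \<le> t"
  shows "0 \<le> h \<bullet> (gpsi (w + t *\<^sub>R h) - gpsi w)"
    and "h \<bullet> (gpsi (w + t *\<^sub>R h) - gpsi w) \<le> t * (h \<bullet> diag_op D1 D2 h)"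
proof -
  have 1: "h \<bullet> Q h \<le> h \<bullet> D h" "h \<bullet> D h \<le> h \<bullet> Q h + h \<bullet> diag_op D1 D2 h" "D (t *\<^sub>R h) = t *\<^sub>R D h"
    if "(grad has_derivative D) (at z)" for D z
    using hess_bounds[OF gen_hessianI(1)[OF that]] linear_scale[OF has_derivative_linear[OF that]]
    unfolding loewner_le_def gen_hessianI(2)[OF that] inner_add_right by blast+
  show "0 \<le> h \<bullet> (gpsi (w + t *\<^sub>R h) - gpsi w)"
    unfolding gpsi_def
  proof (rule residual_gradient_mean_value)
    fix z D assume D: "(grad has_derivative D) (at z)"
    show "0 \<le> h \<bullet> (D (t *\<^sub>R h) - Q (t *\<^sub>R h))"
      unfolding 1(3)[OF D] sa_psd_expand(4)[OF Q] using mult_left_mono[OF 1(1)[OF D] assms]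
      by (simp add: inner_diff_right)
  qed
  have "- (t * (h \<bullet> diag_op D1 D2 h)) \<le> (- h) \<bullet> (gpsi (w + t *\<^sub>R h) - gpsi w)"
    unfolding gpsi_def
  proof (rule residual_gradient_mean_value)
    fix z D assume D: "(grad has_derivative D) (at z)"
    have "t * (h \<bullet> D h) \<le> t * (h \<bullet> Q h + h \<bullet> diag_op D1 D2 h)"
      using 1(2)[OF D] assms by (rule mult_left_mono)
    then show "- (t * (h \<bullet> diag_op D1 D2 h)) \<le> - h \<bullet> (D (t *\<^sub>R h) - Q (t *\<^sub>R h))"
      by (simp add: 1(3)[OF D] sa_psd_expand[OF Q] inner_diff_right distrib_left)
  qed
  then show "h \<bullet> (gpsi (w + t *\<^sub>R h) - gpsi w) \<le> t * (h \<bullet> diag_op D1 D2 h)" by simp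
qed

lemma psi_bregman:
  shows "psi x + gpsi x \<bullet> (y - x) \<le> psi y"
    and "psi y \<le> psi x + gpsi x \<bullet> (y - x) + ((y - x) \<bullet> diag_op D1 D2 (y - x)) / 2"
proof -
  have "0 / 2 \<le> psi (x + (y - x)) - psi x - gpsi x \<bullet> (y - x)"
    by (rule gradient_growth_imp_bregman_ge[OF psi_has_derivative]) (use gpsi_growth(1) in simp)
  then show "psi x + gpsi x \<bullet> (y - x) \<le> psi y" by simp
  have der: "((\<lambda>w. - psi w) has_derivative (\<lambda>h. (- gpsi w) \<bullet> h)) (at w)" for w
    using has_derivative_minus[OF psi_has_derivative] by simp
  have "- ((y - x) \<bullet> diag_op D1 D2 (y - x)) / 2 \<le> - psi (x + (y - x)) - - psi x - (- gpsi x) \<bullet> (y - x)"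
  proof (rule gradient_growth_imp_bregman_ge[where g="\<lambda>w. - gpsi w", OF der])
    fix t :: real assume "0 \<le> t"
    from gpsi_growth(2)[OF this, of "y - x" x]
    show "t * - ((y - x) \<bullet> diag_op D1 D2 (y - x)) \<le> (y - x) \<bullet> (- gpsi (x + t *\<^sub>R (y - x)) - - gpsi x)"
      by (simp add: inner_diff_right)
  qed
  then show "psi y \<le> psi x + gpsi x \<bullet> (y - x) + ((y - x) \<bullet> diag_op D1 D2 (y - x)) / 2" by simp
qed

lemma gpsi_three_points:
  "- ((y - x) \<bullet> diag_op D1 D2 (y - x)) / 2 \<le> (y - z) \<bullet> (gpsi x - gpsi z)"
  using bregman_three_points[where g=gpsi and \<xi>=psi and N="\<lambda>h. h \<bullet> diag_op D1 D2 h"] psi_bregman by blast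

text \<open>The \<eta>-condition controls how the u-gradient reacts to v, whereas the comparison of
  v-steps needs the reaction of the v-gradient to u; \<open>mixed_difference_symmetry\<close>
  mediates between them.\<close>

lemma gpsi_cross_12: "b \<bullet> snd (gpsi (w + (a, 0)) - gpsi w) \<le> \<eta> / 2 * (gnorm2 D1 a + gnorm2 D2 b)"
proof -
  have "(0, b) \<bullet> (gpsi (w + (a, 0)) - gpsi w) \<le> \<eta> / 2 * (gnorm2 D1 a + gnorm2 D2 b)"
  proof (rule mixed_difference_symmetry[OF psi_has_derivative])
    fix w :: "'u \<times> 'v" and s :: real assume s: "0 < s"
    let ?k = "\<eta> / 2 * (gnorm2 D1 a + gnorm2 D2 b)"
    have "- (s * ?k) \<le> (- (a, 0)) \<bullet> (gpsi (w + s *\<^sub>R (0, b)) - gpsi w)"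
      unfolding gpsi_def
    proof (rule residual_gradient_mean_value)
      fix z D assume D: "(grad has_derivative D) (at z)"
      have "a \<bullet> (fst (D (0, b)) - fst (Q (0, b))) \<le> ?k"
        using eta_bound[OF gen_hessianI(1)[OF D], of a b] by (simp add: gen_hessianI(2)[OF D] block12_def)
      then have "s * (a \<bullet> (fst (D (0, b)) - fst (Q (0, b)))) \<le> s * ?k"
        using s by (intro mult_left_mono) auto
      moreover have "- (a, 0) \<bullet> (D (s *\<^sub>R (0, b)) - Q (s *\<^sub>R (0, b))) = - (s * (a \<bullet> (fst (D (0, b)) - fst (Q (0, b)))))"
        unfolding linear_scale[OF has_derivative_linear[OF D]] sa_psd_expand(4)[OF Q]
        by (simp add: inner_prod_def inner_diff_right right_diff_distrib)
      ultimately show "- (s * ?k) \<le> - (a, 0) \<bullet> (D (s *\<^sub>R (0, b)) - Q (s *\<^sub>R (0, b)))" by simp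
    qed
    then show "(a, 0) \<bullet> (gpsi (w + s *\<^sub>R (0, b)) - gpsi w) \<le> s * ?k"
      unfolding inner_minus_left by linarith
  qed
  then show ?thesis by (simp add: inner_prod_def)
qed

text \<open>The left side is an increment of the gradient of \<open>\<xi>\<close>, half the
  \<open>H\<close>-form minus \<open>psi\<close>. Its Bregman distances also lie between 0 and half
  the squared \<open>H\<close>-norm, so \<open>bregman_cross\<close> applies to it.\<close>

lemma gpsi_cross_22:
  "b \<bullet> D2 b' - b \<bullet> snd (gpsi (w + (0, b')) - gpsi w) \<le> (gnorm2 D2 b + gnorm2 D2 b') / 2"
proof -
  let ?H = "diag_op D1 D2"
  have H: "sa_psd ?H" by (rule sa_psd_diag_op[OF D1 D2])
  define \<xi> where "\<xi> z = (z \<bullet> ?H z) / 2 - psi z" for z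
  define g where "g z = ?H z - gpsi z" for z
  have sym: "x \<bullet> ?H y = y \<bullet> ?H x" for x y using sa_psdD(2)[OF H, of x y] by (simp add: inner_commute)
  have exp: "(y \<bullet> ?H y) / 2 = (x \<bullet> ?H x) / 2 + ?H x \<bullet> (y - x) + ((y - x) \<bullet> ?H (y - x)) / 2" for x y
    by (simp add: sa_psd_expand[OF H] inner_diff_right inner_diff_left sym[of y x] inner_commute[of "?H x"] field_simps)
  have lo: "\<xi> x + g x \<bullet> (y - x) \<le> \<xi> y" for x y
    using psi_bregman(2)[of y x] exp[of y x]
    unfolding \<xi>_def g_def inner_diff_left[of "?H x" "gpsi x"] by linarith
  have up: "\<xi> y \<le> \<xi> x + g x \<bullet> (y - x) + ((y - x) \<bullet> ?H (y - x)) / 2" for x y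
    using psi_bregman(1)[of x y] exp[of y x]
    unfolding \<xi>_def g_def inner_diff_left[of "?H x" "gpsi x"] by linarith
  have "(0, b) \<bullet> (g (w + (0, b')) - g w) \<le> ((0, b) \<bullet> ?H (0, b) + (w + (0, b') - w) \<bullet> ?H (w + (0, b') - w)) / 2"
    using lo up by (rule bregman_cross) (simp add: sa_psd_expand[OF H])
  then show ?thesis
    by (simp add: g_def inner_prod_def sa_psd_expand[OF H] gnorm2_def inner_diff_right inner_add_right)
      (simp add: diag_op_def sa_psd_expand[OF D1])
qed

end

section \<open>Optimality conditions of the block steps\<close>

lemma augmented_term_has_derivative:
  fixes J :: "'z::euclidean_space \<Rightarrow> 'u::euclidean_space \<times> 'v::euclidean_space"
    and A :: "'x::euclidean_space \<Rightarrow> 'u" and B :: "'x \<Rightarrow> 'v"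
    and \<phi> grad and e0 w' :: "'u \<times> 'v" and c y :: 'x and \<sigma> :: real and z z0 :: 'z
  assumes J: "linear J" and G: "sa_psd G" and S: "sa_psd S" and AB: "linear A" "linear B"
  defines "f \<equiv> \<lambda>z. phi_hat \<phi> grad G (J z + e0) w' + y \<bullet> constr A B c (J z + e0)
      + \<sigma> / 2 * (norm (constr A B c (J z + e0)))\<^sup>2 + 1/2 * gnorm2 S (z - z0)"
    and "y' \<equiv> y + \<sigma> *\<^sub>R constr A B c (J z + e0)"
  shows "(f has_derivative (\<lambda>h. (grad w' + G (J z + e0 - w') + (A y', B y')) \<bullet> J h + S (z - z0) \<bullet> h)) (at z)"
proof -
  let ?K = "\<lambda>z. constr A B c (J z + e0)" and ?C = "\<lambda>w. adjoint A (fst w) + adjoint B (snd w)"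
  have blJ: "bounded_linear J" and blG: "bounded_linear G" and blS: "bounded_linear S"
    and blA: "bounded_linear (adjoint A)" and blB: "bounded_linear (adjoint B)"
    using J sa_psdD(1)[OF G] sa_psdD(1)[OF S] adjoint_linear[OF AB(1)] adjoint_linear[OF AB(2)]
    by (auto simp: linear_linear)
  have dJ: "(J has_derivative J) (at z)" for z using blJ by (rule bounded_linear_imp_has_derivative)
  have dE: "((\<lambda>z. J z + e0 - w') has_derivative J) (at z)" for z
    by (auto intro!: derivative_eq_intros dJ)
  have dG: "((\<lambda>z. G (J z + e0 - w')) has_derivative (\<lambda>h. G (J h))) (at z)" for z
    by (rule bounded_linear.has_derivative[OF blG dE])
  have dS: "((\<lambda>z. S (z - z0)) has_derivative S) (at z)" for z
    by (rule has_derivative_eq_rhs, rule bounded_linear.has_derivative[OF blS]) (auto intro!: derivative_eq_intros)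
  have dJ0: "((\<lambda>z. J z + e0) has_derivative J) (at z)" for z by (auto intro!: derivative_eq_intros dJ)
  have dK: "(?K has_derivative (\<lambda>h. ?C (J h))) (at z)" for z
    unfolding constr_def
    by (auto intro!: derivative_eq_intros bounded_linear.has_derivative[OF blA] bounded_linear.has_derivative[OF blB]
        bounded_linear.has_derivative[OF bounded_linear_fst] bounded_linear.has_derivative[OF bounded_linear_snd] dJ)
  have f: "f = (\<lambda>z. \<phi> w' + grad w' \<bullet> (J z + e0 - w') + 1/2 * ((J z + e0 - w') \<bullet> G (J z + e0 - w'))
      + y \<bullet> ?K z + \<sigma> / 2 * (?K z \<bullet> ?K z) + 1/2 * ((z - z0) \<bullet> S (z - z0)))"
    unfolding f_def phi_hat_def gnorm2_def power2_norm_eq_inner by (simp add: fun_eq_iff)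
  have "(f has_derivative (\<lambda>h. 0 + grad w' \<bullet> J h + 1/2 * ((J z + e0 - w') \<bullet> G (J h) + J h \<bullet> G (J z + e0 - w'))
      + y \<bullet> ?C (J h) + \<sigma> / 2 * (?K z \<bullet> ?C (J h) + ?C (J h) \<bullet> ?K z) + 1/2 * ((z - z0) \<bullet> S h + (h - 0) \<bullet> S (z - z0)))) (at z)"
    unfolding f
    by (intro has_derivative_add has_derivative_mult_right has_derivative_inner has_derivative_inner_right
        has_derivative_const dE dG dK dS has_derivative_diff has_derivative_ident)
  then show ?thesis
  proof (rule has_derivative_eq_rhs, intro ext)
    fix h
    have adj: "a \<bullet> adjoint A b = A a \<bullet> b" "a \<bullet> adjoint B b' = B a \<bullet> b'" for a b b'
      using adjoint_works AB by auto
    have s1: "(J z + e0 - w') \<bullet> G (J h) = G (J z + e0 - w') \<bullet> J h" using sa_psdD(2)[OF G] by metis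
    have s2: "(z - z0) \<bullet> S h = S (z - z0) \<bullet> h" using sa_psdD(2)[OF S] by metis
    have s3: "a \<bullet> ?C (J h) = (A a, B a) \<bullet> J h" for a by (simp add: inner_add_right adj inner_prod_def)
    have s4: "(A y', B y') = (A y, B y) + \<sigma> *\<^sub>R (A (?K z), B (?K z))"
      unfolding y'_def by (simp add: linear_add[OF AB(1)] linear_add[OF AB(2)] linear_scale[OF AB(1)] linear_scale[OF AB(2)])
    show "0 + grad w' \<bullet> J h + 1/2 * ((J z + e0 - w') \<bullet> G (J h) + J h \<bullet> G (J z + e0 - w'))
      + y \<bullet> ?C (J h) + \<sigma> / 2 * (?K z \<bullet> ?C (J h) + ?C (J h) \<bullet> ?K z) + 1/2 * ((z - z0) \<bullet> S h + (h - 0) \<bullet> S (z - z0))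
      = (grad w' + G (J z + e0 - w') + (A y', B y')) \<bullet> J h + S (z - z0) \<bullet> h"
      unfolding inner_commute[of "?C (J h)" "?K z"] inner_commute[of "J h"] s1 s2 s3 s4 diff_0_right inner_commute[of h]
      unfolding inner_add_left inner_scaleR_left by simp
  qed
qed

lemma edom_if_finite_sum_le:
  assumes "a \<in> edom p" "\<And>z. p z \<noteq> -\<infinity>" "p a0 + ereal s \<le> p a + ereal t"
  shows "a0 \<in> edom p"
  using assms by (cases "p a0"; cases "p a") (auto simp: edom_def)

lemma L_hat_split:
  assumes "\<And>z. p z \<noteq> -\<infinity>" "\<And>z. q z \<noteq> -\<infinity>"
  shows "b \<in> edom q \<Longrightarrow> L_hat p q \<phi> grad G A B c \<sigma> (a, b) y w' + ereal t =
      p a + ereal (phi_hat \<phi> grad G (a, b) w' + y \<bullet> constr A B c (a, b) + \<sigma> / 2 * (norm (constr A B c (a, b)))\<^sup>2 + t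
        + real_of_ereal (q b))"
    and "a \<in> edom p \<Longrightarrow> L_hat p q \<phi> grad G A B c \<sigma> (a, b) y w' + ereal t =
      q b + ereal (phi_hat \<phi> grad G (a, b) w' + y \<bullet> constr A B c (a, b) + \<sigma> / 2 * (norm (constr A B c (a, b)))\<^sup>2 + t
        + real_of_ereal (p a))"
  using assms(1)[of a] assms(2)[of b]
  by (cases "p a"; cases "q b"; auto simp: L_hat_def edom_def)+

lemma block_step_subgradient:
  fixes J :: "'z::euclidean_space \<Rightarrow> 'u::euclidean_space \<times> 'v::euclidean_space"
    and A :: "'x::euclidean_space \<Rightarrow> 'u" and B :: "'x \<Rightarrow> 'v" and P :: "'z \<Rightarrow> ereal"
    and \<phi> grad and e0 w' :: "'u \<times> 'v" and c y :: 'x and \<sigma> t :: real and a0 a' z0 :: 'z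
  assumes cv: "ext_convex P" and fin: "\<And>z. P z \<noteq> -\<infinity>"
    and J: "linear J" and G: "sa_psd G" and S: "sa_psd S" and AB: "linear A" "linear B"
    and a0: "a0 \<in> edom P"
    and proj: "\<And>z h. z \<bullet> J h = pr z \<bullet> h"
    and min: "\<And>a. P a' + ereal (phi_hat \<phi> grad G (J a' + e0) w' + y \<bullet> constr A B c (J a' + e0)
        + \<sigma> / 2 * (norm (constr A B c (J a' + e0)))\<^sup>2 + 1/2 * gnorm2 S (a' - z0) + t)
      \<le> P a + ereal (phi_hat \<phi> grad G (J a + e0) w' + y \<bullet> constr A B c (J a + e0)
        + \<sigma> / 2 * (norm (constr A B c (J a + e0)))\<^sup>2 + 1/2 * gnorm2 S (a - z0) + t)"
  defines "y' \<equiv> y + \<sigma> *\<^sub>R constr A B c (J a' + e0)"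
  shows "a' \<in> edom P" "- (pr (grad w' + G (J a' + e0 - w') + (A y', B y')) + S (a' - z0)) \<in> subdiff P a'"
proof -
  show a': "a' \<in> edom P" using edom_if_finite_sum_le[where p=P, OF a0 fin min] .
  have "((\<lambda>a. phi_hat \<phi> grad G (J a + e0) w' + y \<bullet> constr A B c (J a + e0)
        + \<sigma> / 2 * (norm (constr A B c (J a + e0)))\<^sup>2 + 1/2 * gnorm2 S (a - z0) + t) has_derivative
      (\<lambda>h. (grad w' + G (J a' + e0 - w') + (A y', B y')) \<bullet> J h + S (a' - z0) \<bullet> h + 0)) (at a')"
    unfolding y'_def
    by (rule has_derivative_add[OF augmented_term_has_derivative[OF J G S AB] has_derivative_const])
  then have "((\<lambda>a. phi_hat \<phi> grad G (J a + e0) w' + y \<bullet> constr A B c (J a + e0)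
        + \<sigma> / 2 * (norm (constr A B c (J a + e0)))\<^sup>2 + 1/2 * gnorm2 S (a - z0) + t) has_derivative
      (\<lambda>h. (pr (grad w' + G (J a' + e0 - w') + (A y', B y')) + S (a' - z0)) \<bullet> h)) (at a')"
    by (rule has_derivative_eq_rhs) (simp add: proj inner_add_left)
  then show "- (pr (grad w' + G (J a' + e0 - w') + (A y', B y')) + S (a' - z0)) \<in> subdiff P a'"
    by (rule argmin_subgradient[OF cv fin a']) (rule min)
qed

section \<open>Descent inequalities\<close>

lemma gnorm2_telescope:
  assumes "sa_psd G"
  shows "2 * (y \<bullet> G (y - x)) = gnorm2 G y - gnorm2 G x + gnorm2 G (y - x)"
  using sa_psdD(2)[OF assms, of x y]
  by (simp add: gnorm2_def sa_psd_expand[OF assms] inner_diff_right inner_diff_left inner_commute[of "G x"])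

lemma gnorm2_nonneg: "sa_psd G \<Longrightarrow> 0 \<le> gnorm2 G x"
  by (simp add: gnorm2_def sa_psdD)

lemma gnorm2_young:
  assumes "sa_psd G"
  shows "- (gnorm2 G x + gnorm2 G y) \<le> 2 * (x \<bullet> G y)"
  using gnorm2_nonneg[OF assms, of "x + y"] sa_psdD(2)[OF assms, of x y]
  by (simp add: gnorm2_def sa_psd_expand[OF assms] inner_add_right inner_add_left inner_commute[of "G x"])

lemma gnorm2_diff_le:
  assumes "sa_psd G"
  shows "gnorm2 G (x - y) \<le> 2 * gnorm2 G x + 2 * gnorm2 G y"
  using gnorm2_nonneg[OF assms, of "x + y"]
  by (simp add: gnorm2_def sa_psd_expand[OF assms] inner_add_right inner_add_left inner_diff_right inner_diff_left)

text \<open>\<open>g\<close> stands for the gradient of \<open>\<psi>\<close>, and \<open>(us, vs, xs)\<close> is a KKT point.\<close>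
locale majorized_admm =
  fixes p :: "'u::euclidean_space \<Rightarrow> ereal" and q :: "'v::euclidean_space \<Rightarrow> ereal"
    and g Q :: "'u \<times> 'v \<Rightarrow> 'u \<times> 'v"
    and A :: "'x::euclidean_space \<Rightarrow> 'u" and B :: "'x \<Rightarrow> 'v" and c :: 'x
    and D1 S :: "'u \<Rightarrow> 'u" and D2 T :: "'v \<Rightarrow> 'v" and \<eta> \<sigma> \<tau> :: real
    and u :: "nat \<Rightarrow> 'u" and v :: "nat \<Rightarrow> 'v" and x :: "nat \<Rightarrow> 'x"
    and us :: 'u and vs :: 'v and xs :: 'x
  assumes pfin: "\<And>z. p z \<noteq> -\<infinity>" and qfin: "\<And>z. q z \<noteq> -\<infinity>"
    and Q: "sa_psd Q" and D1: "sa_psd D1" and D2: "sa_psd D2" and S: "sa_psd S" and T: "sa_psd T"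
    and A: "linear A" and B: "linear B" and sigma: "0 < \<sigma>" and tau: "0 < \<tau>" and eta: "0 \<le> \<eta>"
    and three_points: "\<And>w w' z. - gnorm2 (diag_op D1 D2) (w' - w) / 2 \<le> (w' - z) \<bullet> (g w - g z)"
    and cross12: "\<And>w a b. b \<bullet> snd (g (w + (a, 0)) - g w) \<le> \<eta> / 2 * (gnorm2 D1 a + gnorm2 D2 b)"
    and cross22: "\<And>w b b'. b \<bullet> D2 b' - b \<bullet> snd (g (w + (0, b')) - g w) \<le> (gnorm2 D2 b + gnorm2 D2 b') / 2"
    and u_opt: "\<And>k. - (fst (g (u k, v k) + Q (u k, v k) + (Q (u (Suc k) - u k, 0) + diag_op D1 D2 (u (Suc k) - u k, 0)))
        + A (x k + \<sigma> *\<^sub>R constr A B c (u (Suc k), v k)) + S (u (Suc k) - u k)) \<in> subdiff p (u (Suc k))"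
    and v_opt: "\<And>k. - (snd (g (u k, v k) + Q (u k, v k) + (Q (u (Suc k) - u k, v (Suc k) - v k) + diag_op D1 D2 (u (Suc k) - u k, v (Suc k) - v k)))
        + B (x k + \<sigma> *\<^sub>R constr A B c (u (Suc k), v (Suc k))) + T (v (Suc k) - v k)) \<in> subdiff q (v (Suc k))"
    and x_step: "\<And>k. x (Suc k) = x k + (\<tau> * \<sigma>) *\<^sub>R constr A B c (u (Suc k), v (Suc k))"
    and u_kkt: "- (fst (g (us, vs) + Q (us, vs)) + A xs) \<in> subdiff p us"
    and v_kkt: "- (snd (g (us, vs) + Q (us, vs)) + B xs) \<in> subdiff q vs"
    and feas: "constr A B c (us, vs) = 0"
begin

abbreviation "H \<equiv> diag_op D1 D2"
abbreviation "w k \<equiv> (u k, v k)"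
abbreviation "ws \<equiv> (us, vs)"
definition "ue k = u k - us"
definition "ve k = v k - vs"
definition "xe k = x k - xs"
definition "du k = u (Suc k) - u k"
definition "dv k = v (Suc k) - v k"
abbreviation "e k \<equiv> (ue k, ve k)"
abbreviation "d k \<equiv> (du k, dv k)"
definition "r k = constr A B c (u k, v k)"
text \<open>The constraint violation halfway through a step, after the update of u and before that
  of v.\<close>

definition "s k = constr A B c (u (Suc k), v k)"
abbreviation "As \<equiv> adjoint A"
abbreviation "Bs \<equiv> adjoint B"

section \<open>The iteration in terms of errors and increments\<close>

lemma adj: "A y \<bullet> a = y \<bullet> As a" "B y \<bullet> b = y \<bullet> Bs b"
  using adjoint_works A B by (metis inner_commute)+

lemma As_expand: "As (a + a') = As a + As a'" "As (a - a') = As a - As a'" "As 0 = 0"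
  and Bs_expand: "Bs (b + b') = Bs b + Bs b'" "Bs (b - b') = Bs b - Bs b'" "Bs 0 = 0"
  using adjoint_linear[OF A] adjoint_linear[OF B] by (auto simp: linear_add linear_diff linear_0)

lemma c_eq: "c = As us + Bs vs" using feas by (simp add: constr_def)

lemma r_eq: "r k = As (ue k) + Bs (ve k)"
  unfolding r_def constr_def by (simp add: c_eq ue_def ve_def As_expand Bs_expand)

lemma s_eq: "s k = As (ue (Suc k)) + Bs (ve k)"
  unfolding s_def constr_def by (simp add: c_eq ue_def ve_def As_expand Bs_expand)

lemma s_eq': "s k = r (Suc k) - Bs (dv k)"
  by (simp add: s_eq r_eq ve_def dv_def Bs_expand)

lemma As_du: "As (du k) = s k - r k"
  by (simp add: s_eq r_eq ue_def du_def As_expand)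

lemma xe_Suc: "xe (Suc k) = xe k + (\<tau> * \<sigma>) *\<^sub>R r (Suc k)"
  by (simp add: xe_def x_step r_def)

lemma de: "du k = ue (Suc k) - ue k" "dv k = ve (Suc k) - ve k"
  by (auto simp: du_def dv_def ue_def ve_def)

lemma sa_H: "sa_psd H" by (rule sa_psd_diag_op[OF D1 D2])

text \<open>Twice the sum of two monotonicity inequalities, one per block, between new iterate and
  KKT point. The terms with \<open>Q (0, dv k)\<close> and with
  \<open>As (ue (Suc k)) \<bullet> Bs (dv k)\<close> record the Gauss-Seidel asymmetry: the u-step
  still sees the old v.\<close>

lemma one_step:
  "2 * (e (Suc k) \<bullet> Q (e (Suc k))) + 2 * (e (Suc k) \<bullet> (g (w k) - g ws)) + 2 * (e (Suc k) \<bullet> H (d k))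
   + 2 * ((0, ve (Suc k)) \<bullet> Q (0, dv k)) - 2 * (e (Suc k) \<bullet> Q (0, dv k))
   + 2 * (ue (Suc k) \<bullet> S (du k)) + 2 * (ve (Suc k) \<bullet> T (dv k))
   + 2 * ((xe k + \<sigma> *\<^sub>R r (Suc k)) \<bullet> r (Suc k)) - 2 * \<sigma> * (As (ue (Suc k)) \<bullet> Bs (dv k)) \<le> 0"
proof -
  let ?i1 = "(ue (Suc k), 0) :: 'u \<times> 'v" and ?i2 = "(0, ve (Suc k)) :: 'u \<times> 'v"
  let ?a = "(du k, 0) :: 'u \<times> 'v" and ?b = "(0, dv k) :: 'u \<times> 'v"
  have e': "e (Suc k) = ?i1 + ?i2" and d: "d k = ?a + ?b" and ee: "e (Suc k) = e k + d k"
    by (auto simp: de)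
  have Qw: "Q (w k) - Q ws = Q (e k)"
    by (simp add: sa_psd_expand(2)[OF Q, symmetric] ue_def ve_def)
  have Qe: "Q (e (Suc k)) = Q (e k) + Q ?a + Q ?b" and Qd: "Q (d k) = Q ?a + Q ?b"
    unfolding ee d by (simp_all add: sa_psd_expand(1)[OF Q, symmetric])
  have Hd: "H (d k) \<bullet> e (Suc k) = H ?a \<bullet> ?i1 + H (d k) \<bullet> ?i2"
    by (simp add: diag_op_def inner_prod_def sa_psd_expand[OF D1] sa_psd_expand[OF D2])
  have "0 \<le> (- (fst (g (w k) + Q (w k) + (Q ?a + H ?a)) + A (x k + \<sigma> *\<^sub>R s k) + S (du k))
      - - (fst (g ws + Q ws) + A xs)) \<bullet> (u (Suc k) - us)"
    using subdiff_monotone[of p, OF pfin u_opt[of k] u_kkt] unfolding du_def s_def by simp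
  also have "\<dots> = - ((g (w k) - g ws + (Q (w k) - Q ws) + Q ?a + H ?a) \<bullet> ?i1
      + A (xe k + \<sigma> *\<^sub>R s k) \<bullet> ue (Suc k) + S (du k) \<bullet> ue (Suc k))"
    by (simp add: inner_prod_def ue_def xe_def linear_add[OF A] linear_diff[OF A] inner_add_left inner_diff_left)
  finally have 1: "(g (w k) - g ws + Q (e k) + Q ?a + H ?a) \<bullet> ?i1
      + A (xe k + \<sigma> *\<^sub>R s k) \<bullet> ue (Suc k) + S (du k) \<bullet> ue (Suc k) \<le> 0"
    unfolding Qw by linarith
  have "0 \<le> (- (snd (g (w k) + Q (w k) + (Q (d k) + H (d k))) + B (x k + \<sigma> *\<^sub>R r (Suc k)) + T (dv k))
      - - (snd (g ws + Q ws) + B xs)) \<bullet> (v (Suc k) - vs)"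
    using subdiff_monotone[of q, OF qfin v_opt[of k] v_kkt] unfolding du_def dv_def r_def by simp
  also have "\<dots> = - ((g (w k) - g ws + (Q (w k) - Q ws) + Q (d k) + H (d k)) \<bullet> ?i2
      + B (xe k + \<sigma> *\<^sub>R r (Suc k)) \<bullet> ve (Suc k) + T (dv k) \<bullet> ve (Suc k))"
    by (simp add: inner_prod_def ve_def xe_def linear_add[OF B] linear_diff[OF B] inner_add_left inner_diff_left)
  finally have 2: "(g (w k) - g ws + Q (e k) + Q (d k) + H (d k)) \<bullet> ?i2
      + B (xe k + \<sigma> *\<^sub>R r (Suc k)) \<bullet> ve (Suc k) + T (dv k) \<bullet> ve (Suc k) \<le> 0"
    unfolding Qw by linarith
  have 3: "A (xe k + \<sigma> *\<^sub>R s k) \<bullet> ue (Suc k) + B (xe k + \<sigma> *\<^sub>R r (Suc k)) \<bullet> ve (Suc k)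
     = (xe k + \<sigma> *\<^sub>R r (Suc k)) \<bullet> r (Suc k) - \<sigma> * (As (ue (Suc k)) \<bullet> Bs (dv k))"
    unfolding adj s_eq' r_eq
    by (simp add: inner_add_left inner_add_right inner_diff_left scaleR_diff_right scaleR_add_right inner_commute algebra_simps)
  have 4: "(g (w k) - g ws + Q (e k) + Q ?a + H ?a) \<bullet> ?i1 + (g (w k) - g ws + Q (e k) + Q (d k) + H (d k)) \<bullet> ?i2
     = Q (e (Suc k)) \<bullet> e (Suc k) + (g (w k) - g ws) \<bullet> e (Suc k) + H (d k) \<bullet> e (Suc k) + Q ?b \<bullet> ?i2 - Q ?b \<bullet> e (Suc k)"
    unfolding Hd unfolding Qe Qd unfolding e' inner_add_left inner_add_right inner_diff_left by simp
  show ?thesis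
    using 1 2 3 4 by (simp only: inner_commute[of "e (Suc k)"] inner_commute[of ?i2]
      inner_commute[of "ue (Suc k)"] inner_commute[of "ve (Suc k)"])
qed

lemma multiplier_step:
  "2 * ((xe k + \<sigma> *\<^sub>R r (Suc k)) \<bullet> r (Suc k)) =
   ((norm (xe (Suc k)))\<^sup>2 - (norm (xe k))\<^sup>2) / (\<tau> * \<sigma>) + (2 - \<tau>) * \<sigma> * (norm (r (Suc k)))\<^sup>2"
proof -
  have "(norm (xe (Suc k)))\<^sup>2 - (norm (xe k))\<^sup>2 = (\<tau> * \<sigma>) * (2 * (xe k \<bullet> r (Suc k)) + \<tau> * \<sigma> * (r (Suc k) \<bullet> r (Suc k)))"
    unfolding xe_Suc power2_norm_eq_inner by (simp add: inner_add_left inner_add_right inner_commute algebra_simps)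
  then have "((norm (xe (Suc k)))\<^sup>2 - (norm (xe k))\<^sup>2) / (\<tau> * \<sigma>) = 2 * (xe k \<bullet> r (Suc k)) + \<tau> * \<sigma> * (r (Suc k) \<bullet> r (Suc k))"
    using sigma tau by simp
  then show ?thesis
    by (simp add: power2_norm_eq_inner inner_add_left algebra_simps)
qed

lemma coupling_step:
  "- 2 * (As (ue (Suc k)) \<bullet> Bs (dv k)) =
   (norm (Bs (ve (Suc k))))\<^sup>2 - (norm (Bs (ve k)))\<^sup>2 + (norm (Bs (dv k)))\<^sup>2 - 2 * (r (Suc k) \<bullet> Bs (dv k))"
  by (simp add: r_eq de Bs_expand power2_norm_eq_inner inner_diff_left inner_diff_right inner_add_left inner_commute algebra_simps)

text \<open>A Lyapunov function gathering what telescopes in \<open>one_step\<close>: the quadratic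
  terms by \<open>gnorm2_telescope\<close>, the multiplier error by \<open>multiplier_step\<close>,
  and the \<open>Bs\<close> term by \<open>coupling_step\<close>.\<close>

definition "\<Phi> k = gnorm2 H (e k) + gnorm2 Q (0, ve k) + gnorm2 S (ue k) + gnorm2 T (ve k)
   + (norm (xe k))\<^sup>2 / (\<tau> * \<sigma>) + \<sigma> * (norm (Bs (ve k)))\<^sup>2"

lemma Phi_nonneg: "0 \<le> \<Phi> k"
  unfolding \<Phi>_def using sigma tau
  by (intro add_nonneg_nonneg gnorm2_nonneg sa_H Q S T divide_nonneg_nonneg mult_nonneg_nonneg) auto

text \<open>The loss \<open>- gnorm2 H (d k)\<close> from \<open>three_points\<close> cancels the
  term \<open>gnorm2 H (d k)\<close> left by telescoping, so no increment in \<open>H\<close>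
  survives.\<close>

lemma one_step_Phi:
  "\<Phi> (Suc k) - \<Phi> k + 2 * gnorm2 Q (e (Suc k)) - 2 * (e (Suc k) \<bullet> Q (0, dv k)) + gnorm2 Q (0, dv k)
   + gnorm2 S (du k) + gnorm2 T (dv k) + (2 - \<tau>) * \<sigma> * (norm (r (Suc k)))\<^sup>2
   + \<sigma> * (norm (Bs (dv k)))\<^sup>2 - 2 * \<sigma> * (r (Suc k) \<bullet> Bs (dv k)) \<le> 0"
proof -
  have ed: "e (Suc k) - e k = d k" by (simp add: de)
  have 1: "- gnorm2 H (d k) \<le> 2 * (e (Suc k) \<bullet> (g (w k) - g ws))"
    using three_points[of "w (Suc k)" "w k" ws] by (simp add: ue_def ve_def du_def dv_def)
  have 2: "2 * (e (Suc k) \<bullet> H (d k)) = gnorm2 H (e (Suc k)) - gnorm2 H (e k) + gnorm2 H (d k)"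
    using gnorm2_telescope[OF sa_H, of "e (Suc k)" "e k"] unfolding ed .
  have 3: "2 * ((0, ve (Suc k)) \<bullet> Q (0, dv k)) = gnorm2 Q (0, ve (Suc k)) - gnorm2 Q (0, ve k) + gnorm2 Q (0, dv k)"
    using gnorm2_telescope[OF Q, of "(0, ve (Suc k))" "(0, ve k)"] by (simp add: de)
  have 4: "2 * (ue (Suc k) \<bullet> S (du k)) = gnorm2 S (ue (Suc k)) - gnorm2 S (ue k) + gnorm2 S (du k)"
    using gnorm2_telescope[OF S, of "ue (Suc k)" "ue k"] by (simp add: de)
  have 5: "2 * (ve (Suc k) \<bullet> T (dv k)) = gnorm2 T (ve (Suc k)) - gnorm2 T (ve k) + gnorm2 T (dv k)"
    using gnorm2_telescope[OF T, of "ve (Suc k)" "ve k"] by (simp add: de)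
  have 6: "- 2 * \<sigma> * (As (ue (Suc k)) \<bullet> Bs (dv k)) = \<sigma> * (norm (Bs (ve (Suc k))))\<^sup>2 - \<sigma> * (norm (Bs (ve k)))\<^sup>2
      + \<sigma> * (norm (Bs (dv k)))\<^sup>2 - 2 * \<sigma> * (r (Suc k) \<bullet> Bs (dv k))"
    using arg_cong[OF coupling_step[of k], of "\<lambda>z. \<sigma> * z"] by (simp add: algebra_simps)
  have 7: "e (Suc k) \<bullet> Q (e (Suc k)) = gnorm2 Q (e (Suc k))" by (simp add: gnorm2_def)
  show ?thesis
    using one_step[of k] 1 2 3 4 5 6 7 multiplier_step[of k] unfolding \<Phi>_def diff_divide_distrib by linarith
qed

text \<open>Half of the new squared error is deliberately kept on the left, to telescope with the
  half of the old one on the right.\<close>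

lemma e_split: "gnorm2 Q (d k) / 4 + gnorm2 Q (e (Suc k)) / 2 \<le> gnorm2 Q (e (Suc k)) + gnorm2 Q (e k) / 2"
proof -
  have ed: "e (Suc k) - e k = d k" by (simp add: de)
  show ?thesis using gnorm2_diff_le[OF Q, of "e (Suc k)" "e k"] unfolding ed
    by (simp add: field_simps)
qed

text \<open>Of the weight \<open>2 - \<tau>\<close> on the squared violation, one unit completes the
  indefinite product with \<open>Bs (dv k)\<close> to the square of \<open>s k\<close>; the
  remaining \<open>1 - \<tau>\<close> is nonnegative exactly when \<tau> is at most 1.\<close>

lemma descent_small_tau:
  "\<Phi> (Suc k) + gnorm2 Q (e (Suc k)) / 2 + gnorm2 Q (d k) / 4 + gnorm2 S (du k) + gnorm2 T (dv k)
   + (1 - \<tau>) * \<sigma> * (norm (r (Suc k)))\<^sup>2 + \<sigma> * (norm (s k))\<^sup>2 \<le> \<Phi> k + gnorm2 Q (e k) / 2"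
proof -
  have 1: "2 * (e (Suc k) \<bullet> Q (0, dv k)) \<le> gnorm2 Q (e (Suc k)) + gnorm2 Q (0, dv k)"
    using gnorm2_young[OF Q, of "- e (Suc k)" "(0, dv k)"]
    by (simp add: gnorm2_def sa_psd_expand[OF Q] del: uminus_Pair)
  have 2: "\<sigma> * (norm (s k))\<^sup>2 = \<sigma> * (norm (r (Suc k)))\<^sup>2 - 2 * \<sigma> * (r (Suc k) \<bullet> Bs (dv k)) + \<sigma> * (norm (Bs (dv k)))\<^sup>2"
    unfolding s_eq' power2_norm_eq_inner by (simp add: inner_diff_left inner_diff_right inner_commute algebra_simps)
  have 3: "(2 - \<tau>) * \<sigma> * (norm (r (Suc k)))\<^sup>2 = (1 - \<tau>) * \<sigma> * (norm (r (Suc k)))\<^sup>2 + \<sigma> * (norm (r (Suc k)))\<^sup>2"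
    by (simp add: algebra_simps)
  show ?thesis using one_step_Phi[of k] 1 2 3 e_split[of k] by linarith
qed

text \<open>Monotonicity of the subdifferential of \<open>q\<close> between consecutive v-iterates.
  Since the multiplier moves by \<open>(\<tau> * \<sigma>) *\<^sub>R r (Suc k)\<close>, the product
  of the new violation with \<open>Bs (dv (Suc k))\<close> is traded for the old violation with the
  factor \<open>1 - \<tau>\<close>.\<close>

lemma two_step:
  "2 * ((0, dv (Suc k)) \<bullet> Q (d (Suc k))) + gnorm2 D2 (dv (Suc k)) - gnorm2 D2 (dv k)
   - \<eta> * gnorm2 D1 (du k) - \<eta> * gnorm2 D2 (dv (Suc k)) + gnorm2 T (dv (Suc k)) - gnorm2 T (dv k)
   + 2 * \<sigma> * (r (Suc (Suc k)) \<bullet> Bs (dv (Suc k))) - 2 * (1 - \<tau>) * \<sigma> * (r (Suc k) \<bullet> Bs (dv (Suc k))) \<le> 0"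
proof -
  let ?b = "dv (Suc k)"
  have Qw: "Q (w (Suc k)) - Q (w k) = Q (d k)"
    by (simp add: sa_psd_expand(2)[OF Q, symmetric] du_def dv_def)
  have xx: "x (Suc k) - x k = (\<tau> * \<sigma>) *\<^sub>R r (Suc k)" by (simp add: x_step r_def)
  have "0 \<le> (- (snd (g (w (Suc k)) + Q (w (Suc k)) + (Q (d (Suc k)) + H (d (Suc k)))) + B (x (Suc k) + \<sigma> *\<^sub>R r (Suc (Suc k))) + T ?b)
      - - (snd (g (w k) + Q (w k) + (Q (d k) + H (d k))) + B (x k + \<sigma> *\<^sub>R r (Suc k)) + T (dv k))) \<bullet> (v (Suc (Suc k)) - v (Suc k))"
    using subdiff_monotone[of q, OF qfin v_opt[of "Suc k"] v_opt[of k]] unfolding du_def dv_def r_def by simp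
  also have "\<dots> = - (snd (g (w (Suc k)) - g (w k) + (Q (w (Suc k)) - Q (w k)) + Q (d (Suc k)) - Q (d k)) \<bullet> ?b
      + (D2 ?b - D2 (dv k)) \<bullet> ?b + (T ?b - T (dv k)) \<bullet> ?b
      + B ((x (Suc k) - x k) + \<sigma> *\<^sub>R r (Suc (Suc k)) - \<sigma> *\<^sub>R r (Suc k)) \<bullet> ?b)"
    unfolding dv_def[of "Suc k", symmetric]
    by (simp add: diag_op_def linear_add[OF B] linear_diff[OF B] inner_add_left inner_diff_left)
  finally have 1: "snd (g (w (Suc k)) - g (w k)) \<bullet> ?b + (0, ?b) \<bullet> Q (d (Suc k))
      + (D2 ?b - D2 (dv k)) \<bullet> ?b + (T ?b - T (dv k)) \<bullet> ?b
      + B ((\<tau> * \<sigma>) *\<^sub>R r (Suc k) + \<sigma> *\<^sub>R r (Suc (Suc k)) - \<sigma> *\<^sub>R r (Suc k)) \<bullet> ?b \<le> 0"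
    unfolding Qw xx by (simp add: inner_prod_def inner_add_left inner_diff_left inner_add_right inner_diff_right inner_commute)
  have 2: "B ((\<tau> * \<sigma>) *\<^sub>R r (Suc k) + \<sigma> *\<^sub>R r (Suc (Suc k)) - \<sigma> *\<^sub>R r (Suc k)) \<bullet> ?b
      = \<sigma> * (r (Suc (Suc k)) \<bullet> Bs ?b) - (1 - \<tau>) * \<sigma> * (r (Suc k) \<bullet> Bs ?b)"
    unfolding adj by (simp add: inner_add_left inner_diff_left algebra_simps)
  have 3: "2 * ((T ?b - T (dv k)) \<bullet> ?b) \<ge> gnorm2 T ?b - gnorm2 T (dv k)"
    using gnorm2_telescope[OF T, of ?b "dv k"] gnorm2_nonneg[OF T, of "?b - dv k"]
    by (simp add: sa_psd_expand[OF T] inner_commute)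
  \<comment> \<open>The gradient increment is split at the point with new u and old v: the first leg
    is mixed and costs \<eta>, the second moves only v and is absorbed together with the lagged term
    \<open>D2 (dv k)\<close>.\<close>
  let ?m = "w k + (du k, 0)"
  have m: "w (Suc k) = ?m + (0, dv k)" by (simp add: du_def dv_def)
  have 4: "- (\<eta> / 2 * (gnorm2 D1 (du k) + gnorm2 D2 ?b)) \<le> ?b \<bullet> snd (g ?m - g (w k))"
    using cross12[of "- ?b" "w k" "du k"] by (simp add: gnorm2_def sa_psd_expand[OF D2])
  have 5: "?b \<bullet> D2 (dv k) - ?b \<bullet> snd (g (w (Suc k)) - g ?m) \<le> (gnorm2 D2 ?b + gnorm2 D2 (dv k)) / 2"
    using cross22[of ?b "dv k" ?m] unfolding m .
  have 6: "snd (g (w (Suc k)) - g (w k)) \<bullet> ?b = ?b \<bullet> snd (g (w (Suc k)) - g ?m) + ?b \<bullet> snd (g ?m - g (w k))"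
    by (simp add: inner_diff_right inner_commute inner_diff_left)
  have 7: "(D2 ?b - D2 (dv k)) \<bullet> ?b = gnorm2 D2 ?b - ?b \<bullet> D2 (dv k)"
    unfolding inner_commute[of _ ?b] inner_diff_right gnorm2_def ..
  have 8: "\<eta> / 2 * (gnorm2 D1 (du k) + gnorm2 D2 ?b) = (\<eta> * gnorm2 D1 (du k) + \<eta> * gnorm2 D2 ?b) / 2"
    by (simp add: algebra_simps)
  show ?thesis using 1 3 4 5 unfolding 2 6 7 8 add_divide_distrib by linarith
qed

text \<open>\<open>\<kappa>1\<close> and \<open>\<kappa>2\<close> come from Young's inequality with weight 1 if \<open>\<tau> \<le> 1\<close>, and weight \<open>\<tau>\<close> otherwise;
  positivity of \<open>\<kappa>2\<close> is where the golden ratio enters.\<close>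
lemma golden_ratio_split:
  assumes "\<tau> < (1 + sqrt 5) / 2"
  obtains \<kappa>1 \<kappa>2 where "0 \<le> \<kappa>1" "0 < \<kappa>2"
    "\<And>(a::'x) (b::'x) (b'::'x). \<kappa>1 * ((norm b')\<^sup>2 - (norm b)\<^sup>2) + \<kappa>2 * ((norm b')\<^sup>2 + (norm a)\<^sup>2)
       \<le> (2 - \<tau>) * (norm b')\<^sup>2 + (norm a)\<^sup>2 - 2 * (1 - \<tau>) * (b \<bullet> a)"
proof (cases "\<tau> \<le> 1")
  case True
  have "(1 - \<tau>) * ((norm b')\<^sup>2 - (norm b)\<^sup>2) + \<tau> * ((norm b')\<^sup>2 + (norm a)\<^sup>2)
       \<le> (2 - \<tau>) * (norm b')\<^sup>2 + (norm a)\<^sup>2 - 2 * (1 - \<tau>) * (b \<bullet> a)" for a b b' :: 'x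
  proof -
    have "0 \<le> (1 - \<tau>) * ((norm (b - a))\<^sup>2)" using True by simp
    also have "(norm (b - a))\<^sup>2 = (norm b)\<^sup>2 + (norm a)\<^sup>2 - 2 * (b \<bullet> a)"
      unfolding power2_norm_eq_inner by (simp add: inner_diff_left inner_diff_right inner_commute)
    finally have 1: "0 \<le> (1 - \<tau>) * ((norm b)\<^sup>2 + (norm a)\<^sup>2 - 2 * (b \<bullet> a))" .
    have "0 \<le> (1 - \<tau>) * (norm b')\<^sup>2" using True by simp
    with 1 show ?thesis by (simp add: algebra_simps)
  qed
  then show ?thesis using that[of "1 - \<tau>" \<tau>] True tau by auto
next
  case False
  \<comment> \<open>After Young's inequality, \<open>(norm b')\<^sup>2\<close> retains
    \<open>2 - \<tau> - (1 - 1 / \<tau>)\<close>, which is this number, and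
    \<open>(norm a)\<^sup>2\<close> retains \<tau> times it.\<close>
  define z where "z = (1 + \<tau> - \<tau>\<^sup>2) / \<tau>"
  have "(2 * \<tau> - 1)\<^sup>2 < (sqrt 5)\<^sup>2" using assms False by (intro power_strict_mono) auto
  then have pos: "0 < 1 + \<tau> - \<tau>\<^sup>2" by (simp add: power2_eq_square algebra_simps)
  then have z: "0 < z" using tau by (simp add: z_def)
  have zt: "z = 1 / \<tau> + 1 - \<tau>" using tau by (simp add: z_def power2_eq_square field_simps)
  have zle: "z \<le> 1 + \<tau> - \<tau>\<^sup>2" using pos False tau by (simp add: z_def divide_le_eq mult_le_cancel_left1)
  have "(1 - 1 / \<tau>) * ((norm b')\<^sup>2 - (norm b)\<^sup>2) + z * ((norm b')\<^sup>2 + (norm a)\<^sup>2)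
       \<le> (2 - \<tau>) * (norm b')\<^sup>2 + (norm a)\<^sup>2 - 2 * (1 - \<tau>) * (b \<bullet> a)" for a b b' :: 'x
  proof -
    have "0 \<le> ((\<tau> - 1) / \<tau>) * ((norm (b + \<tau> *\<^sub>R a))\<^sup>2)" using False by simp
    also have "(norm (b + \<tau> *\<^sub>R a))\<^sup>2 = (norm b)\<^sup>2 + \<tau>\<^sup>2 * (norm a)\<^sup>2 + 2 * \<tau> * (b \<bullet> a)"
      unfolding power2_norm_eq_inner by (simp add: inner_add_left inner_add_right inner_commute power2_eq_square)
    also have "((\<tau> - 1) / \<tau>) * \<dots> = (1 - 1 / \<tau>) * (norm b)\<^sup>2 + (\<tau>\<^sup>2 - \<tau>) * (norm a)\<^sup>2 - 2 * (1 - \<tau>) * (b \<bullet> a)"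
      using tau by (simp add: field_simps power2_eq_square)
    finally have 1: "0 \<le> (1 - 1 / \<tau>) * (norm b)\<^sup>2 + (\<tau>\<^sup>2 - \<tau>) * (norm a)\<^sup>2 - 2 * (1 - \<tau>) * (b \<bullet> a)" .
    have 2: "z * (norm a)\<^sup>2 \<le> (1 + \<tau> - \<tau>\<^sup>2) * (norm a)\<^sup>2" using zle by (rule mult_right_mono) simp
    have 3: "z * (norm b')\<^sup>2 = (1 / \<tau> + 1 - \<tau>) * (norm b')\<^sup>2" by (simp add: zt)
    show ?thesis using 1 2 3 by (simp add: algebra_simps)
  qed
  then show ?thesis using that[of "1 - 1 / \<tau>" z] False z by auto
qed

text \<open>Adding \<open>two_step\<close> to the next \<open>one_step_Phi\<close> removes the
  indefinite product with the new violation and replaces the new error by the old one in the cross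
  term with \<open>Q\<close>. Young's inequality then leaves twice the new minus once the old
  squared \<open>Q\<close>-error; \<open>e_split\<close> takes its share, whence the weight 3/2. The
  other additions in \<open>\<Psi>\<close> are the lagged terms of \<open>two_step\<close> and of
  the \<kappa>-inequality.\<close>

lemma descent_large_tau:
  assumes \<kappa>: "\<And>(a::'x) (b::'x) (b'::'x). \<kappa>1 * ((norm b')\<^sup>2 - (norm b)\<^sup>2) + \<kappa>2 * ((norm b')\<^sup>2 + (norm a)\<^sup>2)
       \<le> (2 - \<tau>) * (norm b')\<^sup>2 + (norm a)\<^sup>2 - 2 * (1 - \<tau>) * (b \<bullet> a)"
  defines "\<Psi> \<equiv> \<lambda>k. \<Phi> (Suc k) + 3 / 2 * gnorm2 Q (e (Suc k)) + gnorm2 D2 (dv k) + gnorm2 T (dv k)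
       + \<eta> * gnorm2 D1 (du k) + \<sigma> * (\<kappa>1 * (norm (r (Suc k)))\<^sup>2)"
  shows "\<Psi> (Suc k) + (gnorm2 Q (d (Suc k)) / 4 + gnorm2 S (du (Suc k)) + gnorm2 T (dv (Suc k))
        - \<eta> * gnorm2 D1 (du (Suc k)) - \<eta> * gnorm2 D2 (dv (Suc k)))
       + \<sigma> * (\<kappa>2 * ((norm (r (Suc (Suc k))))\<^sup>2 + (norm (Bs (dv (Suc k))))\<^sup>2)) \<le> \<Psi> k"
proof -
  let ?b = "(0, dv (Suc k)) :: 'u \<times> 'v"
  have ee: "e (Suc (Suc k)) = e (Suc k) + d (Suc k)" by (simp add: de)
  have 1: "2 * (?b \<bullet> Q (d (Suc k))) = 2 * (e (Suc (Suc k)) \<bullet> Q ?b) - 2 * (e (Suc k) \<bullet> Q ?b)"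
    unfolding ee inner_add_left using sa_psdD(2)[OF Q, of "d (Suc k)" ?b] by (simp add: inner_commute)
  have 2: "2 * (e (Suc k) \<bullet> Q ?b) \<le> gnorm2 Q (e (Suc k)) + gnorm2 Q ?b"
    using gnorm2_young[OF Q, of "- e (Suc k)" ?b]
    by (simp add: gnorm2_def sa_psd_expand[OF Q] del: uminus_Pair)
  have "\<sigma> * (\<kappa>1 * ((norm (r (Suc (Suc k))))\<^sup>2 - (norm (r (Suc k)))\<^sup>2) + \<kappa>2 * ((norm (r (Suc (Suc k))))\<^sup>2 + (norm (Bs (dv (Suc k))))\<^sup>2))
     \<le> \<sigma> * ((2 - \<tau>) * (norm (r (Suc (Suc k))))\<^sup>2 + (norm (Bs (dv (Suc k))))\<^sup>2 - 2 * (1 - \<tau>) * (r (Suc k) \<bullet> Bs (dv (Suc k))))"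
    using \<kappa> sigma by (intro mult_left_mono) auto
  then have 3: "\<sigma> * (\<kappa>1 * (norm (r (Suc (Suc k))))\<^sup>2) - \<sigma> * (\<kappa>1 * (norm (r (Suc k)))\<^sup>2)
       + \<sigma> * (\<kappa>2 * ((norm (r (Suc (Suc k))))\<^sup>2 + (norm (Bs (dv (Suc k))))\<^sup>2))
     \<le> (2 - \<tau>) * \<sigma> * (norm (r (Suc (Suc k))))\<^sup>2 + \<sigma> * (norm (Bs (dv (Suc k))))\<^sup>2
       - 2 * (1 - \<tau>) * \<sigma> * (r (Suc k) \<bullet> Bs (dv (Suc k)))"
    by (simp add: algebra_simps)
  show ?thesis
    unfolding \<Psi>_def using one_step_Phi[of "Suc k"] two_step[of k] 1 2 3 e_split[of "Suc k"] by linarith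
qed

end

section \<open>Summability of the residuals\<close>

lemma summable_of_descent:
  fixes \<Psi> t :: "nat \<Rightarrow> real"
  assumes "\<And>k. 0 \<le> \<Psi> k" "\<And>k. 0 \<le> t k" and step: "\<And>k. \<Psi> (Suc k) + t k \<le> \<Psi> k"
  shows "summable t"
proof (rule summableI_nonneg_bounded)
  fix n
  have "sum t {..<n} \<le> \<Psi> 0 - \<Psi> n"
  proof (induction n)
    case (Suc n)
    then show ?case using step[of n] by simp
  qed simp
  then show "sum t {..<n} \<le> \<Psi> 0" using assms(1)[of n] by simp
qed (rule assms(2))

lemma op_pd_coercive:
  fixes G :: "'a::euclidean_space \<Rightarrow> 'a"
  assumes lin: "linear G" and pd: "op_pd G"
  obtains m where "0 < m" "\<And>z. m * (norm z)\<^sup>2 \<le> z \<bullet> G z"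
proof -
  have "continuous_on (sphere 0 1) (\<lambda>z. z \<bullet> G z)"
    by (intro continuous_intros linear_continuous_on linear_linear[THEN iffD2] lin)
  moreover have "sphere 0 1 \<noteq> ({} :: 'a set)" by simp
  ultimately obtain z0 :: 'a where z0: "z0 \<in> sphere 0 1" "\<And>z. z \<in> sphere 0 1 \<Longrightarrow> z0 \<bullet> G z0 \<le> z \<bullet> G z"
    using continuous_attains_inf[OF compact_sphere] by blast
  have "z0 \<noteq> 0" using z0(1) by auto
  then have "0 < z0 \<bullet> G z0" using pd by (simp add: op_pd_def)
  moreover have "(z0 \<bullet> G z0) * (norm z)\<^sup>2 \<le> z \<bullet> G z" for z
  proof (cases "z = 0")
    case False
    then have "z0 \<bullet> G z0 \<le> (z /\<^sub>R norm z) \<bullet> G (z /\<^sub>R norm z)" by (intro z0(2)) simp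
    also have "\<dots> = (z \<bullet> G z) / (norm z)\<^sup>2"
      by (simp add: linear_scale[OF lin] power2_eq_square divide_inverse)
    finally show ?thesis using False by (simp add: pos_le_divide_eq)
  qed (simp add: linear_0[OF lin])
  ultimately show thesis using that by blast
qed

lemma norm_diff_sq_le: "(norm (a - b :: 'a::real_inner))\<^sup>2 \<le> 2 * (norm a)\<^sup>2 + 2 * (norm b)\<^sup>2"
proof -
  have "0 \<le> (norm (a + b))\<^sup>2" by simp
  then show ?thesis
    unfolding power2_norm_eq_inner
    by (simp add: inner_add_left inner_add_right inner_diff_left inner_diff_right)
qed

section \<open>Square summability of increments and constraint violations\<close>

context majorized_admm
begin

text \<open>With free \<open>S'\<close>, \<open>T'\<close> and \<open>t\<close>, this covers all
  three operator conditions: \<open>t = (1 - \<tau>) * \<sigma>\<close> in the first case,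
  \<open>t = \<sigma>\<close> and \<open>t = 0\<close> in the second.\<close>

lemma quadratic_form:
  "(a, b) \<bullet> ((1/4) *\<^sub>R Q (a, b) + diag_op (\<lambda>a. S' a + t *\<^sub>R A (As a)) (\<lambda>b. T' b + t *\<^sub>R B (Bs b)) (a, b))
   = gnorm2 Q (a, b) / 4 + gnorm2 S' a + gnorm2 T' b + t * ((norm (As a))\<^sup>2 + (norm (Bs b))\<^sup>2)"
  by (simp add: gnorm2_def diag_op_def inner_add_right inner_commute[of a "A _"] inner_commute[of b "B _"] adj
      power2_norm_eq_inner algebra_simps)

lemma linear_quadratic_form:
  assumes "linear S'" "linear T'"
  shows "linear (\<lambda>z. (1/4) *\<^sub>R Q z + diag_op (\<lambda>a. S' a + t *\<^sub>R A (As a)) (\<lambda>b. T' b + t *\<^sub>R B (Bs b)) z)"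
proof (rule linearI)
  note lin = linear_add[OF assms(1)] linear_add[OF assms(2)] linear_add[OF A] linear_add[OF B]
    linear_add[OF adjoint_linear[OF A]] linear_add[OF adjoint_linear[OF B]] linear_add[OF sa_psdD(1)[OF Q]]
  show "(1/4) *\<^sub>R Q (z + z') + diag_op (\<lambda>a. S' a + t *\<^sub>R A (As a)) (\<lambda>b. T' b + t *\<^sub>R B (Bs b)) (z + z') =
    ((1/4) *\<^sub>R Q z + diag_op (\<lambda>a. S' a + t *\<^sub>R A (As a)) (\<lambda>b. T' b + t *\<^sub>R B (Bs b)) z) +
    ((1/4) *\<^sub>R Q z' + diag_op (\<lambda>a. S' a + t *\<^sub>R A (As a)) (\<lambda>b. T' b + t *\<^sub>R B (Bs b)) z')" for z z'
    by (simp add: diag_op_def case_prod_beta lin prod_eq_iff scaleR_add_right)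
  note lin = linear_scale[OF assms(1)] linear_scale[OF assms(2)] linear_scale[OF A] linear_scale[OF B]
    linear_scale[OF adjoint_linear[OF A]] linear_scale[OF adjoint_linear[OF B]] linear_scale[OF sa_psdD(1)[OF Q]]
  show "(1/4) *\<^sub>R Q (y *\<^sub>R z) + diag_op (\<lambda>a. S' a + t *\<^sub>R A (As a)) (\<lambda>b. T' b + t *\<^sub>R B (Bs b)) (y *\<^sub>R z) =
    y *\<^sub>R ((1/4) *\<^sub>R Q z + diag_op (\<lambda>a. S' a + t *\<^sub>R A (As a)) (\<lambda>b. T' b + t *\<^sub>R B (Bs b)) z)" for y z
    by (simp add: diag_op_def case_prod_beta lin prod_eq_iff scaleR_add_right mult.commute)
qed

text \<open>The shift \<open>n\<close> permits bounds for an increment that refer to violations from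
  earlier steps.\<close>

lemma summable_if_coercive:
  assumes lin: "linear S'" "linear T'"
    and pd: "op_pd (\<lambda>z. (1/4) *\<^sub>R Q z + diag_op (\<lambda>a. S' a + t *\<^sub>R A (As a)) (\<lambda>b. T' b + t *\<^sub>R B (Bs b)) z)"
    and y: "summable y"
    and le: "\<And>k. gnorm2 Q (d (k + n)) / 4 + gnorm2 S' (du (k + n)) + gnorm2 T' (dv (k + n))
       + t * ((norm (As (du (k + n))))\<^sup>2 + (norm (Bs (dv (k + n))))\<^sup>2) \<le> y k"
  shows "summable (\<lambda>k. (norm (d k))\<^sup>2)"
proof -
  obtain m where m: "0 < m" "\<And>z. m * (norm z)\<^sup>2 \<le> z \<bullet> ((1/4) *\<^sub>R Q z +
      diag_op (\<lambda>a. S' a + t *\<^sub>R A (As a)) (\<lambda>b. T' b + t *\<^sub>R B (Bs b)) z)"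
    by (rule op_pd_coercive[OF linear_quadratic_form[OF lin] pd]) (rule that)
  have "(norm (d (k + n)))\<^sup>2 \<le> y k / m" for k
  proof -
    have "m * (norm (d (k + n)))\<^sup>2 \<le> y k"
      using m(2)[of "d (k + n)"] le[of k] unfolding quadratic_form by linarith
    then show ?thesis using m(1) by (simp add: pos_le_divide_eq mult.commute)
  qed
  note bound = this
  have "summable (\<lambda>k. (norm (d (k + n)))\<^sup>2)"
  proof (rule summable_comparison_test'[OF summable_divide[OF y, of m], of 0])
    show "norm ((norm (d (k + n)))\<^sup>2) \<le> y k / m" for k
      using bound[of k] unfolding real_norm_def abs_power2 .
  qed
  then show ?thesis using summable_iff_shift[of "\<lambda>k. (norm (d k))\<^sup>2"] by blast
qed

text \<open>The \<open>A\<close> and \<open>B\<close> parts of the positive definite form are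
  recovered from the violations: \<open>As (du k)\<close> is \<open>s k - r k\<close> and
  \<open>Bs (dv k)\<close> is \<open>r (Suc k) - s k\<close>.\<close>

lemma summable_small_tau:
  assumes "\<tau> \<le> 1"
    and pd: "op_pd (\<lambda>z. (1/4) *\<^sub>R Q z + diag_op (\<lambda>a. S a + ((1 - \<tau>) * \<sigma>) *\<^sub>R A (As a))
        (\<lambda>b. T b + ((1 - \<tau>) * \<sigma>) *\<^sub>R B (Bs b)) z)"
  shows "summable (\<lambda>k. (norm (d k))\<^sup>2)" "summable (\<lambda>k. (norm (r (Suc k)))\<^sup>2)"
proof -
  define t where "t k = gnorm2 Q (d k) / 4 + gnorm2 S (du k) + gnorm2 T (dv k)
   + (1 - \<tau>) * \<sigma> * (norm (r (Suc k)))\<^sup>2 + \<sigma> * (norm (s k))\<^sup>2" for k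
  have nn: "0 \<le> gnorm2 Q (d k)" "0 \<le> gnorm2 S (du k)" "0 \<le> gnorm2 T (dv k)"
     "0 \<le> (1 - \<tau>) * \<sigma> * (norm (r (Suc k)))\<^sup>2" "0 \<le> \<sigma> * (norm (s k))\<^sup>2" for k
    using gnorm2_nonneg Q S T sigma assms(1) by auto
  have sum_t: "summable t"
  proof (rule summable_of_descent[where \<Psi>="\<lambda>k. \<Phi> k + gnorm2 Q (e k) / 2"])
    show "0 \<le> \<Phi> k + gnorm2 Q (e k) / 2" for k using Phi_nonneg[of k] gnorm2_nonneg[OF Q, of "e k"] by simp
    show "0 \<le> t k" for k unfolding t_def using nn[of k] by simp
    show "\<Phi> (Suc k) + gnorm2 Q (e (Suc k)) / 2 + t k \<le> \<Phi> k + gnorm2 Q (e k) / 2" for k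
      using descent_small_tau[of k] unfolding t_def by linarith
  qed
  have small: "(1 - \<tau>) * \<sigma> * X \<le> \<sigma> * X" if "0 \<le> X" for X
    using that tau sigma by (simp add: mult_right_mono)
  show d: "summable (\<lambda>k. (norm (d k))\<^sup>2)"
  \<comment> \<open>The increment with index \<open>Suc k\<close> involves \<open>r (Suc k)\<close>,
    which is contained in \<open>t k\<close>, and later violations contained in
    \<open>t (Suc k)\<close>; without the shift \<open>r 0\<close> would occur, which no
    \<open>t\<close> contains. The factor 5 is generous.\<close>
  proof (rule summable_if_coercive[OF _ _ pd, where n=1 and y="\<lambda>k. 5 * (t (Suc k) + t k)"])
    show "linear S" "linear T" using S T by (auto simp: sa_psd_def)
    show "summable (\<lambda>k. 5 * (t (Suc k) + t k))"
      using sum_t by (intro summable_mult summable_add) (auto simp: summable_Suc_iff)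
    fix k
    let ?c = "(1 - \<tau>) * \<sigma>"
    have c: "0 \<le> ?c" using assms(1) sigma by simp
    have "?c * (norm (As (du (Suc k))))\<^sup>2 \<le> ?c * (2 * (norm (s (Suc k)))\<^sup>2 + 2 * (norm (r (Suc k)))\<^sup>2)"
      unfolding As_du by (rule mult_left_mono[OF norm_diff_sq_le c])
    then have 1: "?c * (norm (As (du (Suc k))))\<^sup>2 \<le> 2 * (?c * (norm (s (Suc k)))\<^sup>2) + 2 * (?c * (norm (r (Suc k)))\<^sup>2)"
      by (simp add: algebra_simps)
    have Bdv: "Bs (dv (Suc k)) = r (Suc (Suc k)) - s (Suc k)" by (simp add: s_eq')
    have "?c * (norm (Bs (dv (Suc k))))\<^sup>2 \<le> ?c * (2 * (norm (r (Suc (Suc k))))\<^sup>2 + 2 * (norm (s (Suc k)))\<^sup>2)"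
      unfolding Bdv by (rule mult_left_mono[OF norm_diff_sq_le c])
    then have 2: "?c * (norm (Bs (dv (Suc k))))\<^sup>2 \<le> 2 * (?c * (norm (r (Suc (Suc k))))\<^sup>2) + 2 * (?c * (norm (s (Suc k)))\<^sup>2)"
      by (simp add: algebra_simps)
    have 3: "?c * (norm (s (Suc k)))\<^sup>2 \<le> \<sigma> * (norm (s (Suc k)))\<^sup>2" by (rule small) simp
    have 4: "?c * ((norm (As (du (Suc k))))\<^sup>2 + (norm (Bs (dv (Suc k))))\<^sup>2)
        = ?c * (norm (As (du (Suc k))))\<^sup>2 + ?c * (norm (Bs (dv (Suc k))))\<^sup>2" by (rule distrib_left)
    have "gnorm2 Q (d (Suc k)) / 4 + gnorm2 S (du (Suc k)) + gnorm2 T (dv (Suc k))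
       + ?c * ((norm (As (du (Suc k))))\<^sup>2 + (norm (Bs (dv (Suc k))))\<^sup>2) \<le> 5 * (t (Suc k) + t k)"
      unfolding 4 t_def distrib_left using 1 2 3 nn[of k] nn[of "Suc k"] by linarith
    then show "gnorm2 Q (d (k + 1)) / 4 + gnorm2 S (du (k + 1)) + gnorm2 T (dv (k + 1))
       + ?c * ((norm (As (du (k + 1))))\<^sup>2 + (norm (Bs (dv (k + 1))))\<^sup>2) \<le> 5 * (t (Suc k) + t k)"
      by simp
  qed
  \<comment> \<open>For \<open>\<tau> = 1\<close> the violation has weight 0 in \<open>t\<close>. It
    is recovered from \<open>r (Suc k) = s k + Bs (dv k)\<close>, now that the increments are known
    to be square summable.\<close>
  obtain K where K: "\<And>b. norm (Bs b) \<le> K * norm b"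
    using linear_bounded[OF adjoint_linear[OF B]] by blast
  have rb: "(norm (r (Suc k)))\<^sup>2 \<le> 2 / \<sigma> * t k + 2 * (\<bar>K\<bar>\<^sup>2 * (norm (d k))\<^sup>2)" for k
  proof -
    have "r (Suc k) = s k - (- Bs (dv k))" by (simp add: s_eq')
    then have "(norm (r (Suc k)))\<^sup>2 \<le> 2 * (norm (s k))\<^sup>2 + 2 * (norm (Bs (dv k)))\<^sup>2"
      using norm_diff_sq_le[of "s k" "- Bs (dv k)"] by simp
    moreover have "\<sigma> * (norm (s k))\<^sup>2 \<le> t k" unfolding t_def using nn[of k] by linarith
    then have "2 * (norm (s k))\<^sup>2 \<le> 2 / \<sigma> * t k" using sigma by (simp add: field_simps)
    moreover have "norm (Bs (dv k)) \<le> \<bar>K\<bar> * norm (d k)"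
    proof -
      have "norm (Bs (dv k)) \<le> \<bar>K\<bar> * norm (dv k)"
        using K[of "dv k"] by (meson abs_ge_self mult_right_mono norm_ge_zero order_trans)
      also have "\<dots> \<le> \<bar>K\<bar> * norm (d k)" by (intro mult_left_mono norm_snd_le) auto
      finally show ?thesis .
    qed
    then have "(norm (Bs (dv k)))\<^sup>2 \<le> \<bar>K\<bar>\<^sup>2 * (norm (d k))\<^sup>2"
      by (metis norm_ge_zero power_mono power_mult_distrib)
    ultimately show ?thesis by linarith
  qed
  show "summable (\<lambda>k. (norm (r (Suc k)))\<^sup>2)"
  proof (rule summable_comparison_test'[of _ 0])
    show "summable (\<lambda>k. 2 / \<sigma> * t k + 2 * (\<bar>K\<bar>\<^sup>2 * (norm (d k))\<^sup>2))"
      by (intro summable_add summable_mult sum_t d)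
    show "norm ((norm (r (Suc k)))\<^sup>2) \<le> 2 / \<sigma> * t k + 2 * (\<bar>K\<bar>\<^sup>2 * (norm (d k))\<^sup>2)" for k
      using rb[of k] unfolding real_norm_def abs_power2 .
  qed
qed

text \<open>The semidefinite condition makes the increment part \<open>P\<close> of the decrease
  nonnegative, so the \<kappa>2 part alone yields summable violations and \<open>Bs (dv k)\<close>.
  These supply what the positive definite form needs beyond \<open>P\<close>.\<close>

lemma summable_large_tau:
  assumes "\<tau> < (1 + sqrt 5) / 2"
    and psd: "op_psd (\<lambda>z. (1/4) *\<^sub>R Q z + diag_op (\<lambda>a. S a - \<eta> *\<^sub>R D1 a) (\<lambda>b. T b - \<eta> *\<^sub>R D2 b) z)"
    and pd: "op_pd (\<lambda>z. (1/4) *\<^sub>R Q z + diag_op (\<lambda>a. S a + \<sigma> *\<^sub>R A (As a) - \<eta> *\<^sub>R D1 a)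
                          (\<lambda>b. T b + \<sigma> *\<^sub>R B (Bs b) - \<eta> *\<^sub>R D2 b) z)"
  shows "summable (\<lambda>k. (norm (d k))\<^sup>2)" "summable (\<lambda>k. (norm (r (Suc k)))\<^sup>2)"
proof -
  obtain \<kappa>1 \<kappa>2 where \<kappa>: "0 \<le> \<kappa>1" "0 < \<kappa>2"
    and \<kappa>': "\<And>(a::'x) (b::'x) (b'::'x). \<kappa>1 * ((norm b')\<^sup>2 - (norm b)\<^sup>2) + \<kappa>2 * ((norm b')\<^sup>2 + (norm a)\<^sup>2)
       \<le> (2 - \<tau>) * (norm b')\<^sup>2 + (norm a)\<^sup>2 - 2 * (1 - \<tau>) * (b \<bullet> a)"
    using golden_ratio_split[OF assms(1)] by metis
  let ?S = "\<lambda>a. S a - \<eta> *\<^sub>R D1 a" and ?T = "\<lambda>b. T b - \<eta> *\<^sub>R D2 b"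
  have ST: "gnorm2 ?S a = gnorm2 S a - \<eta> * gnorm2 D1 a" "gnorm2 ?T b = gnorm2 T b - \<eta> * gnorm2 D2 b" for a b
    by (simp_all add: gnorm2_def inner_diff_right)
  define R where "R k = (norm (r (Suc (Suc k))))\<^sup>2 + (norm (Bs (dv (Suc k))))\<^sup>2" for k
  define P where "P k = gnorm2 Q (d (Suc k)) / 4 + gnorm2 ?S (du (Suc k)) + gnorm2 ?T (dv (Suc k))" for k
  define t where "t k = P k + \<sigma> * (\<kappa>2 * R k)" for k
  have P: "0 \<le> P k" for k
  proof -
    have "0 \<le> d (Suc k) \<bullet> ((1/4) *\<^sub>R Q (d (Suc k)) + diag_op ?S ?T (d (Suc k)))"
      using psd unfolding op_psd_def by blast
    then show ?thesis using quadratic_form[of "du (Suc k)" "dv (Suc k)" ?S 0 ?T] by (simp add: P_def)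
  qed
  have R: "0 \<le> R k" for k by (simp add: R_def)
  have R': "0 \<le> \<sigma> * (\<kappa>2 * R k)" for k using R[of k] sigma \<kappa> by simp
  have sum_t: "summable t"
  proof (rule summable_of_descent)
    let ?Psi = "\<lambda>k. \<Phi> (Suc k) + 3 / 2 * gnorm2 Q (e (Suc k)) + gnorm2 D2 (dv k) + gnorm2 T (dv k)
       + \<eta> * gnorm2 D1 (du k) + \<sigma> * (\<kappa>1 * (norm (r (Suc k)))\<^sup>2)"
    show "0 \<le> ?Psi k" for k
      using sigma \<kappa> eta by (intro add_nonneg_nonneg Phi_nonneg mult_nonneg_nonneg gnorm2_nonneg Q D1 D2 T) auto
    show "0 \<le> t k" for k using P[of k] R'[of k] by (simp add: t_def)
    show "?Psi (Suc k) + t k \<le> ?Psi k" for k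
      using descent_large_tau[OF \<kappa>', of k] unfolding t_def P_def R_def ST by linarith
  qed
  have "summable (\<lambda>k. \<sigma> * (\<kappa>2 * R k))"
  proof (rule summable_comparison_test'[OF sum_t, of 0])
    show "norm (\<sigma> * (\<kappa>2 * R k)) \<le> t k" for k
      using P[of k] unfolding t_def real_norm_def abs_of_nonneg[OF R'[of k]] by simp
  qed
  then have "summable (\<lambda>k. inverse (\<sigma> * \<kappa>2) * (\<sigma> * (\<kappa>2 * R k)))" by (rule summable_mult)
  then have sum_R: "summable R" using sigma \<kappa> by (simp add: field_simps)
  have "summable (\<lambda>k. (norm (r (Suc (Suc k))))\<^sup>2)"
    by (rule summable_comparison_test'[OF sum_R, of 0]) (auto simp: R_def)
  then show "summable (\<lambda>k. (norm (r (Suc k)))\<^sup>2)"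
    using summable_Suc_iff[of "\<lambda>k. (norm (r (Suc k)))\<^sup>2"] by simp
  have pd': "op_pd (\<lambda>z. (1/4) *\<^sub>R Q z + diag_op (\<lambda>a. ?S a + \<sigma> *\<^sub>R A (As a)) (\<lambda>b. ?T b + \<sigma> *\<^sub>R B (Bs b)) z)"
    using pd by (simp add: algebra_simps)
  show "summable (\<lambda>k. (norm (d k))\<^sup>2)"
  \<comment> \<open>\<open>As (du k)\<close> equals \<open>r (Suc k) - Bs (dv k) - r k\<close>. At
    index \<open>k + 2\<close> the first two terms are controlled by \<open>R (Suc k)\<close> and
    the last by \<open>R k\<close>; the factor 6 leaves slack.\<close>
  proof (rule summable_if_coercive[OF _ _ pd', where n=2 and y="\<lambda>k. t (Suc k) + 6 * \<sigma> * R (Suc k) + 6 * \<sigma> * R k"])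
    show "linear ?S" "linear ?T"
      using S T D1 D2 by (auto simp: sa_psd_def linear_iff algebra_simps)
    show "summable (\<lambda>k. t (Suc k) + 6 * \<sigma> * R (Suc k) + 6 * \<sigma> * R k)"
      using sum_t sum_R by (intro summable_mult summable_add) (auto simp: summable_Suc_iff)
    fix k
    let ?k = "Suc (Suc k)"
    have "(norm (As (du ?k)))\<^sup>2 \<le> 2 * (norm (s ?k))\<^sup>2 + 2 * (norm (r ?k))\<^sup>2"
      unfolding As_du by (rule norm_diff_sq_le)
    moreover have "(norm (s ?k))\<^sup>2 \<le> 2 * (norm (r (Suc ?k)))\<^sup>2 + 2 * (norm (Bs (dv ?k)))\<^sup>2"
      unfolding s_eq' by (rule norm_diff_sq_le)
    moreover have "0 \<le> (norm (r ?k))\<^sup>2" "0 \<le> (norm (r (Suc ?k)))\<^sup>2" "0 \<le> (norm (Bs (dv ?k)))\<^sup>2" "0 \<le> (norm (Bs (dv (Suc k))))\<^sup>2" by auto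
    ultimately have "(norm (As (du ?k)))\<^sup>2 + (norm (Bs (dv ?k)))\<^sup>2 \<le> 6 * R (Suc k) + 6 * R k"
      unfolding R_def distrib_left by linarith
    then have "\<sigma> * ((norm (As (du ?k)))\<^sup>2 + (norm (Bs (dv ?k)))\<^sup>2) \<le> \<sigma> * (6 * R (Suc k) + 6 * R k)"
      using sigma by (intro mult_left_mono) auto
    then have "P (Suc k) + \<sigma> * ((norm (As (du ?k)))\<^sup>2 + (norm (Bs (dv ?k)))\<^sup>2) \<le> t (Suc k) + 6 * \<sigma> * R (Suc k) + 6 * \<sigma> * R k"
      using R'[of "Suc k"] unfolding t_def by (simp add: algebra_simps)
    then show "gnorm2 Q (d (k + 2)) / 4 + gnorm2 ?S (du (k + 2)) + gnorm2 ?T (dv (k + 2))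
       + \<sigma> * ((norm (As (du (k + 2))))\<^sup>2 + (norm (Bs (dv (k + 2))))\<^sup>2) \<le> t (Suc k) + 6 * \<sigma> * R (Suc k) + 6 * \<sigma> * R k"
      unfolding P_def by (simp add: numeral_2_eq_2)
  qed
qed

text \<open>The two optimality conditions give the explicit element \<open>z k\<close> of the set
  once the gradient is moved to the new point and the multiplier to its new value. The corrections
  are controlled linearly by \<open>d k\<close> and \<open>r (Suc k)\<close>; those from the
  multiplier are \<open>((\<tau> - 1) * \<sigma>) *\<^sub>R r (Suc k)\<close> and, in the u-block,
  also \<open>\<sigma> *\<^sub>R Bs (dv k)\<close>.\<close>

lemma residual_bound:
  assumes lip: "L-lipschitz_on UNIV (\<lambda>w. g w + Q w)"
  obtains C where
    "\<And>k. F_map p q (\<lambda>w. g w + Q w) A B (u (Suc k)) (v (Suc k)) (x (Suc k)) \<noteq> {}"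
    "\<And>k. residual p q (\<lambda>w. g w + Q w) A B c (u (Suc k)) (v (Suc k)) (x (Suc k))
          \<le> C * ((norm (d k))\<^sup>2 + (norm (r (Suc k)))\<^sup>2)"
proof -
  let ?G = "\<lambda>w. g w + Q w" and ?QH = "\<lambda>z. Q z + H z"
  have linQH: "linear ?QH"
    using sa_psdD(1)[OF Q] sa_psdD(1)[OF sa_H] by (rule linear_compose_add)
  obtain K where K: "0 < K" "\<And>z. norm (?QH z) \<le> K * norm z" using linear_bounded_pos[OF linQH] by blast
  obtain KS where KS: "0 < KS" "\<And>z. norm (S z) \<le> KS * norm z" using linear_bounded_pos[OF sa_psdD(1)[OF S]] by blast
  obtain KT where KT: "0 < KT" "\<And>z. norm (T z) \<le> KT * norm z" using linear_bounded_pos[OF sa_psdD(1)[OF T]] by blast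
  obtain KA where KA: "0 < KA" "\<And>z. norm (A z) \<le> KA * norm z" using linear_bounded_pos[OF A] by blast
  obtain KB where KB: "0 < KB" "\<And>z. norm (B z) \<le> KB * norm z" using linear_bounded_pos[OF B] by blast
  obtain Kb where Kb: "0 < Kb" "\<And>z. norm (Bs z) \<le> Kb * norm z" using linear_bounded_pos[OF adjoint_linear[OF B]] by blast
  have L: "0 \<le> L" by (rule lipschitz_on_nonneg[OF lip])
  define z where "z k = ?G (w (Suc k)) +
     (- (fst (?G (w k) + ?QH (du k, 0)) + A (x k + \<sigma> *\<^sub>R s k) + S (du k)) + A (x (Suc k)),
      - (snd (?G (w k) + ?QH (d k)) + B (x k + \<sigma> *\<^sub>R r (Suc k)) + T (dv k)) + B (x (Suc k)))" for k
  have zF: "z k \<in> F_map p q ?G A B (u (Suc k)) (v (Suc k)) (x (Suc k))" for k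
    unfolding F_map_def z_def mem_Collect_eq
    by (intro exI conjI refl) (use u_opt[of k] v_opt[of k] in \<open>simp_all add: du_def dv_def s_def r_def\<close>)
  define M where "M = 2 * L + 2 * K + KS + KT + KA * (\<bar>\<tau> - 1\<bar> * \<sigma> + \<sigma> * Kb) + KB * (\<bar>\<tau> - 1\<bar> * \<sigma>)"
  have M: "0 \<le> M" unfolding M_def using L K KS KT KA KB Kb sigma by auto
  have zM: "norm (z k) \<le> M * (norm (d k) + norm (r (Suc k)))" for k
  proof -
    let ?n = "norm (d k)" and ?\<rho> = "norm (r (Suc k))"
    have du: "norm (du k) \<le> ?n" and dv: "norm (dv k) \<le> ?n"
      using norm_fst_le[of "du k" "dv k"] norm_snd_le[of "dv k" "du k"] by auto
    have nf: "norm (fst z) \<le> norm z" "norm (snd z) \<le> norm z" for z :: "'u \<times> 'v"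
      by (cases z; simp add: norm_fst_le norm_snd_le)+
    have lipk: "norm (?G (w (Suc k)) - ?G (w k)) \<le> L * ?n"
      using lipschitz_onD[OF lip, of "w (Suc k)" "w k"] by (simp add: dist_norm du_def dv_def)
    have fz: "fst (z k) = fst (?G (w (Suc k)) - ?G (w k)) - fst (?QH (du k, 0)) - S (du k)
        + A (((\<tau> - 1) * \<sigma>) *\<^sub>R r (Suc k) + \<sigma> *\<^sub>R Bs (dv k))"
      unfolding z_def x_step s_eq' r_def[symmetric]
      by (simp add: linear_add[OF A] linear_diff[OF A] linear_scale[OF A] algebra_simps)
    have sz: "snd (z k) = snd (?G (w (Suc k)) - ?G (w k)) - snd (?QH (d k)) - T (dv k)
        + B (((\<tau> - 1) * \<sigma>) *\<^sub>R r (Suc k))"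
      unfolding z_def x_step r_def[symmetric]
      by (simp add: linear_add[OF B] linear_diff[OF B] linear_scale[OF B] algebra_simps)
    have f1: "norm (fst (?G (w (Suc k)) - ?G (w k))) \<le> L * ?n" "norm (snd (?G (w (Suc k)) - ?G (w k))) \<le> L * ?n"
      by (rule order_trans[OF nf(1) lipk], rule order_trans[OF nf(2) lipk])
    have "norm (?QH (du k, 0)) \<le> K * norm (du k)" using K(2)[of "(du k, 0)"] by (simp add: norm_Pair)
    also have "\<dots> \<le> K * ?n" using du K by (intro mult_left_mono) auto
    finally have f2: "norm (fst (?QH (du k, 0))) \<le> K * ?n"
      by (rule order_trans[OF nf(1)])
    have f3: "norm (snd (?QH (d k))) \<le> K * ?n"
      by (rule order_trans[OF nf(2) K(2)])
    have f4: "norm (S (du k)) \<le> KS * ?n"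
      by (rule order_trans[OF KS(2) mult_left_mono[OF du order_less_imp_le[OF KS(1)]]])
    have f5: "norm (T (dv k)) \<le> KT * ?n"
      by (rule order_trans[OF KT(2) mult_left_mono[OF dv order_less_imp_le[OF KT(1)]]])
    have nr: "norm (((\<tau> - 1) * \<sigma>) *\<^sub>R r (Suc k)) = \<bar>\<tau> - 1\<bar> * \<sigma> * ?\<rho>" using sigma by (simp add: abs_mult)
    have "norm (\<sigma> *\<^sub>R Bs (dv k)) \<le> \<sigma> * (Kb * ?n)"
      using order_trans[OF Kb(2) mult_left_mono[OF dv order_less_imp_le[OF Kb(1)]]] sigma by simp
    then have "norm (((\<tau> - 1) * \<sigma>) *\<^sub>R r (Suc k) + \<sigma> *\<^sub>R Bs (dv k)) \<le> \<bar>\<tau> - 1\<bar> * \<sigma> * ?\<rho> + \<sigma> * (Kb * ?n)"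
      using norm_triangle_ineq[of "((\<tau> - 1) * \<sigma>) *\<^sub>R r (Suc k)" "\<sigma> *\<^sub>R Bs (dv k)"] nr by linarith
    then have f6: "norm (A (((\<tau> - 1) * \<sigma>) *\<^sub>R r (Suc k) + \<sigma> *\<^sub>R Bs (dv k))) \<le> KA * (\<bar>\<tau> - 1\<bar> * \<sigma> * ?\<rho> + \<sigma> * (Kb * ?n))"
      using KA by (meson mult_left_mono order_less_imp_le order_trans)
    have f7: "norm (B (((\<tau> - 1) * \<sigma>) *\<^sub>R r (Suc k))) \<le> KB * (\<bar>\<tau> - 1\<bar> * \<sigma> * ?\<rho>)"
      using KB(2)[of "((\<tau> - 1) * \<sigma>) *\<^sub>R r (Suc k)"] unfolding nr .
    have tri: "norm (a - b - c' + d') \<le> norm a + norm b + norm c' + norm d'" for a b c' d' :: "'b::real_normed_vector"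
      by (rule order_trans[OF norm_triangle_ineq])
        (intro add_right_mono order_trans[OF norm_triangle_ineq4] order_refl)
    have a: "norm (fst (z k)) \<le> L * ?n + K * ?n + KS * ?n + KA * (\<bar>\<tau> - 1\<bar> * \<sigma> * ?\<rho> + \<sigma> * (Kb * ?n))"
      unfolding fz by (rule order_trans[OF tri]) (intro add_mono f1 f2 f4 f6)
    have b: "norm (snd (z k)) \<le> L * ?n + K * ?n + KT * ?n + KB * (\<bar>\<tau> - 1\<bar> * \<sigma> * ?\<rho>)"
      unfolding sz by (rule order_trans[OF tri]) (intro add_mono f1 f3 f5 f7)
    have "norm (z k) \<le> norm (fst (z k)) + norm (snd (z k))"
      by (metis norm_Pair_le prod.collapse)
    also have "\<dots> \<le> (2 * L + 2 * K + KS + KT + KA * (\<sigma> * Kb)) * ?n + (KA * (\<bar>\<tau> - 1\<bar> * \<sigma>) + KB * (\<bar>\<tau> - 1\<bar> * \<sigma>)) * ?\<rho>"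
      using a b by (simp add: algebra_simps)
    also have "\<dots> \<le> M * ?n + M * ?\<rho>"
    proof -
      have "0 \<le> KA * (\<bar>\<tau> - 1\<bar> * \<sigma>)" "0 \<le> KB * (\<bar>\<tau> - 1\<bar> * \<sigma>)" "0 \<le> KA * (\<sigma> * Kb)"
        using KA KB Kb sigma by auto
      then have "2 * L + 2 * K + KS + KT + KA * (\<sigma> * Kb) \<le> M"
        "KA * (\<bar>\<tau> - 1\<bar> * \<sigma>) + KB * (\<bar>\<tau> - 1\<bar> * \<sigma>) \<le> M"
        unfolding M_def distrib_left using L K(1) KS(1) KT(1) by linarith+
      then show ?thesis by (intro add_mono mult_right_mono) auto
    qed
    finally show ?thesis by (simp add: distrib_left)
  qed
  show thesis
  proof
    show "F_map p q ?G A B (u (Suc k)) (v (Suc k)) (x (Suc k)) \<noteq> {}" for k using zF[of k] by blast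
    fix k
    let ?n = "norm (d k)" and ?\<rho> = "norm (r (Suc k))"
    have "infdist 0 (F_map p q ?G A B (u (Suc k)) (v (Suc k)) (x (Suc k))) \<le> norm (z k)"
      using infdist_le[OF zF[of k], of 0] by simp
    then have "(infdist 0 (F_map p q ?G A B (u (Suc k)) (v (Suc k)) (x (Suc k))))\<^sup>2 \<le> (M * (?n + ?\<rho>))\<^sup>2"
      using zM[of k] infdist_nonneg by (intro power_mono) auto
    also have "\<dots> = M\<^sup>2 * (?n + ?\<rho>)\<^sup>2" by (rule power_mult_distrib)
    also have "\<dots> \<le> M\<^sup>2 * (2 * (?n\<^sup>2 + ?\<rho>\<^sup>2))"
      using sum_squares_bound[of ?n ?\<rho>] by (intro mult_left_mono) (auto simp: power2_sum)
    finally have "residual p q ?G A B c (u (Suc k)) (v (Suc k)) (x (Suc k)) \<le> M\<^sup>2 * (2 * (?n\<^sup>2 + ?\<rho>\<^sup>2)) + ?\<rho>\<^sup>2"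
      unfolding residual_def r_def[symmetric] by simp
    also have "\<dots> \<le> (2 * M\<^sup>2 + 1) * (?n\<^sup>2 + ?\<rho>\<^sup>2)" by (simp add: algebra_simps)
    finally show "residual p q ?G A B c (u (Suc k)) (v (Suc k)) (x (Suc k)) \<le> (2 * M\<^sup>2 + 1) * (?n\<^sup>2 + ?\<rho>\<^sup>2)" .
  qed
qed

end

text \<open>A minimum is at most any average. Averaging over all indices gives the constant;
  averaging over the upper half, from \<open>k div 2\<close> to \<open>k\<close>, gives twice a
  difference of partial sums with the same limit, which tends to 0.\<close>

lemma min_of_summable:
  fixes \<rho> :: "nat \<Rightarrow> real"
  assumes nn: "\<And>i. 0 \<le> \<rho> i" and sm: "summable \<rho>"
  shows "\<exists>C. \<forall>k\<ge>1. Min (\<rho> ` {1..k}) \<le> C / real k"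
    and "(\<lambda>k. real k * Min (\<rho> ` {1..k})) \<longlonglongrightarrow> 0"
proof -
  define m where "m k = Min (\<rho> ` {1..k})" for k
  have mle: "m k \<le> \<rho> i" if "1 \<le> i" "i \<le> k" for i k
    unfolding m_def using that by (intro Min_le) auto
  have m0: "0 \<le> m k" if "1 \<le> k" for k
    unfolding m_def using that nn by (subst Min_ge_iff) auto
  have block: "real (k - j) * m k \<le> sum \<rho> {..<Suc k} - sum \<rho> {..<Suc j}" if "j \<le> k" for j k
  proof -
    have "real (card {Suc j..<Suc k}) * m k \<le> sum \<rho> {Suc j..<Suc k}"
      by (rule sum_bounded_below) (auto intro: mle)
    also have "\<dots> = sum \<rho> {..<Suc k} - sum \<rho> {..<Suc j}"
      using that by (subst sum_diff[symmetric]) (auto intro!: sum.cong)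
    finally show ?thesis by simp
  qed
  have "m k \<le> suminf \<rho> / real k" if "k \<ge> 1" for k
  proof -
    have "real k * m k \<le> sum \<rho> {..<Suc k} - sum \<rho> {..<Suc 0}" using block[of 0 k] by simp
    also have "\<dots> \<le> sum \<rho> {..<Suc k}" using nn[of 0] by simp
    also have "\<dots> \<le> suminf \<rho>" using sm nn by (intro sum_le_suminf) auto
    finally show ?thesis using that by (simp add: pos_le_divide_eq mult.commute)
  qed
  then show "\<exists>C. \<forall>k\<ge>1. Min (\<rho> ` {1..k}) \<le> C / real k" unfolding m_def by blast
  have "(\<lambda>n. sum \<rho> {..<n}) \<longlonglongrightarrow> suminf \<rho>" by (rule summable_LIMSEQ[OF sm])
  moreover have "filterlim (\<lambda>k. Suc k) sequentially sequentially" by (rule filterlim_Suc)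
  moreover have "filterlim (\<lambda>k. Suc (k div 2)) sequentially sequentially"
    unfolding filterlim_at_top eventually_sequentially
  proof
    show "\<exists>N. \<forall>n\<ge>N. Z \<le> Suc (n div 2)" for Z by (intro exI[of _ "2 * Z"]) auto
  qed
  ultimately have "(\<lambda>k. sum \<rho> {..<Suc k}) \<longlonglongrightarrow> suminf \<rho>" "(\<lambda>k. sum \<rho> {..<Suc (k div 2)}) \<longlonglongrightarrow> suminf \<rho>"
    by (auto dest: filterlim_compose)
  then have "(\<lambda>k. 2 * (sum \<rho> {..<Suc k} - sum \<rho> {..<Suc (k div 2)})) \<longlonglongrightarrow> 2 * (suminf \<rho> - suminf \<rho>)"
    by (intro tendsto_intros)
  then have lim: "(\<lambda>k. 2 * (sum \<rho> {..<Suc k} - sum \<rho> {..<Suc (k div 2)})) \<longlonglongrightarrow> 0" by simp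
  have "(\<lambda>k. real k * m k) \<longlonglongrightarrow> 0"
  proof (rule tendsto_sandwich[OF _ _ tendsto_const lim])
    show "\<forall>\<^sub>F k in sequentially. 0 \<le> real k * m k"
      using m0 by (intro eventually_sequentiallyI[of 1]) auto
    show "\<forall>\<^sub>F k in sequentially. real k * m k \<le> 2 * (sum \<rho> {..<Suc k} - sum \<rho> {..<Suc (k div 2)})"
    proof (rule eventually_sequentiallyI[of 1])
      fix k :: nat assume k: "1 \<le> k"
      have "real k \<le> 2 * real (k - k div 2)" by linarith
      then have "real k * m k \<le> 2 * real (k - k div 2) * m k" using m0[OF k] by (rule mult_right_mono)
      also have "\<dots> = 2 * (real (k - k div 2) * m k)" by (rule mult.assoc)
      also have "\<dots> \<le> 2 * (sum \<rho> {..<Suc k} - sum \<rho> {..<Suc (k div 2)})"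
        using block[of "k div 2" k] by (intro mult_left_mono) auto
      finally show "real k * m k \<le> 2 * (sum \<rho> {..<Suc k} - sum \<rho> {..<Suc (k div 2)})" .
    qed
  qed
  then show "(\<lambda>k. real k * Min (\<rho> ` {1..k})) \<longlonglongrightarrow> 0" unfolding m_def .
qed

text \<open>The first conjunct gives the rates their meaning: \<open>infdist\<close> to the empty
  set is 0, so the distance to an empty value of \<open>F_map\<close> would vanish for no good
  reason.\<close>

theorem theorem4p2:
  fixes p :: "'u::euclidean_space \<Rightarrow> ereal"
    and q :: "'v::euclidean_space \<Rightarrow> ereal"
    and \<phi> :: "'u \<times> 'v \<Rightarrow> real"
    and grad :: "'u \<times> 'v \<Rightarrow> 'u \<times> 'v"
    and A :: "'x::euclidean_space \<Rightarrow> 'u"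
    and B :: "'x \<Rightarrow> 'v"
    and c :: 'x
    and Q :: "'u \<times> 'v \<Rightarrow> 'u \<times> 'v"
    and D1 :: "'u \<Rightarrow> 'u" and D2 :: "'v \<Rightarrow> 'v"
    and S :: "'u \<Rightarrow> 'u" and T :: "'v \<Rightarrow> 'v"
    and \<eta> \<sigma> \<tau> :: real
    and u :: "nat \<Rightarrow> 'u" and v :: "nat \<Rightarrow> 'v" and x :: "nat \<Rightarrow> 'x"
  assumes p: "closed_proper_convex p"
    and q: "closed_proper_convex q"
    and phi_convex: "convex_on UNIV \<phi>"
    and phi_grad: "\<And>w. (\<phi> has_derivative (\<lambda>h. grad w \<bullet> h)) (at w)"
    and grad_lipschitz: "\<exists>L. \<forall>w w'. norm (grad w - grad w') \<le> L * norm (w - w')"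
    and A_lin: "linear A" and B_lin: "linear B"
    and Q: "sa_psd Q" and D1: "sa_psd D1" and D2: "sa_psd D2"
    and hess_bounds: "\<And>w W. W \<in> gen_hessian grad w \<Longrightarrow>
          loewner_le Q (blinfun_apply W) \<and>
          loewner_le (blinfun_apply W) (\<lambda>z. Q z + diag_op D1 D2 z)"
    and eta: "0 \<le> \<eta>" "\<eta> \<le> 1"
    and eta_bound: "\<And>z W a b. W \<in> gen_hessian grad z \<Longrightarrow>
          \<bar>a \<bullet> (block12 (blinfun_apply W) b - block12 Q b)\<bar>
            \<le> \<eta> / 2 * (gnorm2 D1 a + gnorm2 D2 b)"
    and sigma: "\<sigma> > 0" and tau: "\<tau> > 0"
    and S: "sa_psd S" and T: "sa_psd T"
    and sol_nonempty: "solution_set p q \<phi> A B c \<noteq> {}"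
    and slater: "\<exists>uh vh. (uh, vh) \<in> rel_interior (edom p \<times> edom q) \<and>
                   adjoint A uh + adjoint B vh = c"
    and init: "u 0 \<in> edom p" "v 0 \<in> edom q"
    and u_step: "\<And>k u'.
          L_hat p q \<phi> grad (\<lambda>z. Q z + diag_op D1 D2 z) A B c \<sigma> (u (Suc k), v k) (x k) (u k, v k)
            + ereal (1/2 * gnorm2 S (u (Suc k) - u k))
          \<le> L_hat p q \<phi> grad (\<lambda>z. Q z + diag_op D1 D2 z) A B c \<sigma> (u', v k) (x k) (u k, v k)
            + ereal (1/2 * gnorm2 S (u' - u k))"
    and v_step: "\<And>k v'.
          L_hat p q \<phi> grad (\<lambda>z. Q z + diag_op D1 D2 z) A B c \<sigma> (u (Suc k), v (Suc k)) (x k) (u k, v k)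
            + ereal (1/2 * gnorm2 T (v (Suc k) - v k))
          \<le> L_hat p q \<phi> grad (\<lambda>z. Q z + diag_op D1 D2 z) A B c \<sigma> (u (Suc k), v') (x k) (u k, v k)
            + ereal (1/2 * gnorm2 T (v' - v k))"
    and x_step: "\<And>k. x (Suc k) = x k + (\<tau> * \<sigma>) *\<^sub>R
                         (adjoint A (u (Suc k)) + adjoint B (v (Suc k)) - c)"
    and cond: "(\<tau> \<le> 1 \<and>
               op_pd (\<lambda>z. (1/4) *\<^sub>R Q z +
                  diag_op (\<lambda>a. S a + ((1 - \<tau>) * \<sigma>) *\<^sub>R A (adjoint A a))
                          (\<lambda>b. T b + ((1 - \<tau>) * \<sigma>) *\<^sub>R B (adjoint B b)) z))
             \<or> (\<tau> < (1 + sqrt 5) / 2 \<and>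
               op_psd (\<lambda>z. (1/4) *\<^sub>R Q z +
                  diag_op (\<lambda>a. S a - \<eta> *\<^sub>R D1 a) (\<lambda>b. T b - \<eta> *\<^sub>R D2 b) z) \<and>
               op_pd (\<lambda>z. (1/4) *\<^sub>R Q z +
                  diag_op (\<lambda>a. S a + \<sigma> *\<^sub>R A (adjoint A a) - \<eta> *\<^sub>R D1 a)
                          (\<lambda>b. T b + \<sigma> *\<^sub>R B (adjoint B b) - \<eta> *\<^sub>R D2 b) z))"
  shows "(\<forall>i\<ge>1. F_map p q grad A B (u (Suc i)) (v (Suc i)) (x (Suc i)) \<noteq> {}) \<and>
         (\<exists>C. \<forall>k\<ge>1.
            Min ((\<lambda>i. residual p q grad A B c (u (Suc i)) (v (Suc i)) (x (Suc i))) ` {1..k})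
              \<le> C / real k) \<and>
         (\<lambda>k. real k *
            Min ((\<lambda>i. residual p q grad A B c (u (Suc i)) (v (Suc i)) (x (Suc i))) ` {1..k}))
           \<longlonglongrightarrow> 0"
proof -
  \<comment> \<open>The given constant may be negative, while \<open>lipschitz_on\<close> includes
    nonnegativity; hence the absolute value.\<close>
  obtain L where "\<And>w w'. norm (grad w - grad w') \<le> L * norm (w - w')" using grad_lipschitz by blast
  then have "norm (grad w - grad w') \<le> \<bar>L\<bar> * norm (w - w')" for w w'
    by (rule order_trans[OF _ mult_right_mono]) auto
  then have "\<bar>L\<bar>-lipschitz_on UNIV grad"
    by (intro lipschitz_onI) (simp_all add: dist_norm)
  then have lip: "\<exists>L. L-lipschitz_on UNIV grad" by blast
  have p': "ext_convex p" "\<And>z. p z \<noteq> -\<infinity>" and q': "ext_convex q" "\<And>z. q z \<noteq> -\<infinity>"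
    using p q by (auto simp: closed_proper_convex_def)
  let ?H = "diag_op D1 D2" and ?QH = "\<lambda>z. Q z + diag_op D1 D2 z"
  have QH: "sa_psd ?QH"
    using Q sa_psd_diag_op[OF D1 D2] unfolding sa_psd_def
    by (auto simp: linear_compose_add inner_add_left inner_add_right)
  interpret bh: bounded_hessian \<phi> grad Q D1 D2 \<eta>
    by unfold_locales (use phi_grad lip Q D1 D2 hess_bounds eta_bound in blast)+
  have grad_eq: "bh.gpsi w + Q w = grad w" for w by (simp add: bh.gpsi_def)
  obtain w0 where w0: "w0 \<in> solution_set p q \<phi> A B c" using sol_nonempty by blast
  obtain wh where wh: "wh \<in> rel_interior (edom p \<times> edom q)" "constr A B c wh = 0"
    using slater by (auto simp: constr_def)
  obtain xs where xs: "- (fst (grad w0) + A xs) \<in> subdiff p (fst w0)" "- (snd (grad w0) + B xs) \<in> subdiff q (snd w0)"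
    by (rule KKT_multiplier[OF p' q' phi_grad A_lin B_lin w0 wh])
  have inl: "linear (\<lambda>a::'u. (a, 0::'v))" and inr: "linear (\<lambda>b::'v. (0::'u, b))"
    by (auto simp: linear_iff)
  have u_sub: "u (Suc k) \<in> edom p"
    "- (fst (grad (u k, v k) + ?QH (u (Suc k) - u k, 0)) + A (x k + \<sigma> *\<^sub>R constr A B c (u (Suc k), v k))
      + S (u (Suc k) - u k)) \<in> subdiff p (u (Suc k))"
    if k: "u k \<in> edom p" "v k \<in> edom q" for k
  proof -
    have min: "p (u (Suc k)) + ereal (phi_hat \<phi> grad ?QH ((u (Suc k), 0) + (0, v k)) (u k, v k)
          + x k \<bullet> constr A B c ((u (Suc k), 0) + (0, v k))
          + \<sigma> / 2 * (norm (constr A B c ((u (Suc k), 0) + (0, v k))))\<^sup>2 + 1/2 * gnorm2 S (u (Suc k) - u k) + real_of_ereal (q (v k)))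
        \<le> p a + ereal (phi_hat \<phi> grad ?QH ((a, 0) + (0, v k)) (u k, v k) + x k \<bullet> constr A B c ((a, 0) + (0, v k))
          + \<sigma> / 2 * (norm (constr A B c ((a, 0) + (0, v k))))\<^sup>2 + 1/2 * gnorm2 S (a - u k) + real_of_ereal (q (v k)))" for a
      using u_step[of k a] unfolding L_hat_split(1)[OF p'(2) q'(2) k(2)] by simp
    note sub = block_step_subgradient[where J="\<lambda>a. (a, 0)" and pr=fst and P=p, OF p' inl QH S A_lin B_lin k(1) _ min]
    show "u (Suc k) \<in> edom p" by (rule sub(1)) (simp add: inner_prod_def)
    show "- (fst (grad (u k, v k) + ?QH (u (Suc k) - u k, 0)) + A (x k + \<sigma> *\<^sub>R constr A B c (u (Suc k), v k))
      + S (u (Suc k) - u k)) \<in> subdiff p (u (Suc k))"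
      using sub(2) by (simp add: inner_prod_def)
  qed
  have v_sub: "v (Suc k) \<in> edom q"
    "- (snd (grad (u k, v k) + ?QH (u (Suc k) - u k, v (Suc k) - v k)) + B (x k + \<sigma> *\<^sub>R constr A B c (u (Suc k), v (Suc k)))
      + T (v (Suc k) - v k)) \<in> subdiff q (v (Suc k))"
    if k: "u (Suc k) \<in> edom p" "v k \<in> edom q" for k
  proof -
    have min: "q (v (Suc k)) + ereal (phi_hat \<phi> grad ?QH ((0, v (Suc k)) + (u (Suc k), 0)) (u k, v k)
          + x k \<bullet> constr A B c ((0, v (Suc k)) + (u (Suc k), 0))
          + \<sigma> / 2 * (norm (constr A B c ((0, v (Suc k)) + (u (Suc k), 0))))\<^sup>2 + 1/2 * gnorm2 T (v (Suc k) - v k) + real_of_ereal (p (u (Suc k))))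
        \<le> q b + ereal (phi_hat \<phi> grad ?QH ((0, b) + (u (Suc k), 0)) (u k, v k) + x k \<bullet> constr A B c ((0, b) + (u (Suc k), 0))
          + \<sigma> / 2 * (norm (constr A B c ((0, b) + (u (Suc k), 0))))\<^sup>2 + 1/2 * gnorm2 T (b - v k) + real_of_ereal (p (u (Suc k))))" for b
      using v_step[of k b] unfolding L_hat_split(2)[OF p'(2) q'(2) k(1)] by simp
    note sub = block_step_subgradient[where J="\<lambda>b. (0, b)" and pr=snd and P=q, OF q' inr QH T A_lin B_lin k(2) _ min]
    show "v (Suc k) \<in> edom q" by (rule sub(1)) (simp add: inner_prod_def)
    show "- (snd (grad (u k, v k) + ?QH (u (Suc k) - u k, v (Suc k) - v k)) + B (x k + \<sigma> *\<^sub>R constr A B c (u (Suc k), v (Suc k)))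
      + T (v (Suc k) - v k)) \<in> subdiff q (v (Suc k))"
      using sub(2) by (simp add: inner_prod_def)
  qed
  \<comment> \<open>Each block step needs a finite value of the other block function, so the two
    memberships are carried along jointly: old v for the u-step, new u for the v-step.\<close>
  have dom: "u k \<in> edom p \<and> v k \<in> edom q" for k
    by (induction k) (use init u_sub(1) v_sub(1) in blast)+
  interpret ad: majorized_admm p q bh.gpsi Q A B c D1 S D2 T \<eta> \<sigma> \<tau> u v x "fst w0" "snd w0" xs
  proof (rule majorized_admm.intro)
    show "- gnorm2 ?H (w' - w) / 2 \<le> (w' - z) \<bullet> (bh.gpsi w - bh.gpsi z)" for w w' z
      unfolding gnorm2_def by (rule bh.gpsi_three_points)
    show "x (Suc k) = x k + (\<tau> * \<sigma>) *\<^sub>R constr A B c (u (Suc k), v (Suc k))" for k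
      using x_step[of k] by (simp add: constr_def)
    show "constr A B c (fst w0, snd w0) = 0" using w0 by (simp add: solution_set_def)
    show "- (fst (bh.gpsi (u k, v k) + Q (u k, v k) + ?QH (u (Suc k) - u k, 0))
        + A (x k + \<sigma> *\<^sub>R constr A B c (u (Suc k), v k)) + S (u (Suc k) - u k)) \<in> subdiff p (u (Suc k))" for k
      unfolding grad_eq using dom by (intro u_sub(2)) auto
    show "- (snd (bh.gpsi (u k, v k) + Q (u k, v k) + ?QH (u (Suc k) - u k, v (Suc k) - v k))
        + B (x k + \<sigma> *\<^sub>R constr A B c (u (Suc k), v (Suc k))) + T (v (Suc k) - v k)) \<in> subdiff q (v (Suc k))" for k
      unfolding grad_eq using dom by (intro v_sub(2)) auto
  qed (use p' q' Q D1 D2 S T A_lin B_lin sigma tau eta xs bh.gpsi_cross_12 bh.gpsi_cross_22 in \<open>auto simp: grad_eq\<close>)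
  have lip': "\<exists>L. L-lipschitz_on UNIV (\<lambda>w. bh.gpsi w + Q w)" using lip by (simp add: grad_eq)
  then obtain C where C: "\<And>k. F_map p q grad A B (u (Suc k)) (v (Suc k)) (x (Suc k)) \<noteq> {}"
    "\<And>k. residual p q grad A B c (u (Suc k)) (v (Suc k)) (x (Suc k))
          \<le> C * ((norm (ad.du k, ad.dv k))\<^sup>2 + (norm (ad.r (Suc k)))\<^sup>2)"
    using ad.residual_bound unfolding grad_eq by metis
  have "summable (\<lambda>k. (norm (ad.du k, ad.dv k))\<^sup>2) \<and> summable (\<lambda>k. (norm (ad.r (Suc k)))\<^sup>2)"
    using cond ad.summable_small_tau ad.summable_large_tau by blast
  then have sum: "summable (\<lambda>k. C * ((norm (ad.du k, ad.dv k))\<^sup>2 + (norm (ad.r (Suc k)))\<^sup>2))"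
    by (intro summable_mult summable_add) auto
  define \<rho> where "\<rho> i = residual p q grad A B c (u (Suc i)) (v (Suc i)) (x (Suc i))" for i
  have nonneg: "0 \<le> \<rho> i" for i by (simp add: \<rho>_def residual_def)
  have "summable \<rho>"
  proof (rule summable_comparison_test'[OF sum, of 0])
    show "norm (\<rho> k) \<le> C * ((norm (ad.du k, ad.dv k))\<^sup>2 + (norm (ad.r (Suc k)))\<^sup>2)" for k
      using C(2)[of k] nonneg[of k] by (simp add: \<rho>_def)
  qed
  from min_of_summable[OF nonneg this] C(1) show ?thesis unfolding \<rho>_def by blast
qed

end
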